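(* The algebras $F$ and $\widetilde H(R_0)$ are naturally isomorphic under the bijection $\mathbf x:\mathrm{Par}\to\mathcal{IM}_0$; the isomorphism sends $(\lambda)$ to $\mathbf 1_{\mathbf x(\lambda)}$ and, for each arrow $\lambda\to\mu$, $(\lambda|\mu)$ to the crossingless diagram with a single dot having bottom $\mathbf x(\lambda)$ and top $\mathbf x(\mu)$.
   Context: $\mathbf{k}$ is a field of characteristic zero. $\mathrm{Par}$ is the set of all partitions. The algebra $F$: $\Gamma$ is the quiver with vertex set $\mathrm{Par}$ and an arrow $\lambda\to\mu$ if $\lambda\subset\mu$, $|\mu|=|\lambda|+1$. $F$ is the path algebra $\mathbf k\Gamma$ (idempotents $(\lambda)$, arrows $(\lambda|\mu)$) modulo $(\lambda|\mu)(\mu|\eta)=(\lambda|\nu)(\nu|\eta)$ whenever $\lambda\to\mu\to\eta$ and $\lambda\to\nu\to\eta$, and $(\lambda|\mu)(\mu|\eta)=0$ whenever the skew shape $\eta\backslash\lambda$ is a vertical domino $(1^2)$. The DG algebra $R$: $\mathcal{M}$ is the set of sequences $\mathbf{x}=(x_1,x_2,\dots)$ of even integers with $x_i=x_{i-1}+2$ for $i\gg0$; $\mathcal{M}_k$ is the subset with $x_i=2i+2k$ for $i\gg0$; $\mathcal{IM}_k\subset\mathcal M_k$ consists of the strictly increasing sequences. $\odot$ is concatenation of sequences / horizontal juxtaposition of diagrams. $R$ is the graded $\mathbf{k}$-algebra generated by diagrams (read bottom to top; all labels even): idempotents $\mathbf 1_{\mathbf x}$ ($\mathbf x\in\mathcal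 M$, vertical strands), degree $0$; crossings $cr_{i,j}(\mathbf a,\mathbf x)$ with bottom $\mathbf a\odot(j,i)\odot\mathbf x$, top $\mathbf a\odot(i,j)\odot\mathbf x$, degree $1$ if $i<j$ and $-1$ if $i\ge j$; dots $dot_i(\mathbf a,\mathbf x)$ with bottom $\mathbf a\odot(i+2)\odot\mathbf x$, top $\mathbf a\odot(i)\odot\mathbf x$, degree $0$ ($\mathbf a$ a finite even sequence, $\mathbf x\in\mathcal M$). $fg$ is vertical concatenation, $f$ at the bottom, $g$ at the top, zero unless labels match. Local relations (with arbitrary vertical strands added left and right): vertical strands are idempotents and disjoint diagrams supercommute; $dot_{i+2}\cdot dot_i=0$; $cr_{j,i}\cdot cr_{i,j}=(1-\delta_{i,j})\mathbf 1_{(i,j)}$; braid relation for all labels; dot-slide $dot_i\odot\mathbf 1_j=cr_{j,i+2}\cdot(\mathbf 1_j\odot dot_i)\cdot cr_{i,j}$ for all $i,j$. ($R$ also carries a differential with $d(cr_{i,i}(\mathbf a,\mathbf x))=\mathbf 1_{\mathbf a\odot(i,i)\odot\mathbf x}$; it vanishes on $\mathbf 1_{\mathbf x}R\mathbf 1_{\mathbf y}$ when $\mathbf x,\mathbf y$ have no repeated entries.) $\widetilde H(R_0)=\bigoplus_{\mathbf x,\mathbf y\in\mathcal{IM}_0}\mathbf 1_{\mathbf x}R\mathbf 1_{\mathbf y}$, a subalgebra of $R$. The bijection $\mathbf x:\mathrm{Par}\to\mathcal{IM}_0$ is $\mathbf x(\lambda)=(2-2\bar\lambda_1,4-2\bar\lambda_2,\dots,2k-2\bar\lambda_k,2(k+1),\dots)$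 with $\bar\lambda=(\bar\lambda_1,\dots,\bar\lambda_k)$ the dual (transpose) partition of $\lambda$. *)

theory Defs
  imports
    "Graph_Theory.Arc_Walk"
    "HOL-Library.Poly_Mapping"
    "HOL-Library.More_List"
    "HOL-Library.Stream"
begin

section \<open>Algebras without unit\<close>

text \<open>The algebras below have infinitely many orthogonal idempotents and hence no unit, so the
  rings of HOL-Algebra, which carry a unit, do not apply.\<close>

record ('a, 'k) nualgebra =
  car :: "'a set"
  zer :: 'a
  add :: "'a \<Rightarrow> 'a \<Rightarrow> 'a"
  mul :: "'a \<Rightarrow> 'a \<Rightarrow> 'a"
  scl :: "'k \<Rightarrow> 'a \<Rightarrow> 'a"

definition subspace_of :: "('a, 'k) nualgebra \<Rightarrow> 'a set \<Rightarrow> bool" where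
  "subspace_of A V \<longleftrightarrow> V \<subseteq> car A \<and> zer A \<in> V \<and>
     (\<forall>x\<in>V. \<forall>y\<in>V. add A x y \<in> V) \<and> (\<forall>c. \<forall>x\<in>V. scl A c x \<in> V)"

definition linspan :: "('a, 'k) nualgebra \<Rightarrow> 'a set \<Rightarrow> 'a set" where
  "linspan A S = \<Inter> {V. subspace_of A V \<and> S \<subseteq> V}"

definition two_sided_ideal :: "('a, 'k) nualgebra \<Rightarrow> 'a set \<Rightarrow> bool" where
  "two_sided_ideal A I \<longleftrightarrow> subspace_of A I \<and>
     (\<forall>a\<in>car A. \<forall>x\<in>I. mul A a x \<in> I \<and> mul A x a \<in> I)"

definition ideal_gen :: "('a, 'k) nualgebra \<Rightarrow> 'a set \<Rightarrow> 'a set" where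
  "ideal_gen A S = \<Inter> {I. two_sided_ideal A I \<and> S \<subseteq> I}"

definition coset :: "('a, 'k) nualgebra \<Rightarrow> 'a set \<Rightarrow> 'a \<Rightarrow> 'a set" where
  "coset A I x = (\<lambda>i. add A x i) ` I"

definition quot :: "('a, 'k) nualgebra \<Rightarrow> 'a set \<Rightarrow> ('a set, 'k) nualgebra" where
  "quot A I = \<lparr>
     car = coset A I ` car A,
     zer = I,
     add = (\<lambda>X Y. \<Union>x\<in>X. \<Union>y\<in>Y. coset A I (add A x y)),
     mul = (\<lambda>X Y. \<Union>x\<in>X. \<Union>y\<in>Y. coset A I (mul A x y)),
     scl = (\<lambda>c X. \<Union>x\<in>X. coset A I (scl A c x)) \<rparr>"

definition algebra_iso :: "('a, 'k) nualgebra \<Rightarrow> ('b, 'k) nualgebra \<Rightarrow> ('a \<Rightarrow> 'b) \<Rightarrow> bool" where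
  "algebra_iso A B \<Phi> \<longleftrightarrow> bij_betw \<Phi> (car A) (car B) \<and>
     (\<forall>x\<in>car A. \<forall>y\<in>car A. \<Phi> (add A x y) = add B (\<Phi> x) (\<Phi> y)) \<and>
     (\<forall>x\<in>car A. \<forall>y\<in>car A. \<Phi> (mul A x y) = mul B (\<Phi> x) (\<Phi> y)) \<and>
     (\<forall>c. \<forall>x\<in>car A. \<Phi> (scl A c x) = scl B c (\<Phi> x))"

section \<open>Path algebras\<close>

text \<open>A path is a pair of its start vertex and its list of arrows; the start vertex is recorded
  because of the paths of length zero. Paths compose from left to right: the product \<open>pq\<close> is \<open>p\<close> followed by \<open>q\<close>.\<close>

type_synonym ('v, 'e) path = "'v \<times> 'e list"

definition paths :: "('v, 'e) pre_digraph \<Rightarrow> ('v, 'e) path set" where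
  "paths G = {(u, p). \<exists>v. pre_digraph.awalk G u p v}"

definition path_mult ::
  "('v, 'e) pre_digraph \<Rightarrow> (('v, 'e) path \<Rightarrow>\<^sub>0 'k::field) \<Rightarrow> (('v, 'e) path \<Rightarrow>\<^sub>0 'k) \<Rightarrow> (('v, 'e) path \<Rightarrow>\<^sub>0 'k)"
  where
  "path_mult G f g = (\<Sum>(u, p)\<in>Poly_Mapping.keys f. \<Sum>(v, q)\<in>Poly_Mapping.keys g.
     if pre_digraph.awlast G u p = v
     then Poly_Mapping.single (u, p @ q) (Poly_Mapping.lookup f (u, p) * Poly_Mapping.lookup g (v, q))
     else 0)"

definition path_algebra ::
  "('v, 'e) pre_digraph \<Rightarrow> (('v, 'e) path \<Rightarrow>\<^sub>0 'k::field, 'k) nualgebra" where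
  "path_algebra G = \<lparr>
     car = {f. Poly_Mapping.keys f \<subseteq> paths G},
     zer = 0,
     add = (+),
     mul = path_mult G,
     scl = (\<lambda>c. Poly_Mapping.map ((*) c)) \<rparr>"

definition idem :: "'v \<Rightarrow> (('v, 'e) path \<Rightarrow>\<^sub>0 'k::field)" where
  "idem v = Poly_Mapping.single (v, []) 1"

text \<open>The product of a nonempty list of composable arrows.\<close>

definition arrows :: "('v, 'e) pre_digraph \<Rightarrow> 'e list \<Rightarrow> (('v, 'e) path \<Rightarrow>\<^sub>0 'k::field)" where
  "arrows G es = Poly_Mapping.single (tail G (hd es), es) 1"

section \<open>Partitions\<close>

definition Par :: "nat list set" where
  "Par = {l. sorted_wrt (\<ge>) l \<and> 0 \<notin> set l}"

definition cells :: "nat list \<Rightarrow> (nat \<times> nat) set" where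
  "cells l = {(i, j). i < length l \<and> j < l ! i}"

definition dual :: "nat list \<Rightarrow> nat list" where
  "dual l = map (\<lambda>j. length (filter (\<lambda>p. j < p) l)) [0..<nth_default 0 l 0]"

definition par_arrow :: "nat list \<Rightarrow> nat list \<Rightarrow> bool" where
  "par_arrow l m \<longleftrightarrow> l \<in> Par \<and> m \<in> Par \<and> cells l \<subseteq> cells m \<and> sum_list m = sum_list l + 1"

definition vertical_domino :: "(nat \<times> nat) set \<Rightarrow> bool" where
  "vertical_domino S \<longleftrightarrow> (\<exists>i j. S = {(i, j), (Suc i, j)})"

section \<open>The algebra \<open>F\<close>\<close>

definition Gamma :: "(nat list, nat list \<times> nat list) pre_digraph" where
  "Gamma = \<lparr> verts = Par, arcs = {(l, m). par_arrow l m}, tail = fst, head = snd \<rparr>"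

inductive_set F_rel :: "((nat list, nat list \<times> nat list) path \<Rightarrow>\<^sub>0 'k::field) set" where
  square: "par_arrow l m \<Longrightarrow> par_arrow m h \<Longrightarrow> par_arrow l n \<Longrightarrow> par_arrow n h \<Longrightarrow>
    arrows Gamma [(l, m), (m, h)] - arrows Gamma [(l, n), (n, h)] \<in> F_rel"
| domino: "par_arrow l m \<Longrightarrow> par_arrow m h \<Longrightarrow> vertical_domino (cells h - cells l) \<Longrightarrow>
    arrows Gamma [(l, m), (m, h)] \<in> F_rel"

definition F_ideal :: "((nat list, nat list \<times> nat list) path \<Rightarrow>\<^sub>0 'k::field) set" where
  "F_ideal = ideal_gen (path_algebra Gamma) F_rel"

definition F_alg ::
  "(((nat list, nat list \<times> nat list) path \<Rightarrow>\<^sub>0 'k::field) set, 'k) nualgebra" where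
  "F_alg = quot (path_algebra Gamma) F_ideal"

definition F_class ::
  "((nat list, nat list \<times> nat list) path \<Rightarrow>\<^sub>0 'k::field)
     \<Rightarrow> ((nat list, nat list \<times> nat list) path \<Rightarrow>\<^sub>0 'k) set" where
  "F_class = coset (path_algebra Gamma) F_ideal"

section \<open>Sequences\<close>

text \<open>Sequences are indexed from 1 on paper and from 0 as streams: \<open>x\<^sub>i\<close> is \<open>x !! (i - 1)\<close>.\<close>

definition Mseq :: "int stream set" where
  "Mseq = {x. (\<forall>n. even (x !! n)) \<and> (\<exists>N. \<forall>n\<ge>N. x !! Suc n = x !! n + 2)}"

definition Mseq_at :: "int \<Rightarrow> int stream set" where
  "Mseq_at k = {x \<in> Mseq. \<exists>N. \<forall>n\<ge>N. x !! n = 2 * (int n + 1) + 2 * k}"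

definition IM :: "int \<Rightarrow> int stream set" where
  "IM k = {x \<in> Mseq_at k. strict_mono (\<lambda>n. x !! n)}"

definition xseq :: "nat list \<Rightarrow> int stream" where
  "xseq l = map (\<lambda>i. 2 * (int i + 1) - 2 * int (dual l ! i)) [0..<length (dual l)]
     @- smap (\<lambda>i. 2 * (int i + 1)) (fromN (length (dual l)))"

section \<open>The algebra \<open>R\<close>\<close>

text \<open>Local pieces of diagrams: \<open>Cr i j\<close> is the crossing with bottom \<open>(j, i)\<close> and top \<open>(i, j)\<close>,
  \<open>Dot i\<close> the dot with bottom \<open>(i + 2)\<close> and top \<open>(i)\<close>.\<close>

datatype piece = Cr int int | Dot int

fun bot_word :: "piece \<Rightarrow> int list" where
  "bot_word (Cr i j) = [j, i]"
| "bot_word (Dot i) = [i + 2]"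

fun top_word :: "piece \<Rightarrow> int list" where
  "top_word (Cr i j) = [i, j]"
| "top_word (Dot i) = [i]"

fun deg :: "piece \<Rightarrow> int" where
  "deg (Cr i j) = (if i < j then 1 else - 1)"
| "deg (Dot i) = 0"

definition even_words :: "int list set" where
  "even_words = lists {i. even i}"

definition even_pieces :: "piece set" where
  "even_pieces = {g. bot_word g \<in> even_words}"

text \<open>A generating diagram \<open>(a, g, x)\<close> is the piece \<open>g\<close> with vertical strands \<open>a\<close> to its left and
  \<open>x\<close> to its right. Generated by such diagrams and the idempotents of the sequences, with products
  read from bottom to top and zero unless labels match, \<open>R\<close> is a quotient of a path algebra.\<close>

type_synonym diagram = "int list \<times> piece \<times> int stream"

definition R_quiver :: "(int stream, diagram) pre_digraph" where
  "R_quiver = \<lparr>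
     verts = Mseq,
     arcs = {(a, g, x). a \<in> even_words \<and> g \<in> even_pieces \<and> x \<in> Mseq},
     tail = (\<lambda>(a, g, x). a @- bot_word g @- x),
     head = (\<lambda>(a, g, x). a @- top_word g @- x) \<rparr>"

inductive_set R_rel :: "((int stream, diagram) path \<Rightarrow>\<^sub>0 'k::field) set" where
  supercommute: "a \<in> even_words \<Longrightarrow> c \<in> even_words \<Longrightarrow> x \<in> Mseq \<Longrightarrow>
    g \<in> even_pieces \<Longrightarrow> h \<in> even_pieces \<Longrightarrow>
    arrows R_quiver [(a, g, c @- bot_word h @- x), (a @ top_word g @ c, h, x)]
      - scl (path_algebra R_quiver) ((- 1) powi (deg g * deg h))
          (arrows R_quiver [(a @ bot_word g @ c, h, x), (a, g, c @- top_word h @- x)]) \<in> R_rel"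
| double_dot: "a \<in> even_words \<Longrightarrow> x \<in> Mseq \<Longrightarrow> even i \<Longrightarrow>
    arrows R_quiver [(a, Dot (i + 2), x), (a, Dot i, x)] \<in> R_rel"
| double_crossing: "a \<in> even_words \<Longrightarrow> x \<in> Mseq \<Longrightarrow> even i \<Longrightarrow> even j \<Longrightarrow>
    arrows R_quiver [(a, Cr j i, x), (a, Cr i j, x)]
      - (if i = j then 0 else idem (a @- [i, j] @- x)) \<in> R_rel"
| braid: "a \<in> even_words \<Longrightarrow> x \<in> Mseq \<Longrightarrow> even i \<Longrightarrow> even j \<Longrightarrow> even k \<Longrightarrow>
    arrows R_quiver [(a, Cr j k, i ## x), (a @ [j], Cr i k, x), (a, Cr i j, k ## x)]
      - arrows R_quiver [(a @ [k], Cr i j, x), (a, Cr i k, j ## x), (a @ [i], Cr j k, x)] \<in> R_rel"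
| dot_slide: "a \<in> even_words \<Longrightarrow> x \<in> Mseq \<Longrightarrow> even i \<Longrightarrow> even j \<Longrightarrow>
    arrows R_quiver [(a, Dot i, j ## x)]
      - arrows R_quiver [(a, Cr j (i + 2), x), (a @ [j], Dot i, x), (a, Cr i j, x)] \<in> R_rel"

definition R_ideal :: "((int stream, diagram) path \<Rightarrow>\<^sub>0 'k::field) set" where
  "R_ideal = ideal_gen (path_algebra R_quiver) R_rel"

definition R_alg :: "(((int stream, diagram) path \<Rightarrow>\<^sub>0 'k::field) set, 'k) nualgebra" where
  "R_alg = quot (path_algebra R_quiver) R_ideal"

definition R_class ::
  "((int stream, diagram) path \<Rightarrow>\<^sub>0 'k::field) \<Rightarrow> ((int stream, diagram) path \<Rightarrow>\<^sub>0 'k) set" where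
  "R_class = coset (path_algebra R_quiver) R_ideal"

text \<open>The sum of the subspaces \<open>1\<^sub>x R 1\<^sub>y\<close>, for \<open>x\<close> and \<open>y\<close> in \<open>IM 0\<close>, inside \<open>R\<close>. It is direct
  because the idempotents are orthogonal.\<close>

definition H_tilde :: "(((int stream, diagram) path \<Rightarrow>\<^sub>0 'k::field) set, 'k) nualgebra" where
  "H_tilde = R_alg \<lparr> car := linspan R_alg
     (\<Union>x\<in>IM 0. \<Union>y\<in>IM 0.
       {mul R_alg (mul R_alg (R_class (idem x)) r) (R_class (idem y)) | r. r \<in> car R_alg}) \<rparr>"

definition single_dot_diagrams :: "int stream \<Rightarrow> int stream \<Rightarrow> diagram set" where
  "single_dot_diagrams x y = {e \<in> arcs R_quiver.
     (\<exists>a i z. e = (a, Dot i, z)) \<and> tail R_quiver e = x \<and> head R_quiver e = y}"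

end

theory Submission
  imports Defs "HOL-Library.Multiset"
begin

text \<open>Encode a partition by its increasing sequence \<open>x\<close>; adding a box lowers one entry by 2. On the
  side of \<open>F\<close>, any two paths between the same partitions agree, and they vanish as soon as some
  entry is lowered by 4, so that \<open>F\<close> has at most a one-dimensional space between two vertices.

  On the side of \<open>R\<close>, follow the strands of a diagram whose bottom is strictly increasing, remembering
  the original label of each strand and whether it carries a dot. Adding a dot, or crossing two
  strands whose original labels increase, are the only moves needed: the local relations make these
  moves confluent up to a scalar, and every other generator kills a diagram or undoes such a move. If
  the top is increasing as well, the strands come out in their original order, and only products of
  dots are left.

  That these products are nonzero and independent is seen in a representation of \<open>R\<close> on states of
  distinguishable strands. Crossings are odd, so they act with the signs of a twisted group algebra
  of the symmetric group; on the orderings of distinct strands this cocycle has an explicit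
  trivialisation.\<close>

section \<open>Path algebras and their quotients\<close>

text \<open>The obstacle is that labels collide. A dot turns the label \<open>l\<close> of a strand
  into \<open>l - 2\<close>, which may be the label of a neighbour, and a double crossing of equal
  labels is zero instead of the identity. So current labels neither identify strands nor tell which
  crossings can be undone. The order of the original labels settles both: two strands of equal label
  may cross in one direction only, in the moves as well as in the representation. In the dot slides
  that confluence requires, the crossings to be cancelled always have distinct labels, because
  original labels are distinct and a dot lowers a label by just 2.

  Confluence is used downwards. Every state is reachable from the undotted increasing one, so two
  paths of moves to the same state are compared through their last moves, by induction on the number
  of inversions plus the number of dots. The number of moves is thereby bounded by the state, and
  infinitely many strands cause no trouble: a given diagram involves an initial segment of them, and
  the remaining tail is carried along unchanged.\<close>

definition smul :: "'k::field \<Rightarrow> ('a \<Rightarrow>\<^sub>0 'k) \<Rightarrow> 'a \<Rightarrow>\<^sub>0 'k" where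
  "smul c = Poly_Mapping.map ((*) c)"

lemma lookup_smul [simp]: "Poly_Mapping.lookup (smul c f) a = c * Poly_Mapping.lookup f a"
  by (simp add: smul_def Poly_Mapping.map.rep_eq when_def)

lemma smul_add: "smul c (f + g) = smul c f + smul c g"
  by (rule poly_mapping_eqI) (simp add: lookup_add algebra_simps)

lemma smul_diff: "smul c (f - g) = smul c f - smul c g"
  by (rule poly_mapping_eqI) (simp add: lookup_minus algebra_simps)

lemma smul_zero [simp]: "smul c 0 = 0"
  by (rule poly_mapping_eqI) simp

lemma smul_minus_one: "smul (- 1) f = - f"
  by (rule poly_mapping_eqI) simp

lemma smul_single [simp]: "smul c (Poly_Mapping.single a d) = Poly_Mapping.single a (c * d)"
  by (simp add: smul_def)

lemma keys_smul_subset: "Poly_Mapping.keys (smul c f) \<subseteq> Poly_Mapping.keys f"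
  by (auto simp: in_keys_iff)

lemma keys_smul_mono: "Poly_Mapping.keys f \<subseteq> A \<Longrightarrow> Poly_Mapping.keys (smul c f) \<subseteq> A"
  using keys_smul_subset by (rule order.trans)

lemma single_sum: "Poly_Mapping.single a (sum f A) = (\<Sum>b\<in>A. Poly_Mapping.single a (f b))"
  by (induction A rule: infinite_finite_induct) (auto simp: single_add)

lemma sum_singles:
  "f = (\<Sum>a\<in>Poly_Mapping.keys f. Poly_Mapping.single a (Poly_Mapping.lookup f a))"
  by (rule poly_mapping_eqI)
    (auto simp: lookup_sum lookup_single when_def in_keys_iff sum.delta')

text \<open>Linear identities need to be checked on single basis elements only. The bound
  \<open>S\<close> on the supports is kept throughout, so that with \<open>S\<close> the set of
  paths every basis element met is a genuine walk.\<close>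

lemma poly_mapping_keys_induct [consumes 1, case_names zero single add]:
  assumes "Poly_Mapping.keys f \<subseteq> S" "P 0"
    "\<And>a c. a \<in> S \<Longrightarrow> P (Poly_Mapping.single a c)"
    "\<And>f g. Poly_Mapping.keys f \<subseteq> S \<Longrightarrow> Poly_Mapping.keys g \<subseteq> S \<Longrightarrow> P f \<Longrightarrow> P g \<Longrightarrow> P (f + g)"
  shows "P (f :: 'a \<Rightarrow>\<^sub>0 'k::comm_monoid_add)"
proof -
  have "Poly_Mapping.keys (\<Sum>a\<in>A. Poly_Mapping.single a (h a)) \<subseteq> S
      \<and> P (\<Sum>a\<in>A. Poly_Mapping.single a (h a))" if "A \<subseteq> S" "finite A" for A and h :: "'a \<Rightarrow> 'k"
    using that(2,1)
  proof (induction rule: finite_induct)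
    case (insert a A)
    then have "Poly_Mapping.keys (Poly_Mapping.single a (h a) + (\<Sum>a\<in>A. Poly_Mapping.single a (h a))) \<subseteq> S"
      using keys_add[of "Poly_Mapping.single a (h a)" "\<Sum>a\<in>A. Poly_Mapping.single a (h a)"]
      by (auto split: if_splits)
    with insert assms(3,4) show ?case by auto
  qed (use assms(2) in auto)
  then show ?thesis using assms(1) sum_singles[of f] finite_keys[of f] by metis
qed

text \<open>Linear extension from basis elements. The target is a bare commutative monoid without
  scalars, hence \<open>h\<close> receives the coefficient as an argument.\<close>

definition lext :: "('a \<Rightarrow> 'b::zero \<Rightarrow> 'c::comm_monoid_add) \<Rightarrow> ('a \<Rightarrow>\<^sub>0 'b) \<Rightarrow> 'c" where
  "lext h f = (\<Sum>a\<in>Poly_Mapping.keys f. h a (Poly_Mapping.lookup f a))"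

lemma lext_superset:
  assumes "finite A" "Poly_Mapping.keys f \<subseteq> A" "\<And>a. h a 0 = 0"
  shows "lext h f = (\<Sum>a\<in>A. h a (Poly_Mapping.lookup f a))"
  unfolding lext_def using assms by (intro sum.mono_neutral_left) (auto simp: in_keys_iff)

lemma lext_zero [simp]: "lext h 0 = 0"
  by (simp add: lext_def)

lemma lext_single [simp]: "h a 0 = 0 \<Longrightarrow> lext h (Poly_Mapping.single a c) = h a c"
  by (simp add: lext_def)

lemma lext_add:
  assumes "\<And>a. h a 0 = 0" "\<And>a x y. h a (x + y) = h a x + h a y"
  shows "lext h (f + g) = lext h f + lext h g"
proof -
  let ?A = "Poly_Mapping.keys f \<union> Poly_Mapping.keys g"
  have "lext h k = (\<Sum>a\<in>?A. h a (Poly_Mapping.lookup k a))" if "Poly_Mapping.keys k \<subseteq> ?A" for k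
    using that assms(1) by (intro lext_superset) auto
  moreover have "Poly_Mapping.keys (f + g) \<subseteq> ?A" by (rule keys_add)
  ultimately show ?thesis by (simp add: lookup_add assms(2) sum.distrib)
qed

lemma lext_add_left:
  assumes "\<And>a c. h a c = h1 a c + h2 a c"
  shows "lext h f = lext h1 f + lext h2 f"
  unfolding lext_def using assms by (simp add: sum.distrib)

text \<open>Two nested linear extensions, from which additivity in either factor can be read
  off.\<close>

lemma path_mult_lext: "path_mult G f g =
  lext (\<lambda>(u, p) c. lext (\<lambda>(v, q) d. if pre_digraph.awlast G u p = v
     then Poly_Mapping.single (u, p @ q) (c * d) else 0) g) f"
  unfolding path_mult_def lext_def by (auto intro!: sum.cong)

lemma path_mult_zero_left [simp]: "path_mult G 0 g = 0"
  by (simp add: path_mult_lext)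

lemma path_mult_zero_right [simp]: "path_mult G f 0 = 0"
  by (simp add: path_mult_def)

lemma path_mult_add_left: "path_mult G (f + f') g = path_mult G f g + path_mult G f' g"
  unfolding path_mult_lext
  apply (rule lext_add)
  by (auto simp: lext_def single_add algebra_simps sum.distrib[symmetric] intro!: sum.cong sum.neutral)

lemma path_mult_add_right: "path_mult G f (g + g') = path_mult G f g + path_mult G f g'"
  unfolding path_mult_lext
  apply (rule lext_add_left)
  apply (clarsimp split: prod.splits)
  apply (rule lext_add)
  by (auto simp: single_add algebra_simps)

lemma path_mult_single: 
  "path_mult G (Poly_Mapping.single (u, p) c) (Poly_Mapping.single (v, q) d) =
    (if pre_digraph.awlast G u p = v then Poly_Mapping.single (u, p @ q) (c * d) else 0)"
  by (simp add: path_mult_lext lext_def)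

lemma path_mult_uminus_left: "path_mult G (- f) g = - path_mult G f g"
  using path_mult_add_left[of G "- f" f g] by (simp add: eq_neg_iff_add_eq_0)

lemma path_mult_uminus_right: "path_mult G f (- g) = - path_mult G f g"
  using path_mult_add_right[of G f "- g" g] by (simp add: eq_neg_iff_add_eq_0)

lemma path_mult_diff_left: "path_mult G (f - f') g = path_mult G f g - path_mult G f' g"
  using path_mult_add_left[of G f "- f'" g] by (simp add: path_mult_uminus_left)

lemma path_mult_diff_right: "path_mult G f (g - g') = path_mult G f g - path_mult G f g'"
  using path_mult_add_right[of G f g "- g'"] by (simp add: path_mult_uminus_right)

lemma path_algebra_simps [simp]:
  "car (path_algebra G) = {f. Poly_Mapping.keys f \<subseteq> paths G}"
  "zer (path_algebra G) = 0"
  "add (path_algebra G) = (+)"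
  "mul (path_algebra G) = path_mult G"
  "scl (path_algebra G) = smul"
  by (simp_all add: path_algebra_def smul_def fun_eq_iff)

lemma keys_add_subset:
  "Poly_Mapping.keys f \<subseteq> A \<Longrightarrow> Poly_Mapping.keys g \<subseteq> A \<Longrightarrow> Poly_Mapping.keys (f + g) \<subseteq> A"
  using keys_add[of f g] by blast

lemma keys_diff_subset:
  "Poly_Mapping.keys f \<subseteq> A \<Longrightarrow> Poly_Mapping.keys g \<subseteq> A \<Longrightarrow> Poly_Mapping.keys (f - g) \<subseteq> A"
  for f g :: "'a \<Rightarrow>\<^sub>0 'b::ab_group_add"
  using keys_diff[of f g] by blast

lemma cas_awlast: "pre_digraph.cas G u p v \<Longrightarrow> pre_digraph.awlast G u p = v"
  by (induction p arbitrary: u)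
    (auto simp: pre_digraph.cas.simps pre_digraph.awalk_verts.simps pre_digraph.awalk_verts_non_Nil)

lemma awalk_awlast: "pre_digraph.awalk G u p v \<Longrightarrow> pre_digraph.awlast G u p = v"
  by (simp add: pre_digraph.awalk_def cas_awlast)

section \<open>Ideals of a path algebra and its quotients\<close>

locale path_quiver = fixes G :: "('v, 'e) pre_digraph"
  assumes wf: "wf_digraph G"
begin

sublocale wf_digraph G by (rule wf)

lemma path_mult_closed:
  assumes "Poly_Mapping.keys f \<subseteq> paths G" "Poly_Mapping.keys g \<subseteq> paths G"
  shows "Poly_Mapping.keys (path_mult G f g) \<subseteq> paths G"
  using assms(1)
proof (induction rule: poly_mapping_keys_induct)
  case (single a c)
  show ?case using assms(2)
  proof (induction rule: poly_mapping_keys_induct)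
    case (single b d)
    obtain u p v q where [simp]: "a = (u, p)" "b = (v, q)" by fastforce
    show ?case using single \<open>a \<in> paths G\<close>
      by (auto simp: path_mult_single paths_def dest: awalk_awlast[of G] intro: awalk_appendI)
  qed (simp_all add: path_mult_add_right keys_add_subset)
qed (simp_all add: path_mult_add_left keys_add_subset)

definition ideal :: "(('v, 'e) path \<Rightarrow>\<^sub>0 'k::field) set \<Rightarrow> bool" where
  "ideal I \<longleftrightarrow> two_sided_ideal (path_algebra G) I"

lemma idealI:
  assumes "\<And>f. f \<in> I \<Longrightarrow> Poly_Mapping.keys f \<subseteq> paths G" "0 \<in> I"
    "\<And>f g. f \<in> I \<Longrightarrow> g \<in> I \<Longrightarrow> f + g \<in> I" "\<And>c f. f \<in> I \<Longrightarrow> smul c f \<in> I"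
    "\<And>f g. f \<in> I \<Longrightarrow> Poly_Mapping.keys g \<subseteq> paths G \<Longrightarrow> path_mult G g f \<in> I"
    "\<And>f g. f \<in> I \<Longrightarrow> Poly_Mapping.keys g \<subseteq> paths G \<Longrightarrow> path_mult G f g \<in> I"
  shows "ideal I"
  using assms by (auto simp: ideal_def two_sided_ideal_def subspace_of_def)

lemma ideal_gen_least:
  "ideal I \<Longrightarrow> S \<subseteq> I \<Longrightarrow> ideal_gen (path_algebra G) S \<subseteq> I"
  by (auto simp: ideal_gen_def ideal_def)

lemma ideal_gen_superset: "S \<subseteq> ideal_gen (path_algebra G) S"
  by (auto simp: ideal_gen_def)

text \<open>The whole algebra is an ideal containing \<open>S\<close>, so the intersection defining
  \<open>ideal_gen\<close> is over a nonempty family and stays inside the algebra. Over an empty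
  family it would be the whole type.\<close>

lemma ideal_ideal_gen:
  assumes "S \<subseteq> car (path_algebra G)"
  shows "ideal (ideal_gen (path_algebra G) (S :: (('v, 'e) path \<Rightarrow>\<^sub>0 'k::field) set))"
proof (rule idealI)
  have "two_sided_ideal (path_algebra G) {f :: ('v, 'e) path \<Rightarrow>\<^sub>0 'k. Poly_Mapping.keys f \<subseteq> paths G}"
    unfolding ideal_def[symmetric]
  proof (rule idealI; unfold mem_Collect_eq)
    fix c and f g :: "('v, 'e) path \<Rightarrow>\<^sub>0 'k"
    assume f: "Poly_Mapping.keys f \<subseteq> paths G"
    show "Poly_Mapping.keys (smul c f) \<subseteq> paths G"
      using keys_smul_subset f by (rule order_trans)
    assume g: "Poly_Mapping.keys g \<subseteq> paths G"
    show "Poly_Mapping.keys (f + g) \<subseteq> paths G"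
      using f g by (rule keys_add_subset)
    show "Poly_Mapping.keys (path_mult G g f) \<subseteq> paths G" "Poly_Mapping.keys (path_mult G f g) \<subseteq> paths G"
      using f g by (simp_all only: path_mult_closed)
  qed auto
  then show "\<And>f. f \<in> ideal_gen (path_algebra G) S \<Longrightarrow> Poly_Mapping.keys f \<subseteq> paths G"
    using assms unfolding ideal_gen_def by fastforce
qed (auto simp: ideal_gen_def two_sided_ideal_def subspace_of_def)

end

locale path_quotient = path_quiver G for G :: "('v, 'e) pre_digraph" +
  fixes I :: "(('v, 'e) path \<Rightarrow>\<^sub>0 'k::field) set"
  assumes ideal_I: "ideal I"
begin

lemma ideal_keys: "f \<in> I \<Longrightarrow> Poly_Mapping.keys f \<subseteq> paths G"
  and ideal_zero: "0 \<in> I"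
  and ideal_add: "f \<in> I \<Longrightarrow> g \<in> I \<Longrightarrow> f + g \<in> I"
  and ideal_smul: "f \<in> I \<Longrightarrow> smul c f \<in> I"
  and ideal_mult_left: "f \<in> I \<Longrightarrow> Poly_Mapping.keys g \<subseteq> paths G \<Longrightarrow> path_mult G g f \<in> I"
  and ideal_mult_right: "f \<in> I \<Longrightarrow> Poly_Mapping.keys g \<subseteq> paths G \<Longrightarrow> path_mult G f g \<in> I"
  using ideal_I by (auto simp: ideal_def two_sided_ideal_def subspace_of_def)

lemma ideal_uminus: "f \<in> I \<Longrightarrow> - f \<in> I"
  using ideal_smul[of f "- 1"] by (simp add: smul_minus_one)

lemma ideal_diff_commute: "f - g \<in> I \<Longrightarrow> g - f \<in> I"
  using ideal_uminus[of "f - g"] by simp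

lemma ideal_diff_trans: "f - g \<in> I \<Longrightarrow> g - h \<in> I \<Longrightarrow> f - h \<in> I"
  using ideal_add[of "f - g" "g - h"] by simp

lemma ideal_sum: "(\<And>a. a \<in> A \<Longrightarrow> f a \<in> I) \<Longrightarrow> sum f A \<in> I"
  by (induction A rule: infinite_finite_induct) (auto intro: ideal_zero ideal_add)

abbreviation cls :: "(('v, 'e) path \<Rightarrow>\<^sub>0 'k) \<Rightarrow> (('v, 'e) path \<Rightarrow>\<^sub>0 'k) set" where
  "cls \<equiv> coset (path_algebra G) I"

lemma mem_cls: "g \<in> cls f \<longleftrightarrow> g - f \<in> I"
  by (auto simp: coset_def image_iff) (metis add.commute diff_add_cancel)

lemma cls_eq_iff: "cls f = cls g \<longleftrightarrow> f - g \<in> I"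
proof
  assume "cls f = cls g"
  then have "f \<in> cls g" using mem_cls[of f f] ideal_zero by auto
  then show "f - g \<in> I" by (simp add: mem_cls)
next
  assume *: "f - g \<in> I"
  show "cls f = cls g"
    by (auto simp: mem_cls intro: ideal_diff_trans[OF _ *] ideal_diff_trans[OF _ ideal_diff_commute[OF *]])
qed

lemma cls_self: "f \<in> cls f"
  by (simp add: mem_cls ideal_zero)

lemma cls_nonempty [simp]: "cls f \<noteq> {}"
  using cls_self by blast

text \<open>The operations of \<open>quot\<close> are unions over all representatives. If every
  representative yields the same class, the union over a nonempty coset is that class.\<close>

lemma UN_cls: "(\<And>f'. f' \<in> cls f \<Longrightarrow> h f' = Y) \<Longrightarrow> (\<Union>f'\<in>cls f. h f') = Y"
  using cls_self[of f] by blast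

lemma UN_cls2:
  "(\<And>f' g'. f' \<in> cls f \<Longrightarrow> g' \<in> cls g \<Longrightarrow> h f' g' = Y) \<Longrightarrow>
    (\<Union>f'\<in>cls f. \<Union>g'\<in>cls g. h f' g') = Y"
  by (simp add: UN_cls)

lemma add_quot: "add (quot (path_algebra G) I) (cls f) (cls g) = cls (f + g)"
proof -
  have "cls (f' + g') = cls (f + g)" if "f' \<in> cls f" "g' \<in> cls g" for f' g'
    using that ideal_add[of "f' - f" "g' - g"] by (simp add: mem_cls cls_eq_iff algebra_simps)
  then show ?thesis by (simp add: quot_def UN_cls2)
qed

text \<open>By f'g' - fg = (f' - f)g' + f(g' - g). The ideal absorbs only factors supported on
  paths, and \<open>g'\<close> is one because \<open>g\<close> and the ideal are.\<close>

lemma mul_quot: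
  assumes "Poly_Mapping.keys f \<subseteq> paths G" "Poly_Mapping.keys g \<subseteq> paths G"
  shows "mul (quot (path_algebra G) I) (cls f) (cls g) = cls (path_mult G f g)"
proof -
  have "cls (path_mult G f' g') = cls (path_mult G f g)" if "f' \<in> cls f" "g' \<in> cls g" for f' g'
  proof -
    have f: "f' - f \<in> I" and g: "g' - g \<in> I" using that by (auto simp: mem_cls)
    have "Poly_Mapping.keys g' \<subseteq> paths G"
      using keys_add_subset[OF ideal_keys[OF g] assms(2)] by simp
    then have "path_mult G (f' - f) g' \<in> I" "path_mult G f (g' - g) \<in> I"
      using f g assms by (auto intro: ideal_mult_left ideal_mult_right)
    then have "path_mult G (f' - f) g' + path_mult G f (g' - g) \<in> I" by (rule ideal_add)
    then show ?thesis
      by (simp add: cls_eq_iff path_mult_diff_left path_mult_diff_right)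
  qed
  then show ?thesis by (simp add: quot_def UN_cls2)
qed

lemma scl_quot: "scl (quot (path_algebra G) I) c (cls f) = cls (smul c f)"
proof -
  have "cls (smul c f') = cls (smul c f)" if "f' \<in> cls f" for f'
    using that ideal_smul[of "f' - f" c] by (simp add: mem_cls cls_eq_iff smul_diff)
  then show ?thesis by (simp add: quot_def UN_cls)
qed

lemma zer_quot: "zer (quot (path_algebra G) I) = cls 0"
  by (auto simp: quot_def mem_cls)

lemma car_quot: "car (quot (path_algebra G) I) = cls ` {f. Poly_Mapping.keys f \<subseteq> paths G}"
  by (simp add: quot_def)

end

section \<open>A monomial representation of \<open>R\<close>\<close>

lemma shift_eq_shift_iff:
  "length u = length v \<Longrightarrow> u @- x = v @- y \<longleftrightarrow> u = v \<and> x = y"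
  by (induction u v rule: list_induct2) auto

lemma stream_split_length: obtains u r where "s = u @- r" "length u = n"
  by (metis stake_sdrop length_stake)

lemma even_words_simps [simp]:
  "[] \<in> even_words" "i # w \<in> even_words \<longleftrightarrow> even i \<and> w \<in> even_words"
  "v @ w \<in> even_words \<longleftrightarrow> v \<in> even_words \<and> w \<in> even_words"
  by (auto simp: even_words_def)

lemma even_pieces_simps [simp]:
  "Cr i j \<in> even_pieces \<longleftrightarrow> even i \<and> even j" "Dot i \<in> even_pieces \<longleftrightarrow> even i"
  by (auto simp: even_pieces_def)

lemma bot_word_even: "g \<in> even_pieces \<Longrightarrow> bot_word g \<in> even_words"
  by (simp add: even_pieces_def)

lemma top_word_even: "g \<in> even_pieces \<Longrightarrow> top_word g \<in> even_words"
  by (cases g) auto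

lemma length_top_word [simp]: "length (top_word g) = length (bot_word g)"
  by (cases g) auto

lemma Mseq_Stream [simp]: "i ## x \<in> Mseq \<longleftrightarrow> even i \<and> x \<in> Mseq"
proof -
  have "(\<forall>n. even ((i ## x) !! n)) \<longleftrightarrow> even i \<and> (\<forall>n. even (x !! n))"
    by (metis snth.simps(1,2) stream.sel old.nat.exhaust)
  moreover have "(\<exists>N. \<forall>n\<ge>N. (i ## x) !! Suc n = (i ## x) !! n + 2)
      \<longleftrightarrow> (\<exists>N. \<forall>n\<ge>N. x !! Suc n = x !! n + 2)" (is "?L \<longleftrightarrow> ?R")
  proof
    assume ?L
    then obtain N where N: "\<forall>n\<ge>N. (i ## x) !! Suc n = (i ## x) !! n + 2" by blast
    have "x !! Suc n = x !! n + 2" if "n \<ge> N" for n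
      using N[rule_format, of "Suc n"] that by simp
    then show ?R by blast
  next
    assume ?R
    then obtain N where N: "\<forall>n\<ge>N. x !! Suc n = x !! n + 2" by blast
    have "(i ## x) !! Suc n = (i ## x) !! n + 2" if n: "n \<ge> Suc N" for n
    proof -
      obtain m where "n = Suc m" "m \<ge> N" using n by (cases n) auto
      then show ?thesis using N by simp
    qed
    then show ?L by blast
  qed
  ultimately show ?thesis by (simp add: Mseq_def)
qed

lemma Mseq_shift [simp]: "w @- x \<in> Mseq \<longleftrightarrow> w \<in> even_words \<and> x \<in> Mseq"
  by (induction w) auto

lemma R_quiver_simps [simp]:
  "verts R_quiver = Mseq"
  "(a, g, x) \<in> arcs R_quiver \<longleftrightarrow> a \<in> even_words \<and> g \<in> even_pieces \<and> x \<in> Mseq"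
  "tail R_quiver (a, g, x) = a @- bot_word g @- x"
  "head R_quiver (a, g, x) = a @- top_word g @- x"
  by (auto simp: R_quiver_def)

interpretation R: path_quiver R_quiver
  by unfold_locales (auto simp: bot_word_even top_word_even)

lemma R_rel_car: "R_rel \<subseteq> car (path_algebra R_quiver)"
proof
  fix f :: "(int stream, diagram) path \<Rightarrow>\<^sub>0 'k::field"
  have arrow: "Poly_Mapping.keys (arrows R_quiver es) \<subseteq> paths R_quiver"
    if "R.awalk (tail R_quiver (hd es)) es v" for es v
    using that by (auto simp: arrows_def paths_def)
  assume "f \<in> R_rel"
  then show "f \<in> car (path_algebra R_quiver)"
  proof (induction rule: R_rel.induct)
    case (supercommute a c x g h)
    then show ?case unfolding path_algebra_simps mem_Collect_eq
      by (intro keys_diff_subset order.trans[OF keys_smul_subset])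
        (auto simp: paths_def R.awalk_Cons_iff R.awalk_Nil_iff top_word_even bot_word_even arrows_def)
  next
    case (double_crossing a x i j)
    then show ?case unfolding path_algebra_simps mem_Collect_eq
      by (intro keys_diff_subset)
        (auto simp: paths_def R.awalk_Cons_iff R.awalk_Nil_iff arrows_def idem_def)
  next
    case (braid a x i j k)
    then show ?case unfolding path_algebra_simps mem_Collect_eq
      by (intro keys_diff_subset)
        (auto simp: paths_def R.awalk_Cons_iff R.awalk_Nil_iff arrows_def)
  next
    case (dot_slide a x i j)
    then show ?case unfolding path_algebra_simps mem_Collect_eq
      by (intro keys_diff_subset)
        (auto simp: paths_def R.awalk_Cons_iff R.awalk_Nil_iff arrows_def)
  qed (auto simp: paths_def R.awalk_Cons_iff R.awalk_Nil_iff arrows_def)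
qed

interpretation R: path_quotient R_quiver R_ideal
  unfolding R_ideal_def by unfold_locales (rule R.ideal_ideal_gen[OF R_rel_car])

lemma R_rel_ideal: "f \<in> R_rel \<Longrightarrow> f \<in> R_ideal"
  unfolding R_ideal_def using R.ideal_gen_superset by blast

section \<open>Strands and the signs of their crossings\<close>

type_synonym strand = "int \<times> bool"

text \<open>The current label. One bit per strand suffices, since two dots on the same strand give
  zero.\<close>

definition lab :: "strand \<Rightarrow> int" where
  "lab p = fst p - (if snd p then 2 else 0)"

lemma lab_simps [simp]: "lab (l, False) = l" "lab (l, True) = l - 2"
  by (simp_all add: lab_def)

fun invs :: "int list \<Rightarrow> nat" where
  "invs [] = 0"
| "invs (a # L) = length (filter (\<lambda>b. b < a) L) + invs L"

definition gt_count :: "int list \<Rightarrow> int \<Rightarrow> nat" where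
  "gt_count L z = length (filter (\<lambda>b. z < b) L)"

lemma gt_count_simps [simp]:
  "gt_count [] z = 0" "gt_count (a # L) z = of_bool (z < a) + gt_count L z"
  "gt_count (L @ M) z = gt_count L z + gt_count M z"
  by (auto simp: gt_count_def)

lemma invs_snoc [simp]: "invs (L @ [a]) = invs L + gt_count L a"
  by (induction L) auto

lemma invs_swap:
  "a < b \<Longrightarrow> invs (L @ b # a # M) = Suc (invs (L @ a # b # M))"
  by (induction L) auto

text \<open>The sign with which a crossing of \<open>a\<close> and \<open>b\<close>, to the right of the strands \<open>L\<close>, is absorbed
  into the insertion sort word of the resulting ordering.\<close>

definition crossing_sign :: "int list \<Rightarrow> int \<Rightarrow> int \<Rightarrow> 'k::field" where
  "crossing_sign L a b = (- 1) ^ (invs L + gt_count L (max a b) * (gt_count L (min a b) + 1))"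

lemma crossing_sign_commute: "crossing_sign L a b = crossing_sign L b a"
  by (simp add: crossing_sign_def max.commute min.commute)

lemma crossing_sign_square [simp]: "crossing_sign L a b * crossing_sign L a b = (1 :: 'k::field)"
  by (simp add: crossing_sign_def flip: power_add mult_2)

text \<open>The transposition adds one inversion and leaves all values of \<open>gt_count\<close>
  unchanged.\<close>

lemma crossing_sign_swap_less:
  "a < b \<Longrightarrow> crossing_sign (L @ b # a # M) c d = - crossing_sign (L @ a # b # M) c d"
proof -
  assume "a < b"
  moreover have "gt_count (L @ b # a # M) z = gt_count (L @ a # b # M) z" for z by simp
  ultimately show ?thesis by (simp add: crossing_sign_def invs_swap del: gt_count_simps)
qed

text \<open>The source of the sign by which two distant crossings supercommute: the left one
  interchanges two strands to the left of the other.\<close>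

lemma crossing_sign_swap:
  assumes "a \<noteq> b"
  shows "crossing_sign (L @ b # a # M) c d = - crossing_sign (L @ a # b # M) c d"
proof (cases "a < b")
  case False
  with assms have "b < a" by simp
  from crossing_sign_swap_less[OF this, of L M c d] show ?thesis by (metis minus_minus)
qed (rule crossing_sign_swap_less)

text \<open>The exponents are built from \<open>invs L\<close> and the numbers of strands of
  \<open>L\<close> above \<open>a\<close>, \<open>b\<close> and \<open>c\<close>. For each of the
  six orders of the three strands the identity is thus a check over four parities.\<close>

lemma crossing_sign_braid:
  assumes "a \<noteq> b" "b \<noteq> c" "a \<noteq> c"
  shows "crossing_sign L a b * crossing_sign (L @ [b]) a c * crossing_sign L b c =
    crossing_sign (L @ [a]) b c * crossing_sign L a c * (crossing_sign (L @ [c]) a b :: 'k::field)"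
proof -
  consider "a < b" "b < c" "a < c" | "a < c" "c < b" "a < b" | "b < a" "a < c" "b < c"
    | "b < c" "c < a" "b < a" | "c < a" "a < b" "c < b" | "c < b" "b < a" "c < a"
    using assms by (smt (verit))
  then show ?thesis
    by cases (cases "even (invs L)"; cases "even (gt_count L a)"; cases "even (gt_count L b)";
        cases "even (gt_count L c)"; simp add: crossing_sign_def max_def min_def minus_one_power_iff)+
qed

section \<open>The action of diagrams on states\<close>

fun piece_next :: "piece \<Rightarrow> strand list \<Rightarrow> strand list" where
  "piece_next (Dot i) P = [(fst (P ! 0), True)]"
| "piece_next (Cr i j) P = [P ! 1, P ! 0]"

text \<open>A crossing of equal labels has square zero, so it may act in one direction only.\<close>

fun piece_coeff :: "piece \<Rightarrow> int list \<Rightarrow> strand list \<Rightarrow> 'k::field" where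
  "piece_coeff (Dot i) L P = (if snd (P ! 0) then 0 else 1)"
| "piece_coeff (Cr i j) L P = (if lab (P ! 0) = lab (P ! 1) \<and> fst (P ! 1) < fst (P ! 0) then 0
     else crossing_sign L (fst (P ! 0)) (fst (P ! 1)))"

text \<open>Only the position \<open>length a\<close> and the shape of \<open>g\<close> enter. That
  labels match is tested once in \<open>rep\<close>, at the bottom of a path; along a walk it then
  persists as long as the coefficient is nonzero.\<close>

fun next_state :: "diagram \<Rightarrow> strand stream \<Rightarrow> strand stream" where
  "next_state (a, g, x) s = stake (length a) s @-
     piece_next g (stake (length (bot_word g)) (sdrop (length a) s)) @-
     sdrop (length a + length (bot_word g)) s"

fun coeff :: "diagram \<Rightarrow> strand stream \<Rightarrow> 'k::field" where
  "coeff (a, g, x) s = piece_coeff g (map fst (stake (length a) s))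
     (stake (length (bot_word g)) (sdrop (length a) s))"

lemma next_state_eval:
  assumes "length u = length a" "length P = length (bot_word g)"
  shows "next_state (a, g, x) (u @- P @- r) = u @- piece_next g P @- r"
  by (simp add: assms[symmetric] stake_shift sdrop_shift)

lemma coeff_eval:
  assumes "length u = length a" "length P = length (bot_word g)"
  shows "coeff (a, g, x) (u @- P @- r) = piece_coeff g (map fst u) P"
  by (simp add: assms[symmetric] stake_shift sdrop_shift)

lemma crossing_eval:
  assumes "length u = length a"
  shows "coeff (a, Cr i j, x) (u @- p ## q ## r) = (if lab p = lab q \<and> fst q < fst p then 0
      else crossing_sign (map fst u) (fst p) (fst q) :: 'k::field)"
    and "next_state (a, Cr i j, x) (u @- p ## q ## r) = u @- q ## p ## r"
  using coeff_eval[of u a "[p, q]" "Cr i j" x r, where 'a = 'k] next_state_eval[of u a "[p, q]" "Cr i j" x r] assms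
  by (simp_all del: next_state.simps coeff.simps)

primrec next_states :: "diagram list \<Rightarrow> strand stream \<Rightarrow> strand stream" where
  "next_states [] s = s"
| "next_states (e # es) s = next_states es (next_state e s)"

primrec coeffs :: "diagram list \<Rightarrow> strand stream \<Rightarrow> 'k::field" where
  "coeffs [] s = 1"
| "coeffs (e # es) s = coeff e s * coeffs es (next_state e s)"

lemma next_states_append: "next_states (p @ q) s = next_states q (next_states p s)"
  by (induction p arbitrary: s) auto

lemma coeffs_append: "coeffs (p @ q) s = coeffs p s * coeffs q (next_states p s)"
  by (induction p arbitrary: s) auto

text \<open>The sign rules \<open>crossing_sign_swap\<close> and \<open>crossing_sign_braid\<close>
  are about strands that can be told apart by their original labels.\<close>

definition valid :: "strand stream \<Rightarrow> bool" where
  "valid s \<longleftrightarrow> inj (\<lambda>n. fst (s !! n))"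

lemma valid_Stream [simp]: "valid (p ## s) \<longleftrightarrow> fst p \<notin> fst ` sset s \<and> valid s"
proof -
  have "valid (p ## s) \<longleftrightarrow> (\<forall>n. fst p \<noteq> fst (s !! n)) \<and> valid s"
  proof
    assume *: "valid (p ## s)"
    have "m = n" if "fst ((p ## s) !! m) = fst ((p ## s) !! n)" for m n
      using * that by (auto simp: valid_def dest: injD)
    from this[of 0 "Suc n" for n] this[of "Suc m" "Suc n" for m n]
    show "(\<forall>n. fst p \<noteq> fst (s !! n)) \<and> valid s" by (auto simp: valid_def inj_def)
  next
    assume "(\<forall>n. fst p \<noteq> fst (s !! n)) \<and> valid s"
    then show "valid (p ## s)"
      unfolding valid_def by (intro injI, case_tac x; case_tac y) (auto dest: injD sym)
  qed
  then show ?thesis by (auto simp: sset_range)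
qed

lemma valid_shift [simp]:
  "valid (u @- s) \<longleftrightarrow> distinct (map fst u) \<and> fst ` set u \<inter> fst ` sset s = {} \<and> valid s"
  by (induction u) auto

lemma piece_next_length [simp]: "length (piece_next g P) = length (bot_word g)"
  by (cases g) auto

lemma length_Suc_0: "length P = Suc 0 \<longleftrightarrow> (\<exists>p. P = [p])"
  by (cases P) auto

lemma length_Suc_Suc_0: "length P = Suc (Suc 0) \<longleftrightarrow> (\<exists>p q. P = [p, q])"
  by (cases P; cases "tl P") auto

lemma piece_next_fst:
  "length P = length (bot_word g) \<Longrightarrow> distinct (map fst (piece_next g P)) = distinct (map fst P)
    \<and> fst ` set (piece_next g P) = fst ` set P"
  by (cases g) (auto simp: length_Suc_0 length_Suc_Suc_0)

lemma diagram_split: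
  obtains u P r where "s = u @- P @- r" "length u = length a" "length P = length (bot_word g)"
  by (metis stream_split_length)

lemma valid_next_state: "valid s \<Longrightarrow> valid (next_state e s)"
proof (cases e)
  case (fields a g x)
  assume "valid s"
  obtain u P r where "s = u @- P @- r" "length u = length a" "length P = length (bot_word g)"
    by (rule diagram_split)
  with \<open>valid s\<close> fields piece_next_fst[of P g] show ?thesis
    by (auto simp: next_state_eval simp del: next_state.simps)
qed

lemma valid_next_states: "valid s \<Longrightarrow> valid (next_states p s)"
  by (induction p arbitrary: s) (auto simp: valid_next_state)

text \<open>A second dot would leave the label where it is, but its coefficient is zero.\<close>

lemma piece_next_lab:
  "map lab P = bot_word g \<Longrightarrow> piece_coeff g L P \<noteq> (0 :: 'k::field) \<Longrightarrow> map lab (piece_next g P) = top_word g"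
  by (cases g) (auto simp: lab_def split: if_splits)

lemma smap_lab_next_state:
  assumes "smap lab s = tail R_quiver e" "coeff e s \<noteq> (0 :: 'k::field)"
  shows "smap lab (next_state e s) = head R_quiver e"
proof (cases e)
  case (fields a g x)
  obtain u P r where s: "s = u @- P @- r" "length u = length a" "length P = length (bot_word g)"
    by (rule diagram_split)
  then have "map lab u = a" "map lab P = bot_word g" "smap lab r = x"
    using assms(1) fields by (simp_all add: shift_eq_shift_iff)
  with s assms(2) fields piece_next_lab[of P g "map fst u"] show ?thesis
    by (simp add: next_state_eval coeff_eval shift_eq_shift_iff del: next_state.simps coeff.simps)
qed

lemma smap_lab_next_states:
  assumes "R.cas (smap lab s) p v" "coeffs p s \<noteq> (0 :: 'k::field)"
  shows "smap lab (next_states p s) = v"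
  using assms
proof (induction p arbitrary: s)
  case (Cons e p)
  then show ?case using smap_lab_next_state[of s e, where 'k = 'k] by auto
qed auto

text \<open>The action is on functions of states: a path moves the state, then the function is
  evaluated. Thus \<open>f\<close> followed by \<open>g\<close> acts as
  \<open>rep f (rep g \<phi>)\<close>, in agreement with products read from the bottom.\<close>

definition rep :: "((int stream, diagram) path \<Rightarrow>\<^sub>0 'k::field) \<Rightarrow> (strand stream \<Rightarrow> 'k) \<Rightarrow> strand stream \<Rightarrow> 'k" where
  "rep f \<phi> s = lext (\<lambda>(u, p) c. if valid s \<and> smap lab s = u
     then c * coeffs p s * \<phi> (next_states p s) else 0) f"

lemma rep_single: "rep (Poly_Mapping.single (u, p) c) \<phi> s =
    (if valid s \<and> smap lab s = u then c * coeffs p s * \<phi> (next_states p s) else 0)"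
  by (simp add: rep_def)

lemma rep_add: "rep (f + g) \<phi> s = rep f \<phi> s + rep g \<phi> s"
  unfolding rep_def by (rule lext_add) (auto simp: algebra_simps)

lemma rep_zero [simp]: "rep 0 \<phi> s = 0"
  by (simp add: rep_def)

lemma rep_uminus: "rep (- f) \<phi> s = - rep f \<phi> s"
  using rep_add[of "- f" f \<phi> s] by (simp add: eq_neg_iff_add_eq_0)

lemma rep_diff: "rep (f - g) \<phi> s = rep f \<phi> s - rep g \<phi> s"
  using rep_add[of f "- g" \<phi> s] by (simp add: rep_uminus)

lemma rep_sum: "rep (sum f A) \<phi> s = (\<Sum>a\<in>A. rep (f a) \<phi> s)"
  by (induction A rule: infinite_finite_induct) (auto simp: rep_add)

lemma rep_smul: "rep (smul c f) \<phi> s = c * rep f \<phi> s"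
proof -
  have "Poly_Mapping.keys f \<subseteq> UNIV" by simp
  then show ?thesis
    by (induction rule: poly_mapping_keys_induct)
      (auto simp: smul_add rep_add rep_single distrib_left)
qed

lemma rep_path_mult:
  fixes f :: "(int stream, diagram) path \<Rightarrow>\<^sub>0 'k::field"
  assumes "Poly_Mapping.keys f \<subseteq> paths R_quiver" "Poly_Mapping.keys g \<subseteq> paths R_quiver"
  shows "rep (path_mult R_quiver f g) \<phi> s = rep f (rep g \<phi>) s"
  using assms(1)
proof (induction rule: poly_mapping_keys_induct)
  case (single b c)
  obtain u p where b: "b = (u, p)" by fastforce
  with single obtain w where w: "R.awalk u p w" by (auto simp: paths_def)
  show ?case using assms(2)
  proof (induction rule: poly_mapping_keys_induct)
    case zero
    show ?case by (simp add: b rep_single)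
  next
    case (add f g)
    then show ?case by (simp add: b path_mult_add_right rep_add rep_single algebra_simps)
  next
    case (single b' d)
    obtain v q where b': "b' = (v, q)" by fastforce
    show ?case
    proof (cases "valid s \<and> smap lab s = u \<and> coeffs p s \<noteq> (0 :: 'k)")
      case True
      \<comment> \<open>The labels reached are the end of the walk \<open>p\<close>, so the test of
        labels in \<open>rep\<close> for the second factor is the composability test of
        \<open>path_mult\<close>.\<close>
      then have "smap lab (next_states p s) = w"
        using w smap_lab_next_states[of s p w, where 'k = 'k] by (auto simp: R.awalk_def)
      with True w show ?thesis
        by (auto simp: b b' path_mult_single rep_single valid_next_states awalk_awlast
            next_states_append coeffs_append)
    qed (auto simp: b b' path_mult_single rep_single coeffs_append)
  qed
qed (simp_all add: path_mult_add_left rep_add)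

lemma rep_arrows: "rep (arrows R_quiver es) \<phi> s =
    (if valid s \<and> smap lab s = tail R_quiver (hd es) then coeffs es s * \<phi> (next_states es s) else 0)"
  by (simp add: arrows_def rep_single)

text \<open>A coefficient depends on the strands at and to the left of its piece, so of two distant
  pieces only the right one notices the other. It changes sign exactly if both are crossings; dots
  have degree 0, keep original labels and have coefficients without signs.\<close>

lemma piece_sign:
  assumes "length P = length (bot_word g)" "length Q = length (bot_word h)"
    "distinct (map fst (u @ P @ c @ Q))"
  shows "piece_coeff h (map fst (u @ piece_next g P @ c)) Q =
    (- 1 :: 'k::field) powi (deg g * deg h) * piece_coeff h (map fst (u @ P @ c)) Q"
proof (cases g)
  case g: (Cr i j)
  with assms obtain p q where P: "P = [p, q]" "fst p \<noteq> fst q" by (auto simp: length_Suc_Suc_0)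
  show ?thesis
  proof (cases h)
    case (Cr i' j')
    then show ?thesis
      using g P crossing_sign_swap[of "fst p" "fst q" "map fst u" "map fst c"] by auto
  qed (use g in auto)
qed (use assms(1) in \<open>auto simp: length_Suc_0\<close>)

lemma rep_R_rel:
  fixes f :: "(int stream, diagram) path \<Rightarrow>\<^sub>0 'k::field"
  assumes "f \<in> R_rel"
  shows "rep f \<phi> s = 0"
  using assms
proof (cases rule: R_rel.cases)
  case (supercommute a c x g h)
  show ?thesis
  proof (cases "valid s \<and> smap lab s = a @- bot_word g @- c @- bot_word h @- x")
    case True
    obtain u P r where s: "s = u @- P @- r" "length u = length a" "length P = length (bot_word g)"
      by (rule diagram_split)
    obtain d Q r' where r: "r = d @- Q @- r'" "length d = length c" "length Q = length (bot_word h)"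
      by (rule diagram_split)
    have 1: "coeff (a @ w @ c, h, x) (u @- P' @- d @- Q @- r') = (piece_coeff h (map fst (u @ P' @ d)) Q :: 'k)"
      "next_state (a @ w @ c, h, x) (u @- P' @- d @- Q @- r') = u @- P' @- d @- piece_next h Q @- r'"
      if "length P' = length w" for P' w
      using that coeff_eval[of "u @ P' @ d" "a @ w @ c" Q h x r', where 'a = 'k]
        next_state_eval[of "u @ P' @ d" "a @ w @ c" Q h x r'] s r
      by simp_all
    have 2: "coeff (a, g, y) (u @- P @- r'') = (piece_coeff g (map fst u) P :: 'k)"
      "next_state (a, g, y) (u @- P @- r'') = u @- piece_next g P @- r''" for y r''
      using coeff_eval[of u a P g y r'', where 'a = 'k] next_state_eval[of u a P g y r''] s by simp_all
    have "distinct (map fst (u @ P @ d @ Q))"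
      using True s r by (auto simp: image_Un)
    then have 3: "piece_coeff h (map fst (u @ piece_next g P @ d)) Q =
        (- 1 :: 'k) powi (deg g * deg h) * piece_coeff h (map fst (u @ P @ d)) Q"
      using s r by (intro piece_sign) auto
    show ?thesis
      using True
      unfolding supercommute path_algebra_simps rep_diff rep_smul rep_arrows
      by (simp add: 1 2 3 s r del: next_state.simps coeff.simps map_append)
  qed (auto simp: supercommute rep_diff rep_smul rep_arrows)
next
  case (double_dot a x i)
  show ?thesis
    by (auto simp: double_dot rep_arrows)
next
  case (double_crossing a x i j)
  show ?thesis
  proof (cases "valid s \<and> smap lab s = a @- [i, j] @- x")
    case True
    obtain u P r where s: "s = u @- P @- r" "length u = length a" "length P = length [i, j]"
      by (rule diagram_split[of s a "Cr j i"]) simp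
    then obtain p q where P: "P = [p, q]" by (auto simp: length_Suc_Suc_0)
    have "lab p = i" "lab q = j" "fst p \<noteq> fst q"
      using True s P by (auto simp: shift_eq_shift_iff)
    \<comment> \<open>If \<open>i = j\<close>, one of the two crossings goes against the order of
      the original labels and has coefficient zero. Otherwise the two equal signs cancel.\<close>
    then show ?thesis using True s P crossing_sign_square[of "map fst u" "fst p" "fst q", where 'k = 'k]
      by (auto simp: double_crossing rep_diff rep_arrows idem_def rep_single stake_shift sdrop_shift numeral_2_eq_2
          crossing_sign_commute[of _ "fst q" "fst p"] lab_def split: if_splits)
  qed (auto simp: double_crossing rep_diff rep_arrows idem_def rep_single)
next
  case (braid a x i j k)
  show ?thesis
  proof (cases "valid s \<and> smap lab s = a @- [k, j, i] @- x")
    case True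
    obtain u P r where s: "s = u @- P @- r" "length u = length a" "length P = 3"
      by (metis stream_split_length)
    then obtain p q t where P: "P = [p, q, t]" by (auto simp: numeral_3_eq_3 length_Suc_conv)
    have l: "fst p \<noteq> fst q" "fst q \<noteq> fst t" "fst p \<noteq> fst t"
      using True s P by auto
    have 1: "coeff (a, Cr i' j', y) (u @- p' ## q' ## r') =
        (if lab p' = lab q' \<and> fst q' < fst p' then 0 else crossing_sign (map fst u) (fst p') (fst q') :: 'k)"
      "next_state (a, Cr i' j', y) (u @- p' ## q' ## r') = u @- q' ## p' ## r'" for i' j' y p' q' r'
      using s(2) by (simp_all only: crossing_eval)
    have 2: "coeff (a @ [k'], Cr i' j', y) (u @- t' ## p' ## q' ## r') =
        (if lab p' = lab q' \<and> fst q' < fst p' then 0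
         else crossing_sign (map fst u @ [fst t']) (fst p') (fst q') :: 'k)"
      "next_state (a @ [k'], Cr i' j', y) (u @- t' ## p' ## q' ## r') = u @- t' ## q' ## p' ## r'"
      for k' i' j' y t' p' q' r'
      using s(2) crossing_eval(1)[of "u @ [t']" "a @ [k']", where 'k = 'k]
        crossing_eval(2)[of "u @ [t']" "a @ [k']"]
      by (simp_all del: next_state.simps coeff.simps)
    \<comment> \<open>Both sides cross the same three pairs in the same orientation, so a forbidden
      crossing kills both of them.\<close>
    have "coeffs [(a, Cr j k, i ## x), (a @ [j], Cr i k, x), (a, Cr i j, k ## x)] s =
        (coeffs [(a @ [k], Cr i j, x), (a, Cr i k, j ## x), (a @ [i], Cr j k, x)] s :: 'k)"
      using crossing_sign_braid[OF l, of "map fst u", where 'k = 'k]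
      unfolding s P coeffs.simps shift.simps 1 2 by (simp add: mult.assoc)
    moreover have "next_states [(a, Cr j k, i ## x), (a @ [j], Cr i k, x), (a, Cr i j, k ## x)] s =
        next_states [(a @ [k], Cr i j, x), (a, Cr i k, j ## x), (a @ [i], Cr j k, x)] s"
      unfolding s P next_states.simps shift.simps 1 2 ..
    ultimately show ?thesis
      by (simp add: braid rep_diff rep_arrows del: coeffs.simps next_states.simps)
  qed (auto simp: braid rep_diff rep_arrows simp del: coeffs.simps next_states.simps)
next
  case (dot_slide a x i j)
  show ?thesis
  proof (cases "valid s \<and> smap lab s = a @- [i + 2, j] @- x")
    case True
    obtain u P r where s: "s = u @- P @- r" "length u = length a" "length P = length [i + 2, j]"
      by (rule diagram_split[of s a "Cr j (i + 2)"]) simp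
    then obtain p q where P: "P = [p, q]" by (auto simp: length_Suc_Suc_0)
    have "lab p = i + 2" "lab q = j" "fst p \<noteq> fst q"
      using True s P by (auto simp: shift_eq_shift_iff)
    \<comment> \<open>For undotted \<open>p\<close> neither crossing is forbidden. If
      \<open>q\<close> has the label \<open>fst p\<close>, then it is dotted and started at
      \<open>fst p + 2\<close>; if it has the label \<open>fst p - 2\<close>, then it is undotted,
      since \<open>fst q \<noteq> fst p\<close>. In both cases the strands cross in the permitted
      direction.\<close>
    then show ?thesis using True s P crossing_sign_square[of "map fst u" "fst p" "fst q", where 'k = 'k]
      by (auto simp: dot_slide rep_diff rep_arrows stake_shift sdrop_shift numeral_2_eq_2
          mult.assoc[symmetric] crossing_sign_commute[of _ "fst q" "fst p"] lab_def split: if_splits)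
  qed (auto simp: dot_slide rep_diff rep_arrows simp del: coeffs.simps next_states.simps)
qed

text \<open>The elements acting by zero on all functions form an ideal, and it contains the
  relations.\<close>

lemma rep_R_ideal:
  assumes "f \<in> R_ideal"
  shows "rep f \<phi> s = (0 :: 'k::field)"
proof -
  let ?K = "{f :: (int stream, diagram) path \<Rightarrow>\<^sub>0 'k.
    Poly_Mapping.keys f \<subseteq> paths R_quiver \<and> (\<forall>\<phi> s. rep f \<phi> s = 0)}"
  have "R.ideal ?K"
  proof (rule R.idealI)
    fix f g :: "(int stream, diagram) path \<Rightarrow>\<^sub>0 'k"
    assume f: "f \<in> ?K" and g: "Poly_Mapping.keys g \<subseteq> paths R_quiver"
    have 0: "rep f \<phi> = (\<lambda>_. 0)" for \<phi> using f by auto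
    have "rep g (\<lambda>_. 0) s = 0" for s
      using g by (induction rule: poly_mapping_keys_induct) (auto simp: rep_add rep_single)
    with f g 0 show "path_mult R_quiver g f \<in> ?K" "path_mult R_quiver f g \<in> ?K"
      by (simp_all add: R.path_mult_closed rep_path_mult)
  qed (simp_all add: rep_add rep_smul keys_add_subset order.trans[OF keys_smul_subset])
  moreover have "R_rel \<subseteq> ?K" using R_rel_car rep_R_rel by fastforce
  ultimately have "R_ideal \<subseteq> ?K" unfolding R_ideal_def by (rule R.ideal_gen_least)
  with assms show ?thesis by blast
qed

section \<open>Normal forms of diagrams\<close>

context path_quotient
begin

text \<open>The scalars need not be tracked: independence is read off the representation above.\<close>

definition proportional :: "('v, 'e) path \<Rightarrow> ('v, 'e) path \<Rightarrow> bool" where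
  "proportional p q \<longleftrightarrow> (\<exists>c. c \<noteq> 0 \<and> Poly_Mapping.single p 1 - Poly_Mapping.single q c \<in> I)"

definition vanishes :: "('v, 'e) path \<Rightarrow> bool" where
  "vanishes p \<longleftrightarrow> Poly_Mapping.single p 1 \<in> I"

lemma proportionalI:
  "c \<noteq> 0 \<Longrightarrow> Poly_Mapping.single p 1 - Poly_Mapping.single q c \<in> I \<Longrightarrow> proportional p q"
  by (auto simp: proportional_def)

lemma proportional_refl [simp]: "proportional p p"
  by (rule proportionalI[of 1]) (auto intro: ideal_zero)

lemma proportional_sym:
  assumes "proportional p q"
  shows "proportional q p"
proof -
  obtain c where c: "c \<noteq> 0" "Poly_Mapping.single p 1 - Poly_Mapping.single q c \<in> I"
    using assms by (auto simp: proportional_def)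
  have "smul (- inverse c) (Poly_Mapping.single p 1 - Poly_Mapping.single q c) \<in> I"
    using c(2) by (rule ideal_smul)
  then show ?thesis
    using c(1) by (intro proportionalI[of "inverse c"]) (simp_all add: smul_diff single_uminus)
qed

lemma proportional_trans [trans]:
  assumes "proportional p q" "proportional q r"
  shows "proportional p r"
proof -
  obtain c d where c: "c \<noteq> 0" "Poly_Mapping.single p 1 - Poly_Mapping.single q c \<in> I"
    and d: "d \<noteq> 0" "Poly_Mapping.single q 1 - Poly_Mapping.single r d \<in> I"
    using assms by (auto simp: proportional_def)
  have "Poly_Mapping.single p 1 - Poly_Mapping.single q c
      + smul c (Poly_Mapping.single q 1 - Poly_Mapping.single r d) \<in> I"
    using c(2) d(2) by (intro ideal_add ideal_smul)
  then show ?thesis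
    using c(1) d(1) by (intro proportionalI[of "c * d"]) (simp_all add: smul_diff)
qed

lemma vanishes_proportional:
  assumes "proportional p q" "vanishes q"
  shows "vanishes p"
proof -
  obtain c where "Poly_Mapping.single p 1 - Poly_Mapping.single q c \<in> I"
    using assms by (auto simp: proportional_def)
  moreover have "smul c (Poly_Mapping.single q 1) \<in> I"
    using assms(2) by (intro ideal_smul) (simp add: vanishes_def)
  ultimately have "Poly_Mapping.single p 1 - Poly_Mapping.single q c + smul c (Poly_Mapping.single q 1) \<in> I"
    by (rule ideal_add)
  then show ?thesis by (simp add: vanishes_def)
qed

lemma proportional_append:
  assumes "proportional (u, p) (u, p')" "awalk u p v" "awalk u p' v" "awalk v q w"
  shows "proportional (u, p @ q) (u, p' @ q)"
proof -
  obtain c where c: "c \<noteq> 0" "Poly_Mapping.single (u, p) 1 - Poly_Mapping.single (u, p') c \<in> I"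
    using assms by (auto simp: proportional_def)
  then have "path_mult G (Poly_Mapping.single (u, p) 1 - Poly_Mapping.single (u, p') c)
      (Poly_Mapping.single (v, q) 1) \<in> I"
    using assms(4) by (intro ideal_mult_right) (auto simp: paths_def)
  then show ?thesis using assms c(1)
    by (intro proportionalI[of c]) (auto simp: path_mult_diff_left path_mult_single)
qed

lemma proportional_prepend:
  assumes "proportional (v, p) (v, p')" "awalk u r v"
  shows "proportional (u, r @ p) (u, r @ p')"
proof -
  obtain c where c: "c \<noteq> 0" "Poly_Mapping.single (v, p) 1 - Poly_Mapping.single (v, p') c \<in> I"
    using assms by (auto simp: proportional_def)
  then have "path_mult G (Poly_Mapping.single (u, r) 1)
      (Poly_Mapping.single (v, p) 1 - Poly_Mapping.single (v, p') c) \<in> I"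
    using assms(2) by (intro ideal_mult_left) (auto simp: paths_def)
  then show ?thesis using assms c(1)
    by (intro proportionalI[of c]) (auto simp: path_mult_diff_right path_mult_single)
qed

lemma vanishes_append:
  assumes "vanishes (u, p)" "awalk u p v" "awalk v q w"
  shows "vanishes (u, p @ q)"
proof -
  have "path_mult G (Poly_Mapping.single (u, p) 1) (Poly_Mapping.single (v, q) 1) \<in> I"
    using assms by (intro ideal_mult_right) (auto simp: paths_def vanishes_def)
  then show ?thesis using assms by (auto simp: path_mult_single vanishes_def)
qed

lemma vanishes_prepend:
  assumes "vanishes (v, p)" "awalk u r v"
  shows "vanishes (u, r @ p)"
proof -
  have "path_mult G (Poly_Mapping.single (u, r) 1) (Poly_Mapping.single (v, p) 1) \<in> I"
    using assms by (intro ideal_mult_left) (auto simp: paths_def vanishes_def)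
  then show ?thesis using assms by (auto simp: path_mult_single vanishes_def)
qed

end

text \<open>The spanning half of the proof uses of the ideal only that it contains the relations.
  That it is not too large is the business of the representation.\<close>

locale diagram_quotient = path_quotient R_quiver J
  for J :: "((int stream, diagram) path \<Rightarrow>\<^sub>0 'k::field) set" +
  assumes R_rel_subset: "R_rel \<subseteq> J"
begin

lemma supercommute_proportional:
  assumes "a \<in> even_words" "c \<in> even_words" "x \<in> Mseq" "g \<in> even_pieces" "h \<in> even_pieces"
  shows "proportional
    (a @- bot_word g @- c @- bot_word h @- x, [(a, g, c @- bot_word h @- x), (a @ top_word g @ c, h, x)])
    (a @- bot_word g @- c @- bot_word h @- x, [(a @ bot_word g @ c, h, x), (a, g, c @- top_word h @- x)])"
proof (rule proportionalI)
  show "(- 1 :: 'k) powi (deg g * deg h) \<noteq> 0" by simp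
qed (use R_rel_subset R_rel.supercommute[OF assms, where 'k = 'k] in \<open>auto simp: arrows_def\<close>)

lemma crossing_inverse:
  assumes "a \<in> even_words" "x \<in> Mseq" "even i" "even j" "i \<noteq> j"
  shows "proportional (a @- i ## j ## x, [(a, Cr j i, x), (a, Cr i j, x)]) (a @- i ## j ## x, [])"
  using R_rel_subset R_rel.double_crossing[OF assms(1-4), where 'k = 'k] assms(5)
  by (intro proportionalI[of 1]) (auto simp: arrows_def idem_def)

lemma braid_proportional:
  assumes "a \<in> even_words" "x \<in> Mseq" "even i" "even j" "even k"
  shows "proportional
    (a @- k ## j ## i ## x, [(a, Cr j k, i ## x), (a @ [j], Cr i k, x), (a, Cr i j, k ## x)])
    (a @- k ## j ## i ## x, [(a @ [k], Cr i j, x), (a, Cr i k, j ## x), (a @ [i], Cr j k, x)])"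
  using R_rel_subset R_rel.braid[OF assms, where 'k = 'k]
  by (intro proportionalI[of 1]) (auto simp: arrows_def)

lemma dot_slide_proportional:
  assumes "a \<in> even_words" "x \<in> Mseq" "even i" "even j"
  shows "proportional (a @- (i + 2) ## j ## x, [(a, Dot i, j ## x)])
    (a @- (i + 2) ## j ## x, [(a, Cr j (i + 2), x), (a @ [j], Dot i, x), (a, Cr i j, x)])"
  using R_rel_subset R_rel.dot_slide[OF assms, where 'k = 'k]
  by (intro proportionalI[of 1]) (auto simp: arrows_def)

text \<open>A crossing put below the dot slide cancels its first crossing, whose labels
  \<open>j\<close> and \<open>i + 2\<close> differ.\<close>

lemma dot_after_crossing:
  assumes "a \<in> even_words" "x \<in> Mseq" "even i" "even j" "j \<noteq> i + 2"
  shows "proportional (a @- j ## (i + 2) ## x, [(a, Cr (i + 2) j, x), (a, Dot i, j ## x)])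
    (a @- j ## (i + 2) ## x, [(a @ [j], Dot i, x), (a, Cr i j, x)])"
proof -
  let ?u = "a @- j ## (i + 2) ## x"
  have "proportional (?u, [(a, Cr (i + 2) j, x)] @ [(a, Dot i, j ## x)])
      (?u, [(a, Cr (i + 2) j, x)] @ [(a, Cr j (i + 2), x), (a @ [j], Dot i, x), (a, Cr i j, x)])"
    by (rule proportional_prepend[OF dot_slide_proportional])
      (use assms in \<open>auto simp: awalk_Cons_iff awalk_Nil_iff\<close>)
  also have "proportional \<dots> (?u, [] @ [(a @ [j], Dot i, x), (a, Cr i j, x)])"
    using proportional_append[OF crossing_inverse[OF assms(1,2) _ _ assms(5)], of "?u"
        "[(a @ [j], Dot i, x), (a, Cr i j, x)]" "a @- i ## j ## x"] assms
    by (simp add: awalk_Cons_iff awalk_Nil_iff)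
  finally show ?thesis by simp
qed

text \<open>A crossing put on top of the dot slide cancels its last crossing, whose labels
  \<open>i\<close> and \<open>j\<close> differ.\<close>

lemma dot_before_crossing:
  assumes "a \<in> even_words" "x \<in> Mseq" "even i" "even j" "j \<noteq> i"
  shows "proportional (a @- (i + 2) ## j ## x, [(a, Dot i, j ## x), (a, Cr j i, x)])
    (a @- (i + 2) ## j ## x, [(a, Cr j (i + 2), x), (a @ [j], Dot i, x)])"
proof -
  let ?u = "a @- (i + 2) ## j ## x"
  have "proportional (?u, [(a, Dot i, j ## x)] @ [(a, Cr j i, x)])
      (?u, [(a, Cr j (i + 2), x), (a @ [j], Dot i, x), (a, Cr i j, x)] @ [(a, Cr j i, x)])"
    by (rule proportional_append[OF dot_slide_proportional])
      (use assms in \<open>auto simp: awalk_Cons_iff awalk_Nil_iff\<close>)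
  also have "proportional \<dots> (?u, [(a, Cr j (i + 2), x), (a @ [j], Dot i, x)] @ [])"
    using proportional_prepend[OF crossing_inverse[OF assms(1,2) assms(4) assms(3) assms(5)], of ?u
        "[(a, Cr j (i + 2), x), (a @ [j], Dot i, x)]"] assms
    by (simp add: awalk_Cons_iff awalk_Nil_iff)
  finally show ?thesis by simp
qed

end

section \<open>Moves of strands and their weight\<close>

inductive local_move :: "piece \<Rightarrow> strand list \<Rightarrow> strand list \<Rightarrow> bool" where
  dot: "local_move (Dot (l - 2)) [(l, False)] [(l, True)]"
| cross: "fst p < fst q \<Longrightarrow> local_move (Cr (lab q) (lab p)) [p, q] [q, p]"

definition even_strands :: "strand list \<Rightarrow> bool" where
  "even_strands w \<longleftrightarrow> (\<forall>p\<in>set w. even (fst p))"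

lemma even_strands_simps [simp]:
  "even_strands []" "even_strands (p # w) \<longleftrightarrow> even (fst p) \<and> even_strands w"
  "even_strands (v @ w) \<longleftrightarrow> even_strands v \<and> even_strands w"
  by (auto simp: even_strands_def)

lemma even_lab [simp]: "even (lab p) \<longleftrightarrow> even (fst p)"
  by (simp add: lab_def)

lemma map_lab_even [simp]: "map lab w \<in> even_words \<longleftrightarrow> even_strands w"
  by (induction w) auto

lemma local_move_words:
  "local_move g P P' \<Longrightarrow> bot_word g = map lab P \<and> top_word g = map lab P'"
  by (induction rule: local_move.induct) auto

lemma local_move_even: "local_move g P P' \<Longrightarrow> even_strands P' \<longleftrightarrow> even_strands P"
  by (induction rule: local_move.induct) auto

lemma local_move_even_pieces: "local_move g P P' \<Longrightarrow> even_strands P \<Longrightarrow> g \<in> even_pieces"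
  by (induction rule: local_move.induct) auto

text \<open>The move takes place inside a finite word of strands; \<open>t\<close> is the tail of
  the sequence, which no move touches.\<close>

inductive up :: "int stream \<Rightarrow> strand list \<Rightarrow> diagram \<Rightarrow> strand list \<Rightarrow> bool" for t where
  upI: "local_move g P P' \<Longrightarrow>
    up t (u @ P @ v) (map lab u, g, map lab v @- t) (u @ P' @ v)"

text \<open>Paths grow at the top, because uniqueness is proved by stripping the last move.\<close>

inductive ups :: "int stream \<Rightarrow> strand list \<Rightarrow> diagram list \<Rightarrow> strand list \<Rightarrow> bool" for t w where
  ups_Nil: "ups t w [] w"
| ups_snoc: "ups t w es w' \<Longrightarrow> up t w' e w'' \<Longrightarrow> ups t w (es @ [e]) w''"

text \<open>Each move creates exactly one inversion of the original labels or one dot. Hence the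
  weight is the length of every path of moves from the undotted increasing state, which makes it the
  induction measure.\<close>

definition weight :: "strand list \<Rightarrow> nat" where
  "weight w = invs (map fst w) + length (filter snd w)"

lemma invs_swap_fst:
  "fst p < fst q \<Longrightarrow> invs (map fst u @ fst q # fst p # L) = Suc (invs (map fst u @ fst p # fst q # L))"
  by (rule invs_swap)

lemma up_weight: "up t w e w' \<Longrightarrow> weight w' = Suc (weight w)"
  by (induction rule: up.induct; erule local_move.cases) (auto simp: weight_def invs_swap_fst)

lemma up_mset: "up t w e w' \<Longrightarrow> mset (map fst w') = mset (map fst w)"
  by (induction rule: up.induct; erule local_move.cases) auto

lemma up_even: "up t w e w' \<Longrightarrow> even_strands w' \<longleftrightarrow> even_strands w"
  by (induction rule: up.induct) (auto simp: local_move_even)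

lemma up_awalk:
  assumes "up t w e w'" "even_strands w" "t \<in> Mseq"
  shows "R.awalk (map lab w @- t) [e] (map lab w' @- t)"
  using assms
  by (induction rule: up.induct)
    (auto simp: R.awalk_Cons_iff R.awalk_Nil_iff local_move_words local_move_even local_move_even_pieces)

lemma ups_mset: "ups t w es w' \<Longrightarrow> mset (map fst w') = mset (map fst w)"
  by (induction rule: ups.induct) (auto dest: up_mset)

lemma ups_even: "ups t w es w' \<Longrightarrow> even_strands w' \<longleftrightarrow> even_strands w"
  by (induction rule: ups.induct) (auto dest: up_even)

lemma ups_weight: "ups t w es w' \<Longrightarrow> weight w' = weight w + length es"
  by (induction rule: ups.induct) (auto dest: up_weight)

lemma ups_awalk:
  assumes "ups t w es w'" "even_strands w" "t \<in> Mseq"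
  shows "R.awalk (map lab w @- t) es (map lab w' @- t)"
  using assms
proof (induction rule: ups.induct)
  case ups_Nil
  then show ?case by (simp add: R.awalk_Nil_iff)
next
  case (ups_snoc es w' e w'')
  then show ?case
    using up_awalk[of t w' e w''] ups_even[of t w es w'] by (auto intro: R.awalk_appendI)
qed

lemma ups_append: "ups t w' q w'' \<Longrightarrow> ups t w p w' \<Longrightarrow> ups t w (p @ q) w''"
  by (induction rule: ups.induct) (auto intro: ups_snoc simp flip: append_assoc)

lemma ups_single: "up t w e w' \<Longrightarrow> ups t w [e] w'"
  using ups_snoc[OF ups_Nil, of t w e w'] by simp

lemma up_dot: "up t (u @ (l, False) # v) (map lab u, Dot (l - 2), map lab v @- t) (u @ (l, True) # v)"
  using upI[OF local_move.dot, of t u l v] by simp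

lemma up_cross:
  "fst p < fst q \<Longrightarrow>
    up t (u @ p # q # v) (map lab u, Cr (lab q) (lab p), map lab v @- t) (u @ q # p # v)"
  using upI[OF local_move.cross, of p q t u v] by simp

lemma up_cross2:
  "fst p < fst q \<Longrightarrow>
    up t (u @ o' # p # q # v) (map lab u @ [lab o'], Cr (lab q) (lab p), map lab v @- t) (u @ o' # q # p # v)"
  using up_cross[of p q t "u @ [o']" v] by simp

lemma up_dot2:
  "up t (u @ p # (l, False) # v) (map lab u @ [lab p], Dot (l - 2), map lab v @- t) (u @ p # (l, True) # v)"
  using up_dot[of t "u @ [p]" l v] by simp

section \<open>Local confluence\<close>

context diagram_quotient
begin

text \<open>A diamond read downwards: \<open>e1\<close> and \<open>e2\<close> are meant to be two
  moves into the same state, and they are compared along paths from an earlier state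
  \<open>w0\<close>.\<close>

definition joinable :: "int stream \<Rightarrow> strand list \<Rightarrow> diagram \<Rightarrow> strand list \<Rightarrow> diagram \<Rightarrow> bool" where
  "joinable t w1 e1 w2 e2 \<longleftrightarrow> w1 = w2 \<and> e1 = e2 \<or>
    (\<exists>w0 p1 p2. ups t w0 p1 w1 \<and> ups t w0 p2 w2 \<and>
      proportional (map lab w0 @- t, p1 @ [e1]) (map lab w0 @- t, p2 @ [e2]))"

lemma joinable_sym: "joinable t w1 e1 w2 e2 \<Longrightarrow> joinable t w2 e2 w1 e1"
  unfolding joinable_def using proportional_sym by blast

lemma joinableI:
  "ups t w0 p1 w1 \<Longrightarrow> ups t w0 p2 w2 \<Longrightarrow>
    proportional (map lab w0 @- t, p1 @ [e1]) (map lab w0 @- t, p2 @ [e2]) \<Longrightarrow> joinable t w1 e1 w2 e2"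
  unfolding joinable_def by blast

text \<open>Moves on disjoint strands can be made in either order by supercommutation.\<close>

lemma joinable_disjoint:
  assumes "local_move g P P'" "local_move h Q Q'" "t \<in> Mseq" "even_strands (u @ P' @ c @ Q' @ v)"
  shows "joinable t (u @ P @ c @ Q' @ v) (map lab u, g, map lab (c @ Q' @ v) @- t)
    (u @ P' @ c @ Q @ v) (map lab (u @ P' @ c), h, map lab v @- t)"
proof (rule joinableI)
  have P: "bot_word g = map lab P" "top_word g = map lab P'" and Q: "bot_word h = map lab Q" "top_word h = map lab Q'"
    using assms(1,2) by (auto dest: local_move_words)
  show "ups t (u @ P @ c @ Q @ v) [(map lab (u @ P @ c), h, map lab v @- t)] (u @ P @ c @ Q' @ v)"
    using upI[OF assms(2), of t "u @ P @ c" v] by (intro ups_single) simp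
  show "ups t (u @ P @ c @ Q @ v) [(map lab u, g, map lab (c @ Q @ v) @- t)] (u @ P' @ c @ Q @ v)"
    using upI[OF assms(1), of t u "c @ Q @ v"] by (intro ups_single) simp
  have "proportional (map lab (u @ P @ c @ Q @ v) @- t,
      [(map lab u, g, map lab (c @ Q @ v) @- t), (map lab (u @ P' @ c), h, map lab v @- t)])
    (map lab (u @ P @ c @ Q @ v) @- t,
      [(map lab (u @ P @ c), h, map lab v @- t), (map lab u, g, map lab (c @ Q' @ v) @- t)])"
    using supercommute_proportional[of "map lab u" "map lab c" "map lab v @- t" g h] assms
    by (simp add: P Q local_move_even local_move_even_pieces)
  from proportional_sym[OF this]
  show "proportional (map lab (u @ P @ c @ Q @ v) @- t,
      [(map lab (u @ P @ c), h, map lab v @- t)] @ [(map lab u, g, map lab (c @ Q' @ v) @- t)])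
    (map lab (u @ P @ c @ Q @ v) @- t,
      [(map lab u, g, map lab (c @ Q @ v) @- t)] @ [(map lab (u @ P' @ c), h, map lab v @- t)])"
    by simp
qed

text \<open>A dotted strand stands to the left of a strand \<open>p\<close> that it has crossed: the
  dot was put on either before or after the crossing, and \<open>dot_after_crossing\<close> compares
  the two.\<close>

lemma joinable_cross_dot_left:
  assumes "fst p < l" "t \<in> Mseq" "even l" "even_strands (p # u @ v)"
  shows "joinable t (u @ p # (l, True) # v) (map lab u, Cr (l - 2) (lab p), map lab v @- t)
    (u @ (l, False) # p # v) (map lab u, Dot (l - 2), lab p ## map lab v @- t)"
proof (rule joinableI)
  show "ups t (u @ p # (l, False) # v) [(map lab u @ [lab p], Dot (l - 2), map lab v @- t)]
      (u @ p # (l, True) # v)"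
    by (intro ups_single up_dot2)
  show "ups t (u @ p # (l, False) # v) [(map lab u, Cr l (lab p), map lab v @- t)]
      (u @ (l, False) # p # v)"
    using up_cross[of p "(l, False)" t u v] assms(1) by (intro ups_single) simp
  \<comment> \<open>Dots only lower labels: \<open>lab p \<le> fst p < l\<close>.\<close>
  have "lab p \<noteq> l - 2 + 2" using assms(1) by (auto simp: lab_def)
  from proportional_sym[OF dot_after_crossing[OF _ _ _ _ this, of "map lab u" "map lab v @- t"]] assms
  show "proportional (map lab (u @ p # (l, False) # v) @- t,
      [(map lab u @ [lab p], Dot (l - 2), map lab v @- t)] @ [(map lab u, Cr (l - 2) (lab p), map lab v @- t)])
    (map lab (u @ p # (l, False) # v) @- t,
      [(map lab u, Cr l (lab p), map lab v @- t)] @ [(map lab u, Dot (l - 2), lab p ## map lab v @- t)])"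
    by simp
qed

lemma joinable_cross_dot_right:
  assumes "l < fst q" "t \<in> Mseq" "even_strands (q # u @ v)" "even l"
  shows "joinable t (u @ (l, True) # q # v) (map lab u, Cr (lab q) (l - 2), map lab v @- t)
    (u @ q # (l, False) # v) (map lab u @ [lab q], Dot (l - 2), map lab v @- t)"
proof (rule joinableI)
  show "ups t (u @ (l, False) # q # v) [(map lab u, Dot (l - 2), lab q ## map lab v @- t)]
      (u @ (l, True) # q # v)"
    using up_dot[of t u l "q # v"] by (intro ups_single) simp
  show "ups t (u @ (l, False) # q # v) [(map lab u, Cr (lab q) l, map lab v @- t)]
      (u @ q # (l, False) # v)"
    using up_cross[of "(l, False)" q t u v] assms(1) by (intro ups_single) simp
  \<comment> \<open>A strand carries at most one dot:
    \<open>l - 2 < fst q - 2 \<le> lab q\<close>.\<close>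
  have "lab q \<noteq> l - 2" using assms(1) by (auto simp: lab_def)
  from dot_before_crossing[OF _ _ _ _ this, of "map lab u" "map lab v @- t"] assms
  show "proportional (map lab (u @ (l, False) # q # v) @- t,
      [(map lab u, Dot (l - 2), lab q ## map lab v @- t)] @ [(map lab u, Cr (lab q) (l - 2), map lab v @- t)])
    (map lab (u @ (l, False) # q # v) @- t,
      [(map lab u, Cr (lab q) l, map lab v @- t)] @ [(map lab u @ [lab q], Dot (l - 2), map lab v @- t)])"
    by simp
qed

text \<open>The three strands end up completely reversed from \<open>r\<close>, \<open>p\<close>,
  \<open>q\<close>. The last crossing is that of the left or of the right pair, and the braid
  relation compares the two.\<close>

lemma joinable_cross_cross:
  assumes "fst r < fst p" "fst p < fst q" "t \<in> Mseq" "even_strands (p # q # r # u @ v)"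
  shows "joinable t (u @ p # q # r # v) (map lab u, Cr (lab q) (lab p), lab r ## map lab v @- t)
    (u @ q # r # p # v) (map lab u @ [lab q], Cr (lab p) (lab r), map lab v @- t)"
proof (rule joinableI)
  have "ups t (u @ r # p # q # v) [(map lab u, Cr (lab p) (lab r), lab q ## map lab v @- t)]
      (u @ p # r # q # v)"
    using up_cross[of r p t u "q # v"] assms(1) by (intro ups_single) simp
  from ups_snoc[OF this up_cross2[of r q t u p v]]
  show "ups t (u @ r # p # q # v)
      [(map lab u, Cr (lab p) (lab r), lab q ## map lab v @- t),
       (map lab u @ [lab p], Cr (lab q) (lab r), map lab v @- t)] (u @ p # q # r # v)"
    using assms(1,2) by simp
  have "ups t (u @ r # p # q # v) [(map lab u @ [lab r], Cr (lab q) (lab p), map lab v @- t)]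
      (u @ r # q # p # v)"
    using up_cross2[of p q t u r v] assms(2) by (intro ups_single) simp
  from ups_snoc[OF this up_cross[of r q t u "p # v"]]
  show "ups t (u @ r # p # q # v)
      [(map lab u @ [lab r], Cr (lab q) (lab p), map lab v @- t),
       (map lab u, Cr (lab q) (lab r), lab p ## map lab v @- t)] (u @ q # r # p # v)"
    using assms(1,2) by simp
  show "proportional (map lab (u @ r # p # q # v) @- t,
      [(map lab u, Cr (lab p) (lab r), lab q ## map lab v @- t),
       (map lab u @ [lab p], Cr (lab q) (lab r), map lab v @- t)]
      @ [(map lab u, Cr (lab q) (lab p), lab r ## map lab v @- t)])
    (map lab (u @ r # p # q # v) @- t,
      [(map lab u @ [lab r], Cr (lab q) (lab p), map lab v @- t),
       (map lab u, Cr (lab q) (lab r), lab p ## map lab v @- t)]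
      @ [(map lab u @ [lab q], Cr (lab p) (lab r), map lab v @- t)])"
    using braid_proportional[of "map lab u" "map lab v @- t" "lab q" "lab p" "lab r"] assms by simp
qed

text \<open>The output \<open>P'\<close> starts no further right than \<open>Q'\<close> in the
  common target. Disjoint outputs supercommute; overlapping ones involve at most three strands, and
  only equal moves and the three critical pairs above remain.\<close>

lemma joinable_ordered:
  assumes "local_move g P P'" "local_move h Q Q'" "t \<in> Mseq" "even_strands (u @ P' @ v)"
    "P' @ v = c @ Q' @ v'"
  shows "joinable t (u @ P @ v) (map lab u, g, map lab v @- t)
    (u @ c @ Q @ v') (map lab (u @ c), h, map lab v' @- t)"
proof -
  from assms(5) consider d where "c = P' @ d" "v = d @ Q' @ v'"
    | d where "P' = c @ d" "d \<noteq> []" "d @ v = Q' @ v'"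
  proof -
    from assms(5) obtain us where "P' = c @ us \<and> us @ v = Q' @ v' \<or> P' @ us = c \<and> v = us @ Q' @ v'"
      unfolding append_eq_append_conv2 by blast
    then show thesis using that(1)[of us] that(1)[of "[]"] that(2)[of us] by (cases "us = []") auto
  qed
  then show ?thesis
  proof cases
    case 1
    with joinable_disjoint[OF assms(1-3), of u d v'] assms(4) show ?thesis by simp
  next
    case 2
    note c = 2
    from assms(1) show ?thesis
    proof cases
      case g: (dot l)
      with c have [simp]: "c = []" "d = [(l, True)]" by (auto simp: Cons_eq_append_conv)
      from assms(2) show ?thesis
      proof cases
        case (dot l')
        with g c show ?thesis by (simp add: joinable_def)
      next
        case (cross p q)
        with g c have "q = (l, True)" "v = p # v'" by auto
        with joinable_sym[OF joinable_cross_dot_left[of p l t u v']] g cross assms(3,4) show ?thesis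
          by auto
      qed
    next
      case g: (cross p q)
      with c consider "c = []" "d = [q, p]" | "c = [q]" "d = [p]"
        by (auto simp: Cons_eq_append_conv)
      then show ?thesis
      proof cases
        case 1
        from assms(2) show ?thesis
        proof cases
          case (dot l)
          with 1 c have "q = (l, True)" "v' = p # v" by auto
          with joinable_cross_dot_left[of p l t u v] g 1 dot assms(3,4) show ?thesis by auto
        next
          case (cross p' q')
          with g c 1 show ?thesis by (simp add: joinable_def)
        qed
      next
        case 2
        from assms(2) show ?thesis
        proof cases
          case (dot l)
          with 2 c have "p = (l, True)" "v' = v" by auto
          with joinable_cross_dot_right[of l q t u v] g 2 dot assms(3,4) show ?thesis by auto
        next
          case (cross p' q')
          with 2 c have "p = q'" "v = p' # v'" by auto
          with joinable_cross_cross[of p' p q t u v'] g 2 cross assms(3,4) show ?thesis by auto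
        qed
      qed
    qed
  qed
qed

lemma joinable_up:
  assumes "up t w1 e1 w" "up t w2 e2 w" "t \<in> Mseq" "even_strands w"
  shows "joinable t w1 e1 w2 e2"
proof -
  from assms(1) obtain g P P' u v where 1: "local_move g P P'" "w1 = u @ P @ v"
    "e1 = (map lab u, g, map lab v @- t)" "w = u @ P' @ v" by (auto elim: up.cases)
  from assms(2) obtain h Q Q' u' v' where 2: "local_move h Q Q'" "w2 = u' @ Q @ v'"
    "e2 = (map lab u', h, map lab v' @- t)" "w = u' @ Q' @ v'" by (auto elim: up.cases)
  from 1(4) 2(4) have "u @ P' @ v = u' @ Q' @ v'" by simp
  then consider c where "u' = u @ c" "P' @ v = c @ Q' @ v'"
    | c where "u = u' @ c" "Q' @ v' = c @ P' @ v"
    unfolding append_eq_append_conv2[of u "P' @ v" u' "Q' @ v'"] by metis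
  then show ?thesis
  proof cases
    case (1 c)
    with joinable_ordered[OF \<open>local_move g P P'\<close> \<open>local_move h Q Q'\<close> assms(3), of u v c v']
      \<open>w = u @ P' @ v\<close> \<open>w1 = _\<close> \<open>e1 = _\<close> \<open>w2 = _\<close> \<open>e2 = _\<close> assms(4)
    show ?thesis by simp
  next
    case (2 c)
    with joinable_ordered[OF \<open>local_move h Q Q'\<close> \<open>local_move g P P'\<close> assms(3), of u' v' c v]
      \<open>w = u' @ Q' @ v'\<close> \<open>w1 = _\<close> \<open>e1 = _\<close> \<open>w2 = _\<close> \<open>e2 = _\<close> assms(4)
    show ?thesis by (simp add: joinable_sym)
  qed
qed

end

section \<open>Uniqueness and existence of normal forms\<close>

lemma invs_zero_iff: "invs L = 0 \<longleftrightarrow> sorted L"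
  by (induction L) (auto simp: filter_empty_conv not_less)

lemma unsorted_descent:
  assumes "\<not> sorted L"
  obtains U a b V where "L = U @ b # a # V" "a < (b :: 'a :: linorder)"
  using assms
proof (induction L arbitrary: thesis)
  case (Cons x L)
  show ?case
  proof (cases "sorted L")
    case True
    with Cons.prems obtain y L' where "L = y # L'" "y < x"
      by (cases L) (auto simp: not_le)
    with Cons.prems(1)[of "[]" x y L'] show ?thesis by simp
  next
    case False
    then obtain U a b V where "L = U @ b # a # V" "a < b" using Cons.IH by metis
    with Cons.prems(1)[of "x # U" b a V] show ?thesis by simp
  qed
qed simp

text \<open>In use, \<open>X\<close> is an initial segment of an increasing sequence, long enough to
  contain all strands that a given path of diagrams touches, and \<open>t\<close> is the
  rest.\<close>

locale state_space = diagram_quotient J for J :: "((int stream, diagram) path \<Rightarrow>\<^sub>0 'k::field) set" +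
  fixes X :: "int list" and t :: "int stream"
  assumes X_sorted: "sorted_wrt (<) X" and X_even: "X \<in> even_words" and t_Mseq: "t \<in> Mseq"
begin

definition base :: "strand list" where
  "base = map (\<lambda>l. (l, False)) X"

definition state :: "strand list \<Rightarrow> bool" where
  "state w \<longleftrightarrow> mset (map fst w) = mset X"

lemma map_fst_base [simp]: "map fst base = X"
  by (simp add: base_def comp_def)

lemma map_lab_base [simp]: "map lab base = X"
  by (simp add: base_def comp_def)

lemma state_base: "state base"
  by (simp add: state_def)

lemma state_even: "state w \<Longrightarrow> even_strands w"
  using X_even unfolding state_def even_strands_def even_words_def
  by (metis (mono_tags, lifting) image_eqI list.set_map mem_Collect_eq mset_eq_setD in_listsD)

lemma state_distinct: "state w \<Longrightarrow> distinct (map fst w)"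
  using X_sorted unfolding state_def by (metis mset_eq_imp_distinct_iff strict_sorted_iff)

lemma state_length: "state w \<Longrightarrow> length w = length X"
  unfolding state_def by (metis length_map mset_eq_length)

lemma weight_base: "weight base = 0"
  using X_sorted by (auto simp: weight_def invs_zero_iff strict_sorted_iff) (auto simp: base_def filter_empty_conv)

lemma sorted_state: "state w \<Longrightarrow> sorted (map fst w) \<Longrightarrow> map fst w = X"
  using X_sorted unfolding state_def by (metis properties_for_sort strict_sorted_iff)

lemma state_weight_zero:
  assumes "state w" "weight w = 0"
  shows "w = base"
proof -
  have "map fst w = X" using assms by (auto simp: weight_def invs_zero_iff intro!: sorted_state)
  moreover have "w = map (\<lambda>l. (l, False)) (map fst w)"
    using assms(2) by (auto simp: weight_def filter_empty_conv intro!: map_idI[symmetric])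
  ultimately show ?thesis by (simp add: base_def)
qed

text \<open>Any dot can be taken off. Without dots, positive weight means that the original labels
  are unsorted, and an adjacent descent can be uncrossed.\<close>

lemma down_exists:
  assumes "weight w \<noteq> 0"
  obtains w' e where "up t w' e w"
proof (cases "\<exists>l. (l, True) \<in> set w")
  case True
  then obtain l u v where "w = u @ (l, True) # v" by (metis split_list)
  with that up_dot[of t u l v] show ?thesis by metis
next
  case False
  then have "filter snd w = []" by (auto simp: filter_empty_conv)
  with assms have "\<not> sorted (map fst w)" by (auto simp: weight_def invs_zero_iff)
  then obtain U a b V where L: "map fst w = U @ b # a # V" "a < b" by (rule unsorted_descent)
  then obtain u q p v where "w = u @ q # p # v" "fst q = b" "fst p = a"
    by (auto simp: map_eq_append_conv map_eq_Cons_conv)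
  with that up_cross[of p q t u v] L(2) show ?thesis by metis
qed

lemma up_state: "up t w' e w \<Longrightarrow> state w' \<longleftrightarrow> state w"
  by (auto simp: state_def dest: up_mset)

lemma state_reachable: "state w \<Longrightarrow> \<exists>p. ups t base p w"
proof (induction "weight w" arbitrary: w)
  case 0
  with state_weight_zero[of w] show ?case by (auto intro: ups_Nil)
next
  case (Suc n)
  then have "weight w \<noteq> 0" by simp
  then obtain w' e where e: "up t w' e w" by (rule down_exists)
  with Suc up_weight[OF e] up_state[OF e] show ?case by (auto intro: ups_snoc)
qed

lemma ups_state: "ups t base p w \<Longrightarrow> state w"
  using ups_mset[of t base p w] by (simp only: state_def map_fst_base)

text \<open>Induction on the weight: the last moves of the two paths are compared through an earlier
  state \<open>w0\<close>, and the induction hypothesis applies to the states just before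
  them.\<close>

lemma ups_unique:
  "ups t base p w \<Longrightarrow> ups t base q w \<Longrightarrow> proportional (X @- t, p) (X @- t, q)"
proof (induction "weight w" arbitrary: w p q rule: less_induct)
  case less
  have st: "state w" using less.prems(1) by (rule ups_state)
  have len: "length p = weight w" "length q = weight w"
    using less.prems[THEN ups_weight] weight_base by simp_all
  show ?case
  proof (cases "weight w = 0")
    case True
    with len show ?thesis by simp
  next
    case False
    from less.prems(1) False len obtain p1 w1 e1 where
      p: "p = p1 @ [e1]" "ups t base p1 w1" "up t w1 e1 w" by (auto elim: ups.cases)
    from less.prems(2) False len obtain q1 w2 e2 where
      q: "q = q1 @ [e2]" "ups t base q1 w2" "up t w2 e2 w" by (auto elim: ups.cases)
    have lt: "weight w1 < weight w" "weight w2 < weight w"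
      using up_weight[OF p(3)] up_weight[OF q(3)] by auto
    have st12: "state w1" "state w2"
      using st p(3) q(3) by (auto simp: up_state)
    have ev: "even_strands base" by (rule state_even[OF state_base])
    note walks = ups_awalk[OF _ ev t_Mseq, unfolded map_lab_base]
    have e1: "awalk (map lab w1 @- t) [e1] (map lab w @- t)"
      and e2: "awalk (map lab w2 @- t) [e2] (map lab w @- t)"
      using p(3) q(3) st12 t_Mseq state_even by (auto intro: up_awalk)
    from joinable_up[OF p(3) q(3) t_Mseq state_even[OF st]]
    consider "w1 = w2" "e1 = e2" | w0 p0 q0 where "ups t w0 p0 w1" "ups t w0 q0 w2"
      "proportional (map lab w0 @- t, p0 @ [e1]) (map lab w0 @- t, q0 @ [e2])"
      unfolding joinable_def by blast
    then show ?thesis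
    proof cases
      case 1
      with less.hyps[OF lt(1) p(2), of q1] p q walks e1 show ?thesis
        by (auto intro: proportional_append)
    next
      case 2
      have "state w0" using 2(1) st12(1) ups_mset by (simp add: state_def)
      \<comment> \<open>The state \<open>w0\<close> need not lie on either given path, so it is
        joined to \<open>base\<close> separately.\<close>
      then obtain r where r: "ups t base r w0" using state_reachable by blast
      have "proportional (X @- t, p1 @ [e1]) (X @- t, (r @ p0) @ [e1])"
        using less.hyps[OF lt(1) p(2) ups_append[OF 2(1) r]] walks[OF p(2)] walks[OF ups_append[OF 2(1) r]] e1
        by (rule proportional_append)
      also have "proportional (X @- t, (r @ p0) @ [e1]) (X @- t, (r @ q0) @ [e2])"
        using proportional_prepend[OF 2(3) walks[OF r]] by simp
      also have "proportional (X @- t, (r @ q0) @ [e2]) (X @- t, q1 @ [e2])"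
        using less.hyps[OF lt(2) ups_append[OF 2(2) r] q(2)] walks[OF ups_append[OF 2(2) r]] walks[OF q(2)] e2
        by (rule proportional_append)
      finally show ?thesis using p q by simp
    qed
  qed
qed

text \<open>If the new generator is not itself a move, it is a second dot or a crossing against the
  order of the original labels. Then the path below it may be taken to end in the first dot or in
  the inverse crossing, and the quadratic relations give zero or a shorter path.\<close>

lemma ups_step:
  assumes "ups t base q w" "awalk (map lab w @- t) [(a, g, z)] y"
    "length a + length (bot_word g) \<le> length X"
  shows "vanishes (X @- t, q @ [(a, g, z)]) \<or>
    (\<exists>w' q'. ups t base q' w' \<and> y = map lab w' @- t \<and>
      proportional (X @- t, q @ [(a, g, z)]) (X @- t, q'))"
proof -
  have st: "state w" using assms(1) by (rule ups_state)
  have ev: "even_strands base" by (rule state_even[OF state_base])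
  note walks = ups_awalk[OF _ ev t_Mseq, unfolded map_lab_base]
  define u P v where "u = take (length a) w" and "P = take (length (bot_word g)) (drop (length a) w)"
    and "v = drop (length a + length (bot_word g)) w"
  have w: "w = u @ P @ v"
    unfolding u_def P_def v_def by (metis append_take_drop_id drop_drop add.commute)
  have len: "length u = length a" "length P = length (bot_word g)"
    using assms(3) state_length[OF st] by (auto simp: u_def P_def)
  have arc: "a \<in> even_words" "g \<in> even_pieces" "z \<in> Mseq"
    and match: "map lab w @- t = a @- bot_word g @- z" and y: "y = a @- top_word g @- z"
    using assms(2) by (auto simp: awalk_Cons_iff awalk_Nil_iff)
  from match have labs: "map lab u = a" "map lab P = bot_word g" "z = map lab v @- t"
    using len by (auto simp: w shift_eq_shift_iff)
  have evw: "even_strands w" by (rule state_even[OF st])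
  have up: ?thesis if "up t w (a, g, z) w'" for w'
    using ups_snoc[OF assms(1) that] up_awalk[OF that evw t_Mseq] assms(2)
    by (auto simp: awalk_Cons_iff awalk_Nil_iff intro: proportional_refl)
  \<comment> \<open>By \<open>ups_unique\<close> the path to \<open>w\<close> may be replaced by one
    that ends in any chosen move into \<open>w\<close>.\<close>
  have down: "\<exists>q1. ups t base q1 w1 \<and> awalk (map lab w1 @- t) [e] (map lab w @- t) \<and>
      proportional (X @- t, q @ [(a, g, z)]) (X @- t, q1 @ [e, (a, g, z)])"
    if "up t w1 e w" for w1 e
  proof -
    have "state w1" using that st by (simp add: up_state)
    then obtain q1 where q1: "ups t base q1 w1" using state_reachable by blast
    have e: "awalk (map lab w1 @- t) [e] (map lab w @- t)"
      using that \<open>state w1\<close> by (auto intro: up_awalk t_Mseq state_even)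
    have "proportional (X @- t, q @ [(a, g, z)]) (X @- t, (q1 @ [e]) @ [(a, g, z)])"
      using ups_unique[OF assms(1) ups_snoc[OF q1 that]] walks[OF assms(1)] walks[OF ups_snoc[OF q1 that]] assms(2)
      by (rule proportional_append)
    with q1 e show ?thesis by auto
  qed
  have zero: "vanishes (X @- t, q @ [(a, g, z)])"
    if "up t w1 e w" "vanishes (map lab w1 @- t, [e, (a, g, z)])" for w1 e
  proof -
    from down[OF that(1)] obtain q1 where "ups t base q1 w1"
      "proportional (X @- t, q @ [(a, g, z)]) (X @- t, q1 @ [e, (a, g, z)])" by blast
    with vanishes_prepend[OF that(2) walks] show ?thesis by (blast intro: vanishes_proportional)
  qed
  show ?thesis
  proof (cases g)
    case (Dot i)
    with len obtain l b where P: "P = [(l, b)]" by (auto simp: length_Suc_0)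
    show ?thesis
    proof (cases b)
      case False
      with P Dot labs w have "up t w (a, g, z) (u @ (l, True) # v)"
        using up_dot[of t u l v] by auto
      then show ?thesis by (rule up)
    next
      case True
      \<comment> \<open>The dotted strand has label \<open>i + 2\<close>, so the dot that it already
        carries is \<open>Dot (i + 2)\<close>.\<close>
      have "arrows R_quiver [(a, Dot (i + 2), z), (a, Dot i, z)] \<in> J"
        using R_rel_subset R_rel.double_dot[OF arc(1) arc(3), of i] arc(2) Dot by auto
      then have "vanishes (map lab (u @ (l, False) # v) @- t, [(a, Dot (i + 2), z), (a, g, z)])"
        using labs P True Dot by (auto simp: vanishes_def arrows_def)
      moreover have "up t (u @ (l, False) # v) (a, Dot (i + 2), z) w"
        using up_dot[of t u l v] labs P True Dot w by (auto simp: add.commute)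
      ultimately show ?thesis using zero by blast
    qed
  next
    case (Cr i j)
    with len obtain p p' where P: "P = [p, p']" by (auto simp: length_Suc_Suc_0)
    have ij: "lab p = j" "lab p' = i" "even i" "even j" using labs(2) P Cr arc(2) by auto
    have "fst p \<noteq> fst p'" using state_distinct[OF st] w P by auto
    then consider "fst p < fst p'" | "fst p' < fst p" by linarith
    then show ?thesis
    proof cases
      case 1
      with P Cr labs w have "up t w (a, g, z) (u @ p' # p # v)"
        using up_cross[of p p' t u v] by auto
      then show ?thesis by (rule up)
    next
      case 2
      have u1: "up t (u @ p' # p # v) (a, Cr j i, z) w"
        using up_cross[of p' p t u v] 2 labs P Cr w by auto
      show ?thesis
      proof (cases "i = j")
        case True
        have "arrows R_quiver [(a, Cr j i, z), (a, Cr i j, z)] \<in> J"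
          using R_rel_subset R_rel.double_crossing[OF arc(1) arc(3), of i j] ij True by auto
        then have "vanishes (map lab (u @ p' # p # v) @- t, [(a, Cr j i, z), (a, g, z)])"
          using labs P True Cr by (auto simp: vanishes_def arrows_def)
        then show ?thesis using zero u1 by blast
      next
        case False
        from down[OF u1] obtain q1 where q1: "ups t base q1 (u @ p' # p # v)"
          "proportional (X @- t, q @ [(a, g, z)]) (X @- t, q1 @ [(a, Cr j i, z), (a, g, z)])" by blast
        note q1(2)
        also have "proportional (X @- t, q1 @ [(a, Cr j i, z), (a, g, z)]) (X @- t, q1 @ [])"
          using proportional_prepend[OF crossing_inverse[OF arc(1) arc(3) ij(3,4) False], of "X @- t" q1]
            walks[OF q1(1)] labs P Cr by simp
        finally have "proportional (X @- t, q @ [(a, g, z)]) (X @- t, q1)" by simp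
        moreover have "y = map lab (u @ p' # p # v) @- t"
          using y labs P Cr ij by simp
        ultimately show ?thesis using q1(1) by blast
      qed
    qed
  qed
qed

lemma walk_normal_form:
  assumes "awalk (X @- t) p y" "\<forall>(a, g, z)\<in>set p. length a + length (bot_word g) \<le> length X"
  shows "vanishes (X @- t, p) \<or>
    (\<exists>w q. ups t base q w \<and> y = map lab w @- t \<and> proportional (X @- t, p) (X @- t, q))"
  using assms
proof (induction p arbitrary: y rule: rev_induct)
  case Nil
  then have "y = map lab base @- t" by (simp add: awalk_Nil_iff)
  then show ?case using ups_Nil proportional_refl by blast
next
  case (snoc e p)
  have ev: "even_strands base" by (rule state_even[OF state_base])
  note walks = ups_awalk[OF _ ev t_Mseq, unfolded map_lab_base]
  from snoc.prems obtain y' where y': "awalk (X @- t) p y'" "awalk y' [e] y"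
    by (auto simp: awalk_append_iff)
  with snoc consider "vanishes (X @- t, p)" | w q where "ups t base q w" "y' = map lab w @- t"
      "proportional (X @- t, p) (X @- t, q)" by force
  then show ?case
  proof cases
    case 1
    with y' show ?thesis by (auto intro: vanishes_append)
  next
    case 2
    have "proportional (X @- t, p @ [e]) (X @- t, q @ [e])"
      using 2(3) y'(1) walks[OF 2(1)] y'(2) unfolding 2(2) by (rule proportional_append)
    moreover have "vanishes (X @- t, q @ [e]) \<or>
        (\<exists>w' q'. ups t base q' w' \<and> y = map lab w' @- t \<and> proportional (X @- t, q @ [e]) (X @- t, q'))"
      using ups_step[OF 2(1), of "fst e" "fst (snd e)" "snd (snd e)" y] y'(2) 2(2) snoc.prems(2) by auto
    ultimately show ?thesis using vanishes_proportional proportional_trans by blast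
  qed
qed

end

section \<open>Partitions and increasing sequences\<close>

declare snth.simps(2) [simp del]

text \<open>The column lengths of the diagram: the parts of the dual partition, extended by zero, so
  that one formula covers both the list and the tail of \<open>xseq\<close>.\<close>

definition col :: "nat list \<Rightarrow> nat \<Rightarrow> nat" where
  "col l k = length (filter (\<lambda>p. k < p) l)"

lemma col_simps [simp]: "col [] k = 0" "col (a # l) k = of_bool (k < a) + col l k"
  by (auto simp: col_def)

lemma Par_Cons [simp]: "a # l \<in> Par \<longleftrightarrow> 0 < a \<and> (\<forall>p\<in>set l. p \<le> a) \<and> l \<in> Par"
  by (auto simp: Par_def)

lemma col_eq_0: "\<forall>p\<in>set l. p \<le> k \<Longrightarrow> col l k = 0"
  by (auto simp: col_def filter_empty_conv)

lemma col_antimono: "j \<le> k \<Longrightarrow> col l k \<le> col l j"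
  by (induction l) auto

text \<open>The parts decrease weakly, so those exceeding \<open>j\<close> form an initial segment
  of the list.\<close>

lemma less_col_iff: "l \<in> Par \<Longrightarrow> i < col l j \<longleftrightarrow> i < length l \<and> j < l ! i"
proof (induction l arbitrary: i)
  case (Cons a l)
  then show ?case
  proof (cases "j < a")
    case False
    with Cons.prems have "col l j = 0" by (intro col_eq_0) auto
    moreover have "\<not> j < (a # l) ! i" if "i < length (a # l)"
    proof -
      have "(a # l) ! i \<in> set (a # l)" using that by (rule nth_mem)
      with Cons.prems False show ?thesis by auto
    qed
    ultimately show ?thesis using False by auto
  qed (cases i; auto)
qed auto

lemma cells_col: "l \<in> Par \<Longrightarrow> cells l = {(i, j). i < col l j}"
  by (auto simp: cells_def less_col_iff)

lemma col_0: "l \<in> Par \<Longrightarrow> col l 0 = length l"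
  by (induction l) auto

lemma col_inj:
  assumes "l \<in> Par" "m \<in> Par" "\<And>k. col l k = col m k"
  shows "l = m"
proof (rule nth_equalityI)
  show len: "length l = length m" using assms col_0 by metis
  show "l ! i = m ! i" if "i < length l" for i
  proof -
    have "j < l ! i \<longleftrightarrow> j < m ! i" for j
      using less_col_iff[OF assms(1), of i j] less_col_iff[OF assms(2), of i j] that len assms(3) by auto
    then show ?thesis by (metis less_irrefl not_less_iff_gr_or_eq)
  qed
qed

text \<open>Transpose back: the part with index \<open>i\<close> is the number of columns longer
  than \<open>i\<close>. These form an initial segment of the columns because \<open>c\<close>
  decreases weakly.\<close>

lemma col_surj:
  assumes anti: "\<And>j k. j \<le> k \<Longrightarrow> c k \<le> c j" and zero: "\<And>k. k \<ge> N \<Longrightarrow> c k = (0::nat)"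
  obtains l where "l \<in> Par" "\<And>k. col l k = c k"
proof
  let ?r = "\<lambda>i. card {j. i < c j}"
  let ?l = "map ?r [0..<c 0]"
  have fin: "finite {j. i < c j}" for i
    by (rule finite_subset[of _ "{..<N}"]) (use zero in \<open>force simp: not_le[symmetric]\<close>)+
  have r: "k < ?r i \<longleftrightarrow> i < c k" for i k
  proof
    assume "i < c k"
    then have "{..k} \<subseteq> {j. i < c j}" using anti by (auto intro: less_le_trans)
    from card_mono[OF fin this] show "k < ?r i" by simp
  next
    show "i < c k" if "k < ?r i"
    proof (rule ccontr)
      assume "\<not> i < c k"
      then have "{j. i < c j} \<subseteq> {..<k}"
        using anti by (auto simp: not_less) (meson leI le_less_trans not_le order_trans)
      from card_mono[OF _ this] that show False by simp
    qed
  qed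
  have "?r i' \<le> ?r i" if "i \<le> i'" for i i'
    using that by (intro card_mono fin) auto
  moreover have "0 < ?r i" if "i < c 0" for i using that r by blast
  ultimately show "?l \<in> Par"
    unfolding Par_def by (auto simp: sorted_wrt_map sorted_wrt_iff_nth_less simp del: card_eq_0_iff)
      (metis less_irrefl)
  show "col ?l k = c k" for k
  proof -
    have "filter (\<lambda>i. i < c k) [0..<c 0] = [0..<c k]"
    proof -
      have "[0..<c 0] = [0..<c k] @ [c k..<c 0]"
        using anti[of 0 k] by (metis le0 upt_add_eq_append le_add_diff_inverse)
      then show ?thesis by (simp add: filter_empty_conv)
    qed
    then show ?thesis by (simp add: col_def filter_map comp_def r)
  qed
qed

text \<open>Boxes counted by columns.\<close>

lemma sum_list_col: "\<forall>p\<in>set l. p \<le> N \<Longrightarrow> sum_list l = (\<Sum>j<N. col l j)"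
proof (induction l)
  case (Cons a l)
  have "(\<Sum>j<N. of_bool (j < a)) = a" if "a \<le> N"
  proof -
    have "(\<Sum>j<N. of_bool (j < a) :: nat) = card ({..<N} \<inter> {j. j < a})" by (simp add: of_bool_def sum.If_cases)
    also have "{..<N} \<inter> {j. j < a} = {..<a}" using that by auto
    finally show ?thesis by simp
  qed
  with Cons show ?case by (simp add: sum.distrib)
qed simp

lemma list_bound: obtains N where "\<forall>p\<in>set (l :: nat list). p \<le> N"
  using that[of "sum_list l"] member_le_sum_list by blast

lemma cells_subset_iff:
  assumes "l \<in> Par" "m \<in> Par"
  shows "cells l \<subseteq> cells m \<longleftrightarrow> (\<forall>j. col l j \<le> col m j)"
proof
  assume "cells l \<subseteq> cells m"
  then have "i < col m j" if "i < col l j" for i j using that assms by (auto simp: cells_col)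
  then show "\<forall>j. col l j \<le> col m j" using not_le by blast
qed (use assms in \<open>auto simp: cells_col intro: less_le_trans\<close>)

text \<open>The column lengths grow by natural numbers with sum 1, so exactly one of them grows, by
  1.\<close>

lemma par_arrow_iff_col:
  "par_arrow l m \<longleftrightarrow> l \<in> Par \<and> m \<in> Par \<and> (\<exists>k. \<forall>j. col m j = col l j + of_bool (j = k))"
proof -
  obtain N where N: "\<forall>p\<in>set (l @ m). p \<le> N" by (rule list_bound)
  have sums: "sum_list l = (\<Sum>j<N. col l j)" "sum_list m = (\<Sum>j<N. col m j)"
    using N by (auto intro!: sum_list_col)
  have zero: "col l j = 0" "col m j = 0" if "j \<ge> N" for j
    using N that by (force intro!: col_eq_0)+
  show ?thesis
  proof (cases "l \<in> Par \<and> m \<in> Par")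
    case True
    have "sum_list m = sum_list l + 1 \<longleftrightarrow> (\<exists>k. \<forall>j. col m j = col l j + of_bool (j = k))"
      if le: "\<forall>j. col l j \<le> col m j"
    proof -
      have "(\<Sum>j<N. col m j) = (\<Sum>j<N. col l j) + (\<Sum>j<N. col m j - col l j)"
        using le by (simp flip: sum.distrib)
      then have "sum_list m = sum_list l + 1 \<longleftrightarrow> (\<Sum>j<N. col m j - col l j) = 1"
        by (simp add: sums)
      also have "\<dots> \<longleftrightarrow> (\<exists>k\<in>{..<N}. col m k - col l k = 1 \<and> (\<forall>j\<in>{..<N}. k \<noteq> j \<longrightarrow> col m j - col l j = 0))"
        by (subst sum_eq_1_iff) auto
      also have "\<dots> \<longleftrightarrow> (\<exists>k. \<forall>j. col m j = col l j + of_bool (j = k))" (is "?L \<longleftrightarrow> ?R")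
      proof
        assume ?L
        then obtain k where k: "k < N" "col m k - col l k = 1"
          "\<And>j. j < N \<Longrightarrow> k \<noteq> j \<Longrightarrow> col m j - col l j = 0" by auto
        have "col m j = col l j + of_bool (j = k)" for j
        proof (cases "j < N")
          case True
          with k(2) k(3)[OF True] le[rule_format, of j] show ?thesis by (cases "j = k") auto
        qed (use zero k(1) in auto)
        then show ?R by blast
      next
        assume ?R
        then obtain k where k: "\<And>j. col m j = col l j + of_bool (j = k)" by blast
        then have "k < N" using zero[of k] by (cases "k < N") auto
        with k show ?L by (intro bexI[of _ k]) auto
      qed
      finally show ?thesis .
    qed
    moreover have "\<forall>j. col l j \<le> col m j" if "\<exists>k. \<forall>j. col m j = col l j + of_bool (j = k)"
      using that by force
    ultimately show ?thesis
      unfolding par_arrow_def using True cells_subset_iff[of l m] by blast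
  qed (auto simp: par_arrow_def)
qed

section \<open>The sequence of a partition\<close>

lemma xseq_nth:
  assumes "l \<in> Par"
  shows "xseq l !! k = 2 * (int k + 1) - 2 * int (col l k)"
proof (cases "k < nth_default 0 l 0")
  case False
  have "\<forall>p\<in>set l. p \<le> k"
    using assms False by (cases l) (auto simp: nth_default_Cons)
  then have "col l k = 0" by (rule col_eq_0)
  with False show ?thesis by (simp add: xseq_def dual_def)
qed (simp add: xseq_def dual_def col_def)

lemma IM_iff: "x \<in> IM 0 \<longleftrightarrow> (\<forall>n. even (x !! n)) \<and> (\<exists>N. \<forall>n\<ge>N. x !! n = 2 * (int n + 1)) \<and>
    (\<forall>n. x !! n < x !! Suc n)"
proof -
  have "\<forall>n\<ge>N. x !! Suc n = x !! n + 2" if "\<forall>n\<ge>N. x !! n = 2 * (int n + 1)" for N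
    using that by (auto simp: le_SucI)
  then show ?thesis
    unfolding IM_def Mseq_at_def Mseq_def strict_mono_Suc_iff mem_Collect_eq mult_zero_right add_0_right
    by blast
qed

lemma IM_Mseq: "x \<in> IM 0 \<Longrightarrow> x \<in> Mseq"
  by (simp add: IM_def Mseq_at_def)

lemma IM_step:
  assumes "x \<in> IM 0"
  shows "x !! n + 2 \<le> x !! Suc n"
proof -
  have "even (x !! n)" "even (x !! Suc n)" "x !! n < x !! Suc n"
    using assms by (auto simp: IM_iff)
  then show ?thesis by presburger
qed

lemma xseq_IM:
  assumes "l \<in> Par"
  shows "xseq l \<in> IM 0"
proof -
  obtain N where N: "\<forall>p\<in>set l. p \<le> N" by (rule list_bound)
  have "xseq l !! n = 2 * (int n + 1)" if "n \<ge> N" for n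
    using N that col_eq_0[of l n] by (force simp: xseq_nth[OF assms])
  moreover have "xseq l !! n < xseq l !! Suc n" for n
  proof -
    have "int (col l (Suc n)) \<le> int (col l n)" by (simp add: col_antimono)
    then show ?thesis unfolding xseq_nth[OF assms] by simp
  qed
  ultimately show ?thesis by (auto simp: IM_iff xseq_nth[OF assms])
qed

lemma stream_eqI: "(\<And>n. x !! n = y !! n) \<Longrightarrow> x = y"
  using smap_alt[of id x y] by (simp add: stream.map_id)

lemma xseq_eq_iff: "l \<in> Par \<Longrightarrow> m \<in> Par \<Longrightarrow> xseq l = xseq m \<longleftrightarrow> l = m"
proof
  assume "l \<in> Par" "m \<in> Par" "xseq l = xseq m"
  then have "xseq l !! k = xseq m !! k" for k by simp
  then show "l = m" using \<open>l \<in> Par\<close> \<open>m \<in> Par\<close> by (intro col_inj) (auto simp: xseq_nth)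
qed simp

text \<open>Consecutive entries differ by at least 2, so \<open>x !! k - 2 * (int k + 1)\<close> is
  weakly increasing in \<open>k\<close>. It is eventually 0, hence never positive, and half of its
  negative is a sequence of column lengths.\<close>

lemma IM_xseq:
  assumes "x \<in> IM 0"
  obtains l where "l \<in> Par" "xseq l = x"
proof -
  obtain N where N: "\<And>n. n \<ge> N \<Longrightarrow> x !! n = 2 * (int n + 1)" using assms by (auto simp: IM_iff)
  define c where "c k = nat ((2 * (int k + 1) - x !! k) div 2)" for k
  have step: "x !! Suc k - 2 * (int (Suc k) + 1) \<ge> x !! k - 2 * (int k + 1)" for k
    using IM_step[OF assms, of k] by simp
  then have mono: "x !! k - 2 * (int k + 1) \<ge> x !! j - 2 * (int j + 1)" if "j \<le> k" for j k
    using lift_Suc_mono_le[of "\<lambda>k. x !! k - 2 * (int k + 1)"] that by blast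
  have nonpos: "x !! k - 2 * (int k + 1) \<le> 0" for k
    using mono[of k "max k N"] N[of "max k N"] by simp
  have c: "x !! k = 2 * (int k + 1) - 2 * int (c k)" for k
  proof -
    have "even (2 * (int k + 1) - x !! k)" using assms by (simp add: IM_iff)
    then show ?thesis using nonpos[of k] by (auto simp: c_def)
  qed
  have "c k \<le> c j" if "j \<le> k" for j k using mono[OF that] c[of j] c[of k] by linarith
  moreover have "c k = 0" if "k \<ge> N" for k using N[OF that] c[of k] by linarith
  ultimately obtain l where "l \<in> Par" "\<And>k. col l k = c k" using col_surj[of c N] by blast
  then have "l \<in> Par" "xseq l = x" by (auto intro!: stream_eqI simp: xseq_nth c)
  with that show ?thesis .
qed

lemma bij_betw_xseq: "bij_betw xseq Par (IM 0)"
  unfolding bij_betw_def inj_on_def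
  using xseq_eq_iff xseq_IM IM_xseq by (auto simp: image_iff) metis

lemma par_arrow_iff:
  "par_arrow l m \<longleftrightarrow> l \<in> Par \<and> m \<in> Par \<and>
    (\<exists>k. \<forall>j. xseq m !! j = xseq l !! j - (if j = k then 2 else 0))"
proof -
  have "col m j = col l j + of_bool (j = k) \<longleftrightarrow> xseq m !! j = xseq l !! j - (if j = k then 2 else 0)"
    if "l \<in> Par \<and> m \<in> Par" for j k
    using that by (auto simp: xseq_nth)
  then show ?thesis unfolding par_arrow_iff_col by (cases "l \<in> Par \<and> m \<in> Par") (simp only:, blast)
qed

text \<open>The indices \<open>k\<close> and \<open>k'\<close> are the columns of the two added
  boxes, and two boxes added to the same column are stacked.\<close>

lemma vertical_domino_iff:
  assumes "l \<in> Par" "h \<in> Par" "\<And>j. xseq m !! j = xseq l !! j - (if j = k then 2 else 0)"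
    "\<And>j. xseq h !! j = xseq m !! j - (if j = k' then 2 else 0)"
  shows "vertical_domino (cells h - cells l) \<longleftrightarrow> k = k'"
proof -
  have col: "col h j = col l j + of_bool (j = k) + of_bool (j = k')" for j
    using assms(3,4)[of j] assms(1,2) by (auto simp: xseq_nth split: if_splits)
  have mem: "(i, j) \<in> cells h - cells l \<longleftrightarrow> col l j \<le> i \<and> i < col h j" for i j
    using assms by (auto simp: cells_col)
  show ?thesis
  proof
    assume "vertical_domino (cells h - cells l)"
    then obtain i j where "cells h - cells l = {(i, j), (Suc i, j)}" by (auto simp: vertical_domino_def)
    then have "col l j \<le> i" "Suc i < col h j" using mem by blast+
    with col[of j] show "k = k'" by (cases "j = k"; cases "j = k'") auto
  next
    assume "k = k'"
    then have "col h j = col l j + (if j = k then 2 else 0)" for j using col by simp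
    then have "cells h - cells l = {(col l k, k), (Suc (col l k), k)}"
      using assms(1,2) by (auto simp: cells_col split: if_splits)
    then show "vertical_domino (cells h - cells l)" by (auto simp: vertical_domino_def)
  qed
qed

lemma par_arrow_sum_list: "par_arrow l m \<Longrightarrow> sum_list m = Suc (sum_list l)"
  by (simp add: par_arrow_def)

lemma par_arrow_below: "par_arrow l m \<Longrightarrow> xseq m !! j \<le> xseq l !! j"
  by (auto simp: par_arrow_iff)

text \<open>Raising an entry removes the lowest box of column \<open>k\<close>; a gap of more than 2
  to the next entry keeps the sequence strictly increasing.\<close>

lemma raise_Par:
  assumes "m \<in> Par" "xseq m !! k + 2 < xseq m !! Suc k"
  obtains n where "par_arrow n m" "\<And>j. xseq n !! j = xseq m !! j + (if j = k then 2 else 0)"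
proof -
  let ?y = "xseq m"
  let ?x = "smap (\<lambda>j. ?y !! j + (if j = k then 2 else 0)) (fromN 0)"
  have y: "?y \<in> IM 0" using assms(1) by (rule xseq_IM)
  have "?x \<in> IM 0"
    unfolding IM_iff
  proof (intro conjI allI)
    show "even (?x !! n)" for n using y by (simp add: IM_iff)
    obtain N where "\<And>n. n \<ge> N \<Longrightarrow> ?y !! n = 2 * (int n + 1)" using y by (auto simp: IM_iff)
    then show "\<exists>N. \<forall>n\<ge>N. ?x !! n = 2 * (int n + 1)" by (intro exI[of _ "max N (Suc k)"]) auto
    fix j
    have "?y !! j < ?y !! Suc j" using y by (simp add: IM_iff)
    then show "?x !! j < ?x !! Suc j" using assms(2) by auto
  qed
  then obtain n where "n \<in> Par" "xseq n = ?x" by (rule IM_xseq)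
  then show thesis using assms(1) by (intro that[of n]) (auto simp: par_arrow_iff)
qed

section \<open>Paths in Young's lattice\<close>

lemma Gamma_simps [simp]:
  "verts Gamma = Par" "(l, m) \<in> arcs Gamma \<longleftrightarrow> par_arrow l m"
  "tail Gamma = fst" "head Gamma = snd"
  by (auto simp: Gamma_def)

lemma par_arrow_Par: "par_arrow l m \<Longrightarrow> l \<in> Par \<and> m \<in> Par"
  by (simp add: par_arrow_def)

interpretation F: path_quiver Gamma
  by unfold_locales (auto simp: par_arrow_Par)

lemma F_rel_car: "F_rel \<subseteq> car (path_algebra Gamma)"
proof
  fix f :: "(nat list, nat list \<times> nat list) path \<Rightarrow>\<^sub>0 'k::field"
  assume "f \<in> F_rel"
  then show "f \<in> car (path_algebra Gamma)"
  proof (induction rule: F_rel.induct)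
    case (square l m h n)
    then show ?case unfolding path_algebra_simps mem_Collect_eq
      by (intro keys_diff_subset)
        (auto simp: paths_def F.awalk_Cons_iff F.awalk_Nil_iff arrows_def par_arrow_Par)
  qed (auto simp: paths_def F.awalk_Cons_iff F.awalk_Nil_iff arrows_def par_arrow_Par)
qed

interpretation F: path_quotient Gamma F_ideal
  unfolding F_ideal_def by unfold_locales (rule F.ideal_ideal_gen[OF F_rel_car])

lemma walk_below: "F.awalk l p m \<Longrightarrow> xseq m !! j \<le> xseq l !! j"
proof (induction p arbitrary: l)
  case (Cons e p)
  then have "xseq m !! j \<le> xseq (snd e) !! j" "par_arrow l (snd e)"
    by (auto simp: F.awalk_Cons_iff) (metis Gamma_simps(2) prod.collapse)
  with par_arrow_below[of l "snd e" j] show ?case by simp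
qed (simp add: F.awalk_Nil_iff)

lemma walk_sum_list: "F.awalk l p m \<Longrightarrow> sum_list m = sum_list l + length p"
proof (induction p arbitrary: l)
  case (Cons e p)
  then have "sum_list m = sum_list (snd e) + length p" "par_arrow l (snd e)"
    by (auto simp: F.awalk_Cons_iff) (metis Gamma_simps(2) prod.collapse)
  with par_arrow_sum_list[of l "snd e"] show ?case by simp
qed (simp add: F.awalk_Nil_iff)

lemma walk_Par: "F.awalk l p m \<Longrightarrow> l \<in> Par \<and> m \<in> Par"
  using F.awalk_hd_in_verts F.awalk_last_in_verts by fastforce

text \<open>The two sequences agree eventually, so there is a last index at which they
  differ.\<close>

lemma last_lowered:
  assumes "l \<in> Par" "m \<in> Par" "m \<noteq> l" "\<And>j. xseq m !! j \<le> xseq l !! j"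
  obtains k where "xseq m !! k < xseq l !! k" "xseq m !! Suc k = xseq l !! Suc k"
proof -
  obtain N N' where N: "\<And>n. n \<ge> N \<Longrightarrow> xseq l !! n = 2 * (int n + 1)"
    "\<And>n. n \<ge> N' \<Longrightarrow> xseq m !! n = 2 * (int n + 1)"
    using assms(1,2)[THEN xseq_IM] by (auto simp: IM_iff)
  let ?K = "{k. xseq m !! k \<noteq> xseq l !! k}"
  have "xseq m !! k = xseq l !! k" if "k \<ge> max N N'" for k using N that by simp
  then have "finite ?K" by (intro finite_subset[of ?K "{..<max N N'}"]) (auto simp: not_le[symmetric])
  moreover have "?K \<noteq> {}"
    using assms xseq_eq_iff[of m l] stream_eqI[of "xseq m" "xseq l"] by auto
  ultimately have max: "Max ?K \<in> ?K" "\<And>k. k \<in> ?K \<Longrightarrow> k \<le> Max ?K"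
    by (rule Max_in, intro Max_ge)
  have "Suc (Max ?K) \<notin> ?K" using max(2)[of "Suc (Max ?K)"] by auto
  with max(1) assms(4)[of "Max ?K"] show thesis by (intro that[of "Max ?K"]) auto
qed

text \<open>Behind the last lowered entry comes one that \<open>m\<close> shares with
  \<open>l\<close>. It exceeds \<open>xseq l !! k\<close>, which by parity is at least
  \<open>xseq m !! k + 2\<close>, so there is room to raise without passing
  \<open>l\<close>.\<close>

lemma raise_last:
  assumes "l \<in> Par" "m \<in> Par" "m \<noteq> l" "\<And>j. xseq m !! j \<le> xseq l !! j"
  obtains n k where "par_arrow n m" "\<And>j. xseq n !! j = xseq m !! j + (if j = k then 2 else 0)"
    "\<And>j. xseq n !! j \<le> xseq l !! j" "xseq m !! Suc k = xseq l !! Suc k"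
proof -
  obtain k where k: "xseq m !! k < xseq l !! k" "xseq m !! Suc k = xseq l !! Suc k"
    using last_lowered[OF assms] by metis
  have ev: "even (xseq m !! k)" "even (xseq l !! k)" using assms(1,2)[THEN xseq_IM] by (auto simp: IM_iff)
  then have le: "xseq m !! k + 2 \<le> xseq l !! k" using k(1) by presburger
  have "xseq l !! k < xseq l !! Suc k" using assms(1)[THEN xseq_IM] by (simp add: IM_iff)
  with k le have "xseq m !! k + 2 < xseq m !! Suc k" by simp
  from raise_Par[OF assms(2) this] obtain n where
    n: "par_arrow n m" "\<And>j. xseq n !! j = xseq m !! j + (if j = k then 2 else 0)" by metis
  have "xseq n !! j \<le> xseq l !! j" for j using n(2)[of j] le assms(4)[of j] by auto
  with n k(2) that show thesis by blast
qed

lemma walk_snoc: "F.awalk l p n \<Longrightarrow> par_arrow n m \<Longrightarrow> F.awalk l (p @ [(n, m)]) m"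
  by (rule F.awalk_appendI) (auto simp: F.awalk_Cons_iff F.awalk_Nil_iff par_arrow_Par)

lemma walk_snocE:
  assumes "F.awalk l (p @ [e]) m"
  obtains n where "e = (n, m)" "F.awalk l p n" "par_arrow n m"
  using assms by (cases e) (auto simp: F.awalk_append_iff F.awalk_Cons_iff F.awalk_Nil_iff)

lemma walk_exists:
  assumes "l \<in> Par" "m \<in> Par" "\<And>j. xseq m !! j \<le> xseq l !! j"
  shows "\<exists>p. F.awalk l p m"
  using assms(2,3)
proof (induction "sum_list m" arbitrary: m rule: less_induct)
  case less
  show ?case
  proof (cases "m = l")
    case True
    with assms show ?thesis by (auto intro!: exI[of _ "[]"] simp: F.awalk_Nil_iff)
  next
    case False
    from raise_last[OF assms(1) less.prems(1) False less.prems(2)] obtain n where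
      n: "par_arrow n m" "\<And>j. xseq n !! j \<le> xseq l !! j" by metis
    with less.hyps[of n] obtain p where "F.awalk l p n"
      using par_arrow_sum_list par_arrow_Par by fastforce
    with n(1) walk_snoc show ?thesis by blast
  qed
qed

text \<open>The partition \<open>n\<close> is the intersection of the shapes \<open>m1\<close> and
  \<open>m2\<close>: the sequence of \<open>m\<close> raised at both of the entries
  \<open>k1\<close> and \<open>k2\<close>.\<close>

lemma common_raise:
  assumes "par_arrow m1 m" "par_arrow m2 m" "m1 \<noteq> m2"
    "\<And>j. xseq m1 !! j \<le> xseq l !! j" "\<And>j. xseq m2 !! j \<le> xseq l !! j"
  obtains n where "par_arrow n m1" "par_arrow n m2" "\<And>j. xseq n !! j \<le> xseq l !! j"
proof -
  obtain k1 where 1: "\<And>j. xseq m !! j = xseq m1 !! j - (if j = k1 then 2 else 0)"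
    using assms(1) unfolding par_arrow_iff by blast
  obtain k2 where 2: "\<And>j. xseq m !! j = xseq m2 !! j - (if j = k2 then 2 else 0)"
    using assms(2) unfolding par_arrow_iff by blast
  have P: "m1 \<in> Par" "m2 \<in> Par" using assms(1,2) par_arrow_Par by auto
  have neq: "k1 \<noteq> k2"
  proof
    assume "k1 = k2"
    then have "xseq m1 = xseq m2" using 1 2 by (intro stream_eqI) (metis add_diff_cancel_right' diff_add_cancel)
    with P assms(3) show False by (simp add: xseq_eq_iff)
  qed
  \<comment> \<open>The left side is \<open>xseq m2 !! k2\<close>, and
    \<open>xseq m2 !! Suc k2 \<le> xseq m1 !! Suc k2\<close>, since \<open>m2\<close> differs from
    \<open>m\<close> only at \<open>k2\<close>.\<close>
  have "xseq m1 !! k2 + 2 < xseq m1 !! Suc k2"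
  proof -
    have "xseq m2 !! k2 < xseq m2 !! Suc k2" using P(2)[THEN xseq_IM] by (simp add: IM_iff)
    with 1[of k2] 2[of k2] 1[of "Suc k2"] 2[of "Suc k2"] neq show ?thesis by (auto split: if_splits)
  qed
  from raise_Par[OF P(1) this] obtain n where
    n: "par_arrow n m1" "\<And>j. xseq n !! j = xseq m1 !! j + (if j = k2 then 2 else 0)" by metis
  have n2: "xseq m2 !! j = xseq n !! j - (if j = k1 then 2 else 0)" for j
    using 1[of j] 2[of j] n(2)[of j] by (auto split: if_splits)
  then have "par_arrow n m2"
    unfolding par_arrow_iff[of n m2] using par_arrow_Par[OF n(1)] P(2) by blast
  moreover have "xseq n !! j \<le> xseq l !! j" for j
    using n(2)[of j] n2[of j] assms(4)[of j] assms(5)[of j] neq by (auto split: if_splits)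
  ultimately show thesis using n(1) that by blast
qed

context path_quotient
begin

lemma cls_append:
  assumes "cls (Poly_Mapping.single (u, p) 1) = cls (Poly_Mapping.single (u, p') 1)"
    "awalk u p v" "awalk u p' v" "awalk v q w"
  shows "cls (Poly_Mapping.single (u, p @ q) 1) = cls (Poly_Mapping.single (u, p' @ q) 1)"
proof -
  have "path_mult G (Poly_Mapping.single (u, p) 1 - Poly_Mapping.single (u, p') 1)
      (Poly_Mapping.single (v, q) 1) \<in> I"
    using assms by (intro ideal_mult_right) (auto simp: paths_def cls_eq_iff)
  then show ?thesis using assms
    by (auto simp: path_mult_diff_left path_mult_single cls_eq_iff)
qed

lemma cls_prepend:
  assumes "cls (Poly_Mapping.single (v, p) 1) = cls (Poly_Mapping.single (v, p') 1)" "awalk u r v"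
  shows "cls (Poly_Mapping.single (u, r @ p) 1) = cls (Poly_Mapping.single (u, r @ p') 1)"
proof -
  have "path_mult G (Poly_Mapping.single (u, r) 1)
      (Poly_Mapping.single (v, p) 1 - Poly_Mapping.single (v, p') 1) \<in> I"
    using assms by (intro ideal_mult_left) (auto simp: paths_def cls_eq_iff)
  then show ?thesis using assms
    by (auto simp: path_mult_diff_right path_mult_single cls_eq_iff)
qed

end

section \<open>Walks modulo the relations of F\<close>

locale young_quotient = path_quotient Gamma J
  for J :: "((nat list, nat list \<times> nat list) path \<Rightarrow>\<^sub>0 'k::field) set" +
  assumes F_rel_subset: "F_rel \<subseteq> J"
begin

text \<open>If the last arrows differ, they are completed downwards to a square with corner
  \<open>n\<close>. By induction the two walks may be rerouted through \<open>n\<close>, and the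
  square relation exchanges their last two arrows.\<close>

lemma walk_class_unique:
  assumes "F.awalk l p m" "F.awalk l q m"
  shows "Poly_Mapping.single (l, p) 1 - Poly_Mapping.single (l, q) 1 \<in> J"
proof -
  have "cls (Poly_Mapping.single (l, p) 1) = cls (Poly_Mapping.single (l, q) 1)"
    using assms
  proof (induction "length p" arbitrary: p q m)
    case 0
    then have "q = []" using walk_sum_list[of l p m] walk_sum_list[of l q m] by auto
    with 0 show ?case by simp
  next
    case (Suc N)
    have len: "length q = length p"
      using walk_sum_list[OF Suc.prems(1)] walk_sum_list[OF Suc.prems(2)] by simp
    with Suc.hyps(2) obtain p1 e1 q1 e2 where "p = p1 @ [e1]" "q = q1 @ [e2]"
      by (metis length_Suc_conv_rev)
    with Suc.prems obtain m1 m2 where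
      p: "p = p1 @ [(m1, m)]" "F.awalk l p1 m1" "par_arrow m1 m" and
      q: "q = q1 @ [(m2, m)]" "F.awalk l q1 m2" "par_arrow m2 m"
      by (metis walk_snocE)
    have last: "F.awalk n [(n, m)] m" if "par_arrow n m" for n m
      using that by (simp add: F.awalk_Cons_iff F.awalk_Nil_iff par_arrow_Par)
    show ?case
    proof (cases "m1 = m2")
      case True
      have "cls (Poly_Mapping.single (l, p1) 1) = cls (Poly_Mapping.single (l, q1) 1)"
        using Suc.hyps(1)[of p1 m1 q1] Suc.hyps(2) p q True by simp
      from cls_append[OF this p(2) q(2)[folded True] last[OF p(3)]] show ?thesis
        using p(1) q(1) True by simp
    next
      case False
      from common_raise[OF p(3) q(3) False walk_below[OF p(2)] walk_below[OF q(2)]]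
      obtain n where n: "par_arrow n m1" "par_arrow n m2" "\<And>j. xseq n !! j \<le> xseq l !! j" by metis
      have "l \<in> Par" "n \<in> Par" using p(2) n(1) walk_Par par_arrow_Par by auto
      with walk_exists n(3) obtain r where r: "F.awalk l r n" by blast
      have "length (r @ [(n, m1)]) = N" "length p1 = N" "length q1 = N"
        using p q len Suc.hyps(2) walk_sum_list[OF p(2)] walk_sum_list[OF walk_snoc[OF r n(1)]] by auto
      note IH = Suc.hyps(1)[OF this(2)[symmetric] p(2) walk_snoc[OF r n(1)]]
        Suc.hyps(1)[OF this(3)[symmetric] q(2) walk_snoc[OF r n(2)]]
      have "cls (Poly_Mapping.single (l, p) 1) = cls (Poly_Mapping.single (l, (r @ [(n, m1)]) @ [(m1, m)]) 1)"
        unfolding p(1) using IH(1) p(2) walk_snoc[OF r n(1)] last[OF p(3)] by (rule cls_append)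
      also have "\<dots> = cls (Poly_Mapping.single (l, r @ [(n, m1), (m1, m)]) 1)" by simp
      also have "\<dots> = cls (Poly_Mapping.single (l, r @ [(n, m2), (m2, m)]) 1)"
      proof (rule cls_prepend[OF _ r])
        show "cls (Poly_Mapping.single (n, [(n, m1), (m1, m)]) 1) =
            cls (Poly_Mapping.single (n, [(n, m2), (m2, m)]) 1)"
          using subsetD[OF F_rel_subset F_rel.square[OF n(1) p(3) n(2) q(3)]]
          by (simp add: cls_eq_iff arrows_def)
      qed
      also have "\<dots> = cls (Poly_Mapping.single (l, (r @ [(n, m2)]) @ [(m2, m)]) 1)" by simp
      also have "\<dots> = cls (Poly_Mapping.single (l, q) 1)"
        unfolding q(1) using IH(2)[symmetric] walk_snoc[OF r n(2)] q(2) last[OF q(3)] by (rule cls_append)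
      finally show ?thesis .
    qed
  qed
  then show ?thesis by (simp add: cls_eq_iff)
qed

end

text \<open>In terms of shapes, \<open>m\<close> minus \<open>l\<close> is a horizontal strip.\<close>

definition strip :: "nat list \<Rightarrow> nat list \<Rightarrow> bool" where
  "strip l m \<longleftrightarrow> (\<forall>j. xseq l !! j - 2 \<le> xseq m !! j \<and> xseq m !! j \<le> xseq l !! j)"

text \<open>The last lowered entry of \<open>m\<close> can always be raised. By the time it is lowered by 4, it can be
  raised twice in a row, which gives a path ending in a vertical domino.\<close>

lemma (in young_quotient) walk_class_zero:
  assumes "F.awalk l p m" "\<not> strip l m"
  shows "Poly_Mapping.single (l, p) 1 \<in> J"
proof -
  obtain k where k: "xseq m !! k + 2 < xseq l !! k"
    using assms(2) walk_below[OF assms(1)] unfolding strip_def by (metis not_le less_diff_eq)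
  \<comment> \<open>By \<open>walk_class_unique\<close> it is enough that some walk to
    \<open>m\<close> vanishes.\<close>
  have "\<exists>q. F.awalk l q m \<and> vanishes (l, q)"
    using walk_Par[OF assms(1)] walk_below[OF assms(1)] k
  proof (induction "sum_list m" arbitrary: m rule: less_induct)
    case less
    then have Par: "l \<in> Par" "m \<in> Par" and neq: "m \<noteq> l" by auto
    from raise_last[OF Par neq less.prems(2)] obtain n i where
      n: "par_arrow n m" "\<And>j. xseq n !! j = xseq m !! j + (if j = i then 2 else 0)"
      "\<And>j. xseq n !! j \<le> xseq l !! j" "xseq m !! Suc i = xseq l !! Suc i" by metis
    have last: "F.awalk n [(n, m)] m"
      using n(1) by (simp add: F.awalk_Cons_iff F.awalk_Nil_iff par_arrow_Par)
    show ?case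
    proof (cases "i = k")
      case True
      have nP: "n \<in> Par" using n(1) par_arrow_Par by blast
      have ev: "even (xseq m !! k)" "even (xseq l !! k)"
        using Par[THEN xseq_IM] by (auto simp: IM_iff)
      then have le: "xseq m !! k + 4 \<le> xseq l !! k" using less.prems(3) by presburger
      have "xseq l !! k < xseq l !! Suc k" using Par(1)[THEN xseq_IM] by (simp add: IM_iff)
      then have "xseq n !! k + 2 < xseq n !! Suc k" using n(2)[of k] n(2)[of "Suc k"] n(4) le True by simp
      from raise_Par[OF nP this] obtain n' where
        n': "par_arrow n' n" "\<And>j. xseq n' !! j = xseq n !! j + (if j = k then 2 else 0)" by metis
      have "xseq n' !! j \<le> xseq l !! j" for j using n'(2)[of j] n(2)[of j] n(3)[of j] le True by auto
      then obtain q where q: "F.awalk l q n'" using walk_exists[OF Par(1)] n'(1) par_arrow_Par by blast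
      have "vertical_domino (cells m - cells n')"
      proof (subst vertical_domino_iff)
        show "xseq n !! j = xseq n' !! j - (if j = k then 2 else 0)" for j using n'(2)[of j] by simp
        show "xseq m !! j = xseq n !! j - (if j = k then 2 else 0)" for j using n(2)[of j] True by simp
      qed (use Par(2) par_arrow_Par[OF n'(1)] in simp_all)
      from subsetD[OF F_rel_subset F_rel.domino[OF n'(1) n(1) this]]
      have "vanishes (n', [(n', n), (n, m)])" by (simp add: vanishes_def arrows_def)
      from vanishes_prepend[OF this q] have "vanishes (l, q @ [(n', n), (n, m)])" .
      moreover have "F.awalk l (q @ [(n', n), (n, m)]) m"
        using walk_snoc[OF walk_snoc[OF q n'(1)] n(1)] by simp
      ultimately show ?thesis by blast
    next
      case False
      \<comment> \<open>Raising another entry leaves the entry \<open>k\<close> lowered by 4, so the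
        induction hypothesis applies to \<open>n\<close>.\<close>
      then have "xseq n !! k + 2 < xseq l !! k" using n(2)[of k] less.prems(3) by simp
      with less.hyps[of n] n Par obtain q where q: "F.awalk l q n" "vanishes (l, q)"
        using par_arrow_sum_list[OF n(1)] par_arrow_Par[OF n(1)] by auto
      with vanishes_append[OF q(2) q(1) last] walk_snoc[OF q(1) n(1)] show ?thesis by blast
    qed
  qed
  then obtain q where q: "F.awalk l q m" "vanishes (l, q)" by blast
  then have "Poly_Mapping.single (l, p) 1 - Poly_Mapping.single (l, q) 1
      + Poly_Mapping.single (l, q) 1 \<in> J"
    using walk_class_unique[OF assms(1) q(1)] by (intro ideal_add) (simp_all add: vanishes_def)
  then show ?thesis by simp
qed

section \<open>The map from \<open>F\<close> to \<open>R\<close>\<close>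

definition lower :: "int stream \<Rightarrow> nat \<Rightarrow> int stream" where
  "lower x k = stake k x @- (x !! k - 2) ## sdrop (Suc k) x"

definition dot_at :: "int stream \<Rightarrow> nat \<Rightarrow> diagram" where
  "dot_at x k = (stake k x, Dot (x !! k - 2), sdrop (Suc k) x)"

lemma sdrop_Suc_snth: "sdrop (Suc k) x !! j = x !! (Suc k + j)"
  by (rule sdrop_snth)

lemma shift_Stream_snth:
  "(w @- i ## z) !! j = (if j < length w then w ! j else if j = length w then i else z !! (j - Suc (length w)))"
proof -
  consider "j < length w" | "j = length w" | d where "j = Suc (length w + d)"
    using less_imp_Suc_add by (metis linorder_neqE_nat)
  then show ?thesis
  proof cases
    case 3
    then have j: "length w \<le> j" "j - length w = Suc d" "j - Suc (length w) = d" by auto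
    then have "(w @- i ## z) !! j = (i ## z) !! Suc d" by (metis shift_snth_ge)
    with j show ?thesis by (auto simp: snth_Stream)
  qed simp_all
qed

lemma lower_nth [simp]: "lower x k !! j = x !! j - (if j = k then 2 else 0)"
  unfolding lower_def shift_Stream_snth sdrop_Suc_snth by (auto simp: stake_nth)

lemma lower_shift [simp]: "lower (w @- i ## z) (length w) = w @- (i - 2) ## z"
  by (rule stream_eqI) (auto simp: shift_Stream_snth)

lemma dot_at_shift [simp]: "dot_at (w @- i ## z) (length w) = (w, Dot (i - 2), z)"
  by (simp add: dot_at_def stake_shift sdrop_shift shift_Stream_snth del: sdrop.simps)
    (simp add: sdrop.simps Suc_diff_le)

lemma split_at: obtains w i z where "x = w @- i ## z" "length w = k"
  using that[of "stake k x" "x !! k" "sdrop (Suc k) x"] id_stake_snth_sdrop[of x k] by simp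

lemma dot_at_quiver:
  assumes "x \<in> Mseq"
  shows "dot_at x k \<in> arcs R_quiver" "tail R_quiver (dot_at x k) = x"
    "head R_quiver (dot_at x k) = lower x k"
proof -
  obtain w i z where "x = w @- i ## z" "length w = k" by (rule split_at)
  with assms show "dot_at x k \<in> arcs R_quiver" "tail R_quiver (dot_at x k) = x"
    "head R_quiver (dot_at x k) = lower x k"
    by auto
qed

text \<open>A dot changes exactly the entry at its own position, so bottom and top determine the
  diagram.\<close>

lemma single_dot_diagrams_lower:
  assumes "x \<in> Mseq"
  shows "single_dot_diagrams x (lower x k) = {dot_at x k}"
proof
  show "{dot_at x k} \<subseteq> single_dot_diagrams x (lower x k)"
    using dot_at_quiver[OF assms] by (auto simp: single_dot_diagrams_def dot_at_def)
  show "single_dot_diagrams x (lower x k) \<subseteq> {dot_at x k}"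
  proof
    fix e assume "e \<in> single_dot_diagrams x (lower x k)"
    then obtain a i z where e: "e = (a, Dot i, z)" "x = a @- (i + 2) ## z" "a @- i ## z = lower x k"
      by (auto simp: single_dot_diagrams_def)
    have "(a @- i ## z) !! length a \<noteq> x !! length a" by (simp add: e(2) shift_Stream_snth)
    then have "k = length a" unfolding e(3) by (auto split: if_splits)
    then show "e \<in> {dot_at x k}" using e(1,2) by simp
  qed
qed

text \<open>For an arrow the two sequences differ at exactly one index, the column of the added
  box.\<close>

definition dot_diagram :: "nat list \<times> nat list \<Rightarrow> diagram" where
  "dot_diagram e = dot_at (xseq (fst e)) (THE k. xseq (snd e) !! k \<noteq> xseq (fst e) !! k)"

lemma par_arrow_lower:
  assumes "par_arrow l m"
  obtains k where "xseq m = lower (xseq l) k" "dot_diagram (l, m) = dot_at (xseq l) k"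
proof -
  obtain k where k: "\<forall>j. xseq m !! j = xseq l !! j - (if j = k then 2 else 0)"
    using assms unfolding par_arrow_iff by blast
  then have "(THE k. xseq m !! k \<noteq> xseq l !! k) = k" by (intro the_equality) (auto split: if_splits)
  moreover have "xseq m = lower (xseq l) k" using k by (intro stream_eqI) simp
  ultimately show thesis by (intro that) (auto simp: dot_diagram_def)
qed

lemma xseq_Mseq: "l \<in> Par \<Longrightarrow> xseq l \<in> Mseq"
  by (intro IM_Mseq xseq_IM)

lemma dot_diagram_walk:
  assumes "F.awalk l p m"
  shows "R.awalk (xseq l) (map dot_diagram p) (xseq m)"
  using assms
proof (induction p arbitrary: m rule: rev_induct)
  case Nil
  then show ?case by (auto simp: F.awalk_Nil_iff R.awalk_Nil_iff xseq_Mseq)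
next
  case (snoc e p)
  from snoc.prems obtain n where n: "e = (n, m)" "F.awalk l p n" "par_arrow n m" by (rule walk_snocE)
  then obtain k where k: "xseq m = lower (xseq n) k" "dot_diagram e = dot_at (xseq n) k"
    by (metis par_arrow_lower)
  have "n \<in> Par" "m \<in> Par" using n(3) par_arrow_Par by auto
  then have "R.awalk (xseq n) [dot_diagram e] (xseq m)"
    using dot_at_quiver[of "xseq n" k] k xseq_Mseq[of n] xseq_Mseq[of m]
    by (simp add: R.awalk_Cons_iff R.awalk_Nil_iff)
  with snoc.IH[OF n(2)] show ?case by (auto intro: R.awalk_appendI)
qed

section \<open>The homomorphism of path algebras\<close>

definition dot_map :: "((nat list, nat list \<times> nat list) path \<Rightarrow>\<^sub>0 'k::field)
    \<Rightarrow> ((int stream, diagram) path \<Rightarrow>\<^sub>0 'k)" where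
  "dot_map = lext (\<lambda>(l, p) c. Poly_Mapping.single (xseq l, map dot_diagram p) c)"

lemma dot_map_single [simp]:
  "dot_map (Poly_Mapping.single (l, p) c) = Poly_Mapping.single (xseq l, map dot_diagram p) c"
  by (simp add: dot_map_def)

lemma dot_map_zero [simp]: "dot_map 0 = 0"
  by (simp add: dot_map_def)

lemma dot_map_add: "dot_map (f + g) = dot_map f + dot_map g"
  unfolding dot_map_def by (rule lext_add) (auto simp: single_add)

lemma dot_map_diff: "dot_map (f - g) = dot_map f - dot_map g"
  using dot_map_add[of "f - g" g] by simp

lemma dot_map_smul: "dot_map (smul c f) = smul c (dot_map f)"
proof -
  have "Poly_Mapping.keys f \<subseteq> UNIV" by simp
  then show ?thesis
    by (induction rule: poly_mapping_keys_induct) (auto simp: smul_add dot_map_add)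
qed

lemma dot_map_keys:
  "Poly_Mapping.keys f \<subseteq> paths Gamma \<Longrightarrow> Poly_Mapping.keys (dot_map f) \<subseteq> paths R_quiver"
proof (induction rule: poly_mapping_keys_induct)
  case (single a c)
  then obtain l p m where "a = (l, p)" "F.awalk l p m" by (auto simp: paths_def)
  with dot_diagram_walk show ?case by (auto simp: paths_def)
qed (auto simp: dot_map_add keys_add_subset)

text \<open>Since \<open>xseq\<close> is injective on partitions, paths that do not compose still do
  not compose after the map.\<close>

lemma dot_map_mult:
  assumes "Poly_Mapping.keys f \<subseteq> paths Gamma" "Poly_Mapping.keys g \<subseteq> paths Gamma"
  shows "dot_map (path_mult Gamma f g) = path_mult R_quiver (dot_map f) (dot_map g)"
  using assms(1)
proof (induction rule: poly_mapping_keys_induct)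
  case (single a c)
  then obtain l p m where a: "a = (l, p)" "F.awalk l p m" by (auto simp: paths_def)
  show ?case using assms(2)
  proof (induction rule: poly_mapping_keys_induct)
    case (single b d)
    then obtain l' q m' where b: "b = (l', q)" "F.awalk l' q m'" by (auto simp: paths_def)
    have "m = l' \<longleftrightarrow> xseq m = xseq l'"
      using walk_Par[OF a(2)] walk_Par[OF b(2)] by (auto simp: xseq_eq_iff)
    with a b awalk_awlast[OF a(2)] awalk_awlast[OF dot_diagram_walk[OF a(2)]] show ?case
      by (simp add: path_mult_single)
  qed (simp_all add: path_mult_add_right dot_map_add)
qed (simp_all add: path_mult_add_left dot_map_add)

text \<open>Supercommutation of two dots; their degree is 0, so there is no sign.\<close>

lemma dots_commute:
  assumes "x \<in> Mseq" "k < k'"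
  shows "Poly_Mapping.single (x, [dot_at x k, dot_at (lower x k) k']) (1 :: 'k::field)
    - Poly_Mapping.single (x, [dot_at x k', dot_at (lower x k') k]) 1 \<in> R_ideal"
proof -
  obtain a i r where x: "x = a @- i ## r" "length a = k" by (rule split_at)
  obtain c j z where r: "r = c @- j ## z" "length c = k' - Suc k" by (rule split_at)
  have k: "k = length a" "k' = length (a @ i # c)" "k' = length (a @ (i - 2) # c)"
    using x r assms(2) by auto
  have x': "x = (a @ i # c) @- j ## z" by (simp add: x r)
  have "dot_at x k = (a, Dot (i - 2), c @- j ## z)" "lower x k = (a @ (i - 2) # c) @- j ## z"
    unfolding k(1) x(1) r(1) dot_at_shift lower_shift by simp_all
  moreover from this(2) have "dot_at (lower x k) k' = (a @ (i - 2) # c, Dot (j - 2), z)"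
    unfolding k(3) by (simp only: dot_at_shift)
  moreover have "dot_at x k' = (a @ i # c, Dot (j - 2), z)"
    unfolding k(2) x' by (simp only: dot_at_shift)
  moreover have "lower x k' = a @- i ## c @- (j - 2) ## z"
    unfolding k(2) x' lower_shift by simp
  moreover from this have "dot_at (lower x k') k = (a, Dot (i - 2), c @- (j - 2) ## z)"
    unfolding k(1) by (simp only: dot_at_shift)
  ultimately show ?thesis
    using R_rel_ideal[OF R_rel.supercommute[of a c z "Dot (i - 2)" "Dot (j - 2)", where 'k = 'k]] assms(1)
    unfolding x r by (simp add: arrows_def)
qed

lemma dots_square_zero:
  assumes "x \<in> Mseq"
  shows "Poly_Mapping.single (x, [dot_at x k, dot_at (lower x k) k]) (1 :: 'k::field) \<in> R_ideal"
proof -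
  obtain a i z where x: "x = a @- i ## z" "k = length a" by (metis split_at)
  have "arrows R_quiver [(a, Dot (i - 4 + 2), z), (a, Dot (i - 4), z)] \<in> (R_ideal :: (_ \<Rightarrow>\<^sub>0 'k) set)"
    using assms x by (intro R_rel_ideal R_rel.double_dot) auto
  then show ?thesis by (simp add: x arrows_def)
qed

lemma dot_map_F_rel:
  assumes "f \<in> F_rel"
  shows "dot_map f \<in> (R_ideal :: (_ \<Rightarrow>\<^sub>0 'k::field) set)"
  using assms
proof (cases rule: F_rel.cases)
  case (square l m h n)
  obtain k1 where k1: "xseq m = lower (xseq l) k1" "dot_diagram (l, m) = dot_at (xseq l) k1"
    using square(2) by (rule par_arrow_lower)
  obtain k2 where k2: "xseq h = lower (xseq m) k2" "dot_diagram (m, h) = dot_at (xseq m) k2"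
    using square(3) by (rule par_arrow_lower)
  obtain k3 where k3: "xseq n = lower (xseq l) k3" "dot_diagram (l, n) = dot_at (xseq l) k3"
    using square(4) by (rule par_arrow_lower)
  obtain k4 where k4: "xseq h = lower (xseq n) k4" "dot_diagram (n, h) = dot_at (xseq n) k4"
    using square(5) by (rule par_arrow_lower)
  have P: "l \<in> Par" "m \<in> Par" "n \<in> Par" using square par_arrow_Par by auto
  note x = xseq_Mseq[OF P(1)]
  have f: "dot_map f = Poly_Mapping.single (xseq l, [dot_at (xseq l) k1, dot_at (lower (xseq l) k1) k2]) 1
      - Poly_Mapping.single (xseq l, [dot_at (xseq l) k3, dot_at (lower (xseq l) k3) k4]) 1"
    by (simp add: square(1) arrows_def dot_map_diff k1 k2 k3 k4)
  \<comment> \<open>Both sides of the square lower the same entries in total, so \<open>k1\<close>,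
    \<open>k2\<close> and \<open>k3\<close>, \<open>k4\<close> agree up to order.\<close>
  have eq: "(if j = k1 then 2 else 0) + (if j = k2 then 2 else 0) =
      (if j = k3 then 2 else 0) + (if j = k4 then 2 else (0::int))" for j
  proof -
    have "xseq h !! j = xseq h !! j" ..
    then show ?thesis by (subst (asm) k2, subst (asm) k4) (simp add: k1 k3)
  qed
  then consider "k1 = k3" "k2 = k4" | "k1 = k4" "k2 = k3" "k1 < k2" | "k1 = k4" "k2 = k3" "k2 < k1"
    using eq[of k1] eq[of k2] eq[of k3] by (fastforce split: if_splits)
  then show ?thesis
  proof cases
    case 1
    then show ?thesis by (simp add: f R.ideal_zero)
  next
    case 2
    with dots_commute[OF x 2(3)] show ?thesis by (simp add: f)
  next
    case 3
    with R.ideal_diff_commute[OF dots_commute[OF x 3(3)]] show ?thesis by (simp add: f)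
  qed
next
  case (domino l m h)
  obtain k where k: "xseq m = lower (xseq l) k" "dot_diagram (l, m) = dot_at (xseq l) k"
    using domino(2) by (rule par_arrow_lower)
  obtain k' where k': "xseq h = lower (xseq m) k'" "dot_diagram (m, h) = dot_at (xseq m) k'"
    using domino(3) by (rule par_arrow_lower)
  have P: "l \<in> Par" "h \<in> Par" using domino par_arrow_Par by auto
  have "k = k'"
    using domino(4) vertical_domino_iff[OF P, of m k k'] by (simp add: k(1) k'(1))
  then show ?thesis
    using dots_square_zero[OF xseq_Mseq[OF P(1)], of k] by (simp add: domino(1) arrows_def k k')
qed

lemma dot_map_F_ideal:
  assumes "f \<in> F_ideal"
  shows "dot_map f \<in> (R_ideal :: (_ \<Rightarrow>\<^sub>0 'k::field) set)"
proof -
  let ?K = "{f :: (nat list, nat list \<times> nat list) path \<Rightarrow>\<^sub>0 'k.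
    Poly_Mapping.keys f \<subseteq> paths Gamma \<and> dot_map f \<in> R_ideal}"
  have "F.ideal ?K"
    by (rule F.idealI)
      (auto simp only: mem_Collect_eq dot_map_zero R.ideal_zero dot_map_add R.ideal_add dot_map_smul
        R.ideal_smul keys_add_subset F.path_mult_closed dot_map_mult dot_map_keys
        R.ideal_mult_left R.ideal_mult_right keys_zero empty_subsetI keys_smul_mono)
  moreover have "F_rel \<subseteq> ?K" using F_rel_car dot_map_F_rel by fastforce
  ultimately have "F_ideal \<subseteq> ?K" unfolding F_ideal_def by (rule F.ideal_gen_least)
  with assms show ?thesis by blast
qed

section \<open>Independence of the products of dots\<close>

definition strip_state :: "nat list \<Rightarrow> nat list \<Rightarrow> strand stream" where
  "strip_state l m = smap (\<lambda>j. (xseq l !! j, xseq m !! j \<noteq> xseq l !! j)) (fromN 0)"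

lemma strip_state_nth [simp]:
  "strip_state l m !! j = (xseq l !! j, xseq m !! j \<noteq> xseq l !! j)"
  by (simp add: strip_state_def)

lemma coeff_dot_at: "coeff (dot_at x k) s = (if snd (s !! k) then 0 else 1)"
  by (simp add: dot_at_def)

lemma next_state_dot_at:
  "next_state (dot_at x k) s !! j = (if j = k then (fst (s !! k), True) else s !! j)"
  by (simp add: dot_at_def shift_Stream_snth stake_nth sdrop_Suc_snth del: sdrop.simps)

lemma xseq_even: "l \<in> Par \<Longrightarrow> even (xseq l !! j)"
  using xseq_IM by (simp add: IM_iff)

lemma xseq_strict_mono: "l \<in> Par \<Longrightarrow> strict_mono ((!!) (xseq l))"
  using xseq_IM by (simp add: IM_iff strict_mono_Suc_iff)

text \<open>Entries are even, so on a strip each entry is kept or lowered by exactly 2, and a single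
  dot records this.\<close>

lemma strip_state_lab:
  assumes "strip l m" "l \<in> Par" "m \<in> Par"
  shows "smap lab (strip_state l m) = xseq m"
proof (rule stream_eqI)
  fix j
  have "xseq l !! j - 2 \<le> xseq m !! j" "xseq m !! j \<le> xseq l !! j" using assms(1) by (auto simp: strip_def)
  moreover have "even (xseq l !! j)" "even (xseq m !! j)" using assms by (auto simp: xseq_even)
  ultimately have "xseq m !! j = xseq l !! j \<or> xseq m !! j = xseq l !! j - 2" by presburger
  then show "smap lab (strip_state l m) !! j = xseq m !! j" by (auto simp: lab_def)
qed

lemma strip_state_valid: "l \<in> Par \<Longrightarrow> valid (strip_state l m)"
  using xseq_strict_mono[of l] by (simp add: valid_def strict_mono_imp_inj_on)

lemma strip_refl: "strip l l"
  by (simp add: strip_def)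

text \<open>Along a walk entries only fall, so the entry \<open>k\<close> can be lowered within the
  strips only if it still has its value in \<open>l\<close>.\<close>

lemma strip_lower:
  assumes "F.awalk l p n" "xseq m = lower (xseq n) k"
  shows "strip l m \<longleftrightarrow> strip l n \<and> xseq n !! k = xseq l !! k"
proof
  assume *: "strip l m"
  have "xseq l !! j - 2 \<le> xseq n !! j" for j
  proof -
    have "xseq l !! j - 2 \<le> xseq m !! j" using * by (simp add: strip_def)
    also have "\<dots> \<le> xseq n !! j" by (simp add: assms(2))
    finally show ?thesis .
  qed
  moreover have "xseq l !! k \<le> xseq n !! k"
    using *[unfolded strip_def, rule_format, of k] assms(2) by simp
  ultimately show "strip l n \<and> xseq n !! k = xseq l !! k"
    using walk_below[OF assms(1)] by (simp add: strip_def order.antisym)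
qed (use assms(2) in \<open>auto simp: strip_def\<close>)

text \<open>Dots act without signs, and a walk puts a second dot on some strand exactly when it
  leaves the strips.\<close>

lemma dot_diagram_action:
  assumes "F.awalk l p m"
  shows "coeffs (map dot_diagram p) (strip_state l l) = (if strip l m then 1 else 0 :: 'k::field) \<and>
    (strip l m \<longrightarrow> next_states (map dot_diagram p) (strip_state l l) = strip_state l m)"
  using assms
proof (induction p arbitrary: m rule: rev_induct)
  case Nil
  then show ?case by (auto simp: F.awalk_Nil_iff strip_refl)
next
  case (snoc e p)
  from snoc.prems obtain n where n: "e = (n, m)" "F.awalk l p n" "par_arrow n m" by (rule walk_snocE)
  then obtain k where k: "xseq m = lower (xseq n) k" "dot_diagram e = dot_at (xseq n) k"
    by (metis par_arrow_lower)
  have "next_state (dot_at (xseq n) k) (strip_state l n) = strip_state l m"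
    if "xseq n !! k = xseq l !! k"
    using that by (intro stream_eqI) (auto simp: next_state_dot_at k(1))
  with snoc.IH[OF n(2)] strip_lower[OF n(2) k(1)] show ?case
    by (auto simp: coeffs_append next_states_append k(2) coeff_dot_at)
qed

interpretation F: young_quotient F_ideal
  by unfold_locales (auto simp: F_ideal_def F.ideal_gen_superset[THEN subsetD])

lemma rep_dot_map:
  "rep (dot_map f) \<phi> s = (\<Sum>(l, p)\<in>Poly_Mapping.keys f.
    rep (Poly_Mapping.single (xseq l, map dot_diagram p) (Poly_Mapping.lookup f (l, p))) \<phi> s)"
  unfolding dot_map_def lext_def rep_sum by (intro sum.cong) auto

text \<open>The terms of \<open>f\<close> are grouped by their end points. In a group that is a
  strip all walks are congruent, so only the sum of the coefficients matters, and the representation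
  shows that it is zero. The walks of any other group lie in the ideal.\<close>

lemma dot_map_inj:
  fixes f :: "(nat list, nat list \<times> nat list) path \<Rightarrow>\<^sub>0 'k::field"
  assumes f: "Poly_Mapping.keys f \<subseteq> paths Gamma" and zero: "dot_map f \<in> R_ideal"
  shows "f \<in> F_ideal"
proof -
  define ends where "ends = (\<lambda>(l, p). (l, F.awlast l p))"
  let ?K = "Poly_Mapping.keys f"
  let ?A = "\<lambda>b. {a \<in> ?K. ends a = b}"
  have walk: "F.awalk l p m" if "(l', p) \<in> ?K" "ends (l', p) = (l, m)" for l l' p m
    using that f awalk_awlast by (auto simp: paths_def ends_def)
  have coeff: "(\<Sum>a\<in>?A (l, m). Poly_Mapping.lookup f a) = 0" if lm: "strip l m" "l \<in> Par" "m \<in> Par" for l m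
  proof -
    \<comment> \<open>The indicator of \<open>strip_state l m\<close>, evaluated from the undotted
      state of \<open>l\<close>, selects the walks from \<open>l\<close> to
      \<open>m\<close>.\<close>
    let ?\<phi> = "\<lambda>s. if s = strip_state l m then 1 else 0 :: 'k"
    have "rep (Poly_Mapping.single (xseq l', map dot_diagram p) c) ?\<phi> (strip_state l l)
        = (if ends (l', p) = (l, m) then c else 0)" if lp: "(l', p) \<in> ?K" for l' p c
    proof -
      obtain m' where m': "ends (l', p) = (l', m')" "F.awalk l' p m'"
        using walk[OF lp, of l' "F.awlast l' p"] by (simp add: ends_def)
      have P: "l' \<in> Par" "m' \<in> Par" using walk_Par[OF m'(2)] by auto
      have "strip_state l m' = strip_state l m \<longleftrightarrow> m' = m" if "strip l m'"
        using strip_state_lab[OF that lm(2) P(2)] strip_state_lab[OF lm] xseq_eq_iff[OF P(2) lm(3)] by auto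
      then show ?thesis
        using dot_diagram_action[OF m'(2), where 'k = 'k] m'(1) lm
        by (auto simp: rep_single strip_state_valid strip_state_lab[OF strip_refl] xseq_eq_iff P)
    qed
    then have "rep (dot_map f) ?\<phi> (strip_state l l)
        = (\<Sum>a\<in>?K. if ends a = (l, m) then Poly_Mapping.lookup f a else 0)"
      unfolding rep_dot_map by (intro sum.cong) (auto split: prod.splits)
    also have "\<dots> = (\<Sum>a\<in>?A (l, m). Poly_Mapping.lookup f a)"
      by (simp add: sum.inter_filter)
    finally show ?thesis using rep_R_ideal[OF zero] by simp
  qed
  have part: "(\<Sum>a\<in>?A b. Poly_Mapping.single a (Poly_Mapping.lookup f a)) \<in> F_ideal" if b: "b \<in> ends ` ?K" for b
  proof -
    obtain l m where lm: "b = (l, m)" by fastforce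
    obtain p0 where p0: "(l, p0) \<in> ?A b" using b lm by (auto simp: ends_def)
    then have w0: "F.awalk l p0 m" using walk lm by auto
    have w: "\<exists>p. a = (l, p) \<and> F.awalk l p m" if "a \<in> ?A b" for a
      using that walk lm by (cases a) (auto simp: ends_def)
    show ?thesis
    proof (cases "strip l m")
      case True
      have "Poly_Mapping.single a (Poly_Mapping.lookup f a)
          = smul (Poly_Mapping.lookup f a) (Poly_Mapping.single a 1 - Poly_Mapping.single (l, p0) 1)
            + Poly_Mapping.single (l, p0) (Poly_Mapping.lookup f a)" for a
        by (simp add: smul_diff)
      then have "(\<Sum>a\<in>?A b. Poly_Mapping.single a (Poly_Mapping.lookup f a))
          = (\<Sum>a\<in>?A b. smul (Poly_Mapping.lookup f a) (Poly_Mapping.single a 1 - Poly_Mapping.single (l, p0) 1))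
            + Poly_Mapping.single (l, p0) (\<Sum>a\<in>?A b. Poly_Mapping.lookup f a)"
        by (simp add: single_sum flip: sum.distrib)
      also have "(\<Sum>a\<in>?A b. Poly_Mapping.lookup f a) = 0"
        using coeff[OF True] walk_Par[OF w0] lm by simp
      finally have eq: "(\<Sum>a\<in>?A b. Poly_Mapping.single a (Poly_Mapping.lookup f a))
          = (\<Sum>a\<in>?A b. smul (Poly_Mapping.lookup f a) (Poly_Mapping.single a 1 - Poly_Mapping.single (l, p0) 1))"
        by simp
      have "smul (Poly_Mapping.lookup f a) (Poly_Mapping.single a 1 - Poly_Mapping.single (l, p0) 1) \<in> F_ideal"
        if "a \<in> ?A b" for a
        using w[OF that] F.walk_class_unique[OF _ w0] by (blast intro: F.ideal_smul)
      then show ?thesis unfolding eq by (rule F.ideal_sum)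
    next
      case False
      have "Poly_Mapping.single a (Poly_Mapping.lookup f a) \<in> F_ideal" if "a \<in> ?A b" for a
        using w[OF that] F.ideal_smul[OF F.walk_class_zero[OF _ False], of _ "Poly_Mapping.lookup f a"] by auto
      then show ?thesis by (rule F.ideal_sum)
    qed
  qed
  have "f = (\<Sum>b\<in>ends ` ?K. \<Sum>a\<in>?A b. Poly_Mapping.single a (Poly_Mapping.lookup f a))"
    using sum_singles[of f] sum.image_gen[of ?K "\<lambda>a. Poly_Mapping.single a (Poly_Mapping.lookup f a)" ends]
    by simp
  also have "\<dots> \<in> F_ideal" using part by (rule F.ideal_sum)
  finally show ?thesis .
qed

section \<open>The isomorphism\<close>

context state_space
begin

lemma stake_strip_state_base:
  assumes "xseq l = X @- t"
  shows "stake (length X) (strip_state l l) = base"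
proof -
  have "strip_state l l = smap (\<lambda>i. (i, False)) (xseq l)" by (intro stream_eqI) simp
  then show ?thesis by (simp add: assms base_def stake_shift)
qed

text \<open>This makes products of dots paths of moves, so that \<open>ups_unique\<close> can
  compare them with normal forms.\<close>

lemma dot_diagrams_ups:
  assumes "xseq l = X @- t" "F.awalk l r m" "strip l m" "\<forall>j\<ge>length X. xseq m !! j = xseq l !! j"
  shows "ups t base (map dot_diagram r) (stake (length X) (strip_state l m))"
  using assms(2-4)
proof (induction r arbitrary: m rule: rev_induct)
  case Nil
  then have "m = l" by (simp add: F.awalk_Nil_iff)
  with stake_strip_state_base[OF assms(1)] show ?case by (simp add: ups_Nil)
next
  case (snoc e r)
  let ?N = "length X"
  from snoc.prems(1) obtain n where n: "e = (n, m)" "F.awalk l r n" "par_arrow n m" by (rule walk_snocE)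
  from n obtain k where k: "xseq m = lower (xseq n) k" "dot_diagram e = dot_at (xseq n) k"
    by (metis par_arrow_lower)
  have strip: "strip l n" "xseq n !! k = xseq l !! k"
    using strip_lower[OF n(2) k(1)] snoc.prems(2) by auto
  have agree: "xseq n !! j = xseq l !! j" if "j \<ge> ?N" for j
    using walk_below[OF n(2), of j] par_arrow_below[OF n(3), of j] snoc.prems(3) that
    by (metis order.antisym)
  have "k < ?N"
  proof (rule ccontr)
    assume "\<not> k < ?N"
    then have "xseq m !! k = xseq l !! k" using snoc.prems(3) by simp
    then show False using strip(2) k(1) by simp
  qed
  then obtain d where d: "?N = Suc (k + d)" by (metis less_imp_Suc_add)
  define s where "s = strip_state l n"
  define u v where "u = stake k s" and "v = stake d (sdrop (Suc k) s)"
  define l0 where "l0 = xseq l !! k"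
  have sk: "s !! k = (l0, False)" by (simp add: s_def l0_def strip(2))
  have s: "s = u @- (l0, False) ## v @- sdrop ?N s"
  proof -
    have "sdrop (Suc k) s = v @- sdrop ?N s"
      unfolding v_def d by (metis sdrop_add stake_sdrop add_Suc)
    then show ?thesis unfolding u_def sk[symmetric] by (metis id_stake_snth_sdrop)
  qed
  have lab: "smap lab s = xseq n"
    unfolding s_def using strip(1) walk_Par[OF n(2)] by (intro strip_state_lab) auto
  have t: "smap lab (sdrop ?N s) = t"
  proof (rule stream_eqI)
    fix j
    have "smap lab (sdrop ?N s) !! j = xseq n !! (?N + j)"
      using lab by (metis sdrop_smap sdrop_snth)
    also have "\<dots> = t !! j" using agree[of "?N + j"] assms(1) by simp
    finally show "smap lab (sdrop ?N s) !! j = t !! j" .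
  qed
  have len: "length u = k" "length v = d" by (simp_all add: u_def v_def)
  have n': "xseq n = map lab u @- l0 ## map lab v @- t"
    unfolding lab[symmetric] by (subst s) (simp add: t)
  have "dot_at (xseq n) k = (map lab u, Dot (l0 - 2), map lab v @- t)"
    unfolding n' using dot_at_shift[of "map lab u" l0 "map lab v @- t"] len by simp
  moreover have "strip_state l m = u @- (l0, True) ## v @- sdrop ?N s"
  proof (rule stream_eqI)
    fix j
    have "strip_state l m !! j = (if j = k then (l0, True) else s !! j)"
      using strip(2) by (auto simp: k(1) s_def l0_def)
    moreover have "(u @- (l0, True) ## v @- sdrop ?N s) !! j = (if j = k then (l0, True) else s !! j)"
      using arg_cong[OF s, of "\<lambda>z. z !! j"] by (simp add: shift_Stream_snth len)
    ultimately show "strip_state l m !! j = (u @- (l0, True) ## v @- sdrop ?N s) !! j" by simp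
  qed
  moreover have "stake ?N (u @- p ## v @- r') = u @ p # v" for p and r' :: "strand stream"
    by (simp add: d stake_shift len)
  moreover have "ups t base (map dot_diagram r) (stake ?N s)"
    unfolding s_def using n(2) strip(1) agree by (intro snoc.IH) auto
  ultimately show ?case
    using ups_snoc[OF _ up_dot[of t u l0 v]] s k(2) by simp (metis)
qed

lemma state_strip:
  assumes "xseq l = X @- t" "l \<in> Par" "m \<in> Par" "state w" "xseq m = map lab w @- t"
  shows "strip l m" "w = stake (length X) (strip_state l m)"
    "\<forall>j\<ge>length X. xseq m !! j = xseq l !! j"
proof -
  have len: "length w = length X" using assms(4) by (rule state_length)
  have nth_m: "xseq m !! i = lab (w ! i)" if "i < length X" for i using that assms(5) len by simp
  have nth_l: "xseq l !! i = X ! i" if "i < length X" for i using that assms(1) by simp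
  \<comment> \<open>Labels at the top grow by at least 2 and a dot lowers a label by 2, so undoing
    the dots cannot reverse the order of two neighbours.\<close>
  have "fst (w ! i) \<le> fst (w ! Suc i)" if "Suc i < length X" for i
  proof -
    have "xseq m !! i + 2 \<le> xseq m !! Suc i" using xseq_IM[OF assms(3)] by (rule IM_step)
    then have "lab (w ! i) + 2 \<le> lab (w ! Suc i)" using nth_m that by simp
    then show ?thesis by (auto simp: lab_def split: if_splits)
  qed
  then have "sorted (map fst w)" by (simp add: sorted_iff_nth_Suc len)
  then have "map fst w = X" using assms(4) by (rule sorted_state[rotated])
  then have fst_w: "fst (w ! i) = xseq l !! i" if "i < length X" for i
    using nth_l[OF that] that len by (metis nth_map)
  show tl: "\<forall>j\<ge>length X. xseq m !! j = xseq l !! j" using assms(1,5) len by simp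
  have "xseq l !! j - 2 \<le> xseq m !! j \<and> xseq m !! j \<le> xseq l !! j" for j
  proof (cases "j < length X")
    case True
    then show ?thesis using fst_w[OF True] nth_m[OF True] by (auto simp: lab_def)
  qed (use tl in simp)
  then show "strip l m" by (simp add: strip_def)
  show "w = stake (length X) (strip_state l m)"
  proof (rule nth_equalityI)
    fix i assume "i < length w"
    then have i: "i < length X" using len by simp
    show "w ! i = stake (length X) (strip_state l m) ! i"
      using fst_w[OF i] nth_m[OF i] i by (cases "w ! i") (auto simp: stake_nth lab_def)
  qed (simp add: len)
qed

text \<open>The normal form and any product of dots from \<open>l\<close> to \<open>m\<close> end in
  the same state, so they are proportional.\<close>

lemma IM_walk:
  assumes "xseq l = X @- t" "l \<in> Par" "m \<in> Par" "awalk (X @- t) p (xseq m)"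
    "\<forall>(a, g, z)\<in>set p. length a + length (bot_word g) \<le> length X"
  shows "vanishes (xseq l, p) \<or>
    (\<exists>r. F.awalk l r m \<and> proportional (xseq l, p) (xseq l, map dot_diagram r))"
proof -
  from walk_normal_form[OF assms(4,5)] consider "vanishes (xseq l, p)"
    | w q where "ups t base q w" "xseq m = map lab w @- t" "proportional (xseq l, p) (xseq l, q)"
    using assms(1) by auto
  then show ?thesis
  proof cases
    case (2 w q)
    note w = state_strip[OF assms(1-3) ups_state[OF 2(1)] 2(2)]
    obtain r where r: "F.awalk l r m"
      using walk_exists[OF assms(2,3)] w(1) by (auto simp: strip_def)
    have "ups t base (map dot_diagram r) w"
      using dot_diagrams_ups[OF assms(1) r w(1) w(3)] w(2) by simp
    from ups_unique[OF 2(1) this] 2(3) have "proportional (xseq l, p) (xseq l, map dot_diagram r)"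
      unfolding assms(1)[symmetric] by (metis proportional_trans)
    with r show ?thesis by blast
  qed blast
qed

end

lemma (in diagram_quotient) walk_between_IM:
  assumes "l \<in> Par" "m \<in> Par" "awalk (xseq l) p (xseq m)"
  shows "vanishes (xseq l, p) \<or>
    (\<exists>r. F.awalk l r m \<and> proportional (xseq l, p) (xseq l, map dot_diagram r))"
proof -
  \<comment> \<open>A crude bound for the number of strands involved in \<open>p\<close>: the sum of
    the positions at which its diagrams end.\<close>
  define N where "N = sum_list (map (\<lambda>(a, g, z). length a + length (bot_word g)) p)"
  define X t where "X = stake N (xseq l)" and "t = sdrop N (xseq l)"
  have x: "xseq l = X @- t" by (simp add: X_def t_def stake_sdrop)
  have "X @- t \<in> Mseq" using xseq_Mseq[OF assms(1)] x by simp
  then have ev: "X \<in> even_words" "t \<in> Mseq" by auto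
  have "sorted_wrt (<) X"
    using xseq_strict_mono[OF assms(1)]
    by (auto simp: sorted_wrt_iff_nth_less X_def stake_nth strict_mono_def)
  with ev interpret state_space J X t by unfold_locales
  have "\<forall>(a, g, z)\<in>set p. length a + length (bot_word g) \<le> length X"
    using member_le_sum_list[of _ "map (\<lambda>(a, g, z). length a + length (bot_word g)) p"]
    by (fastforce simp: X_def N_def)
  with assms x show ?thesis by (intro IM_walk) auto
qed

text \<open>Only paths from \<open>xseq l\<close> to \<open>xseq m\<close> survive between the two
  idempotents, and each of them vanishes or is a multiple of a product of dots.\<close>

lemma (in diagram_quotient) corner_in_dot_map:
  fixes f :: "(int stream, diagram) path \<Rightarrow>\<^sub>0 'k"
  assumes "l \<in> Par" "m \<in> Par" "Poly_Mapping.keys f \<subseteq> paths R_quiver"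
  shows "\<exists>g. Poly_Mapping.keys g \<subseteq> paths Gamma \<and>
    path_mult R_quiver (path_mult R_quiver (idem (xseq l)) f) (idem (xseq m)) - dot_map g \<in> J"
  using assms(3)
proof (induction rule: poly_mapping_keys_induct)
  case zero
  show ?case by (intro exI[of _ 0]) (simp add: ideal_zero)
next
  case (add f f')
  then obtain g g' where g: "Poly_Mapping.keys g \<subseteq> paths Gamma" "Poly_Mapping.keys g' \<subseteq> paths Gamma"
    "path_mult R_quiver (path_mult R_quiver (idem (xseq l)) f) (idem (xseq m)) - dot_map g \<in> J"
    "path_mult R_quiver (path_mult R_quiver (idem (xseq l)) f') (idem (xseq m)) - dot_map g' \<in> J"
    by blast
  from ideal_add[OF g(3,4)] g(1,2) show ?case
    by (intro exI[of _ "g + g'"])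
      (simp add: path_mult_add_left path_mult_add_right dot_map_add keys_add_subset algebra_simps)
next
  case (single a c)
  obtain u p y where a: "a = (u, p)" "awalk u p y" using single by (auto simp: paths_def)
  show ?case
  proof (cases "u = xseq l \<and> y = xseq m")
    case True
    then have prod: "path_mult R_quiver (path_mult R_quiver (idem (xseq l)) (Poly_Mapping.single a c)) (idem (xseq m))
        = Poly_Mapping.single (xseq l, p) c"
      using a awalk_awlast[OF a(2)] by (simp add: idem_def path_mult_single)
    from walk_between_IM[OF assms(1,2), of p] a(2) True
    consider "vanishes (xseq l, p)" | r where "F.awalk l r m"
      "proportional (xseq l, p) (xseq l, map dot_diagram r)"
      by blast
    then show ?thesis
    proof cases
      case 1
      then have "smul c (Poly_Mapping.single (xseq l, p) 1) \<in> J"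
        unfolding vanishes_def by (rule ideal_smul)
      then show ?thesis unfolding prod by (intro exI[of _ 0]) simp
    next
      case (2 r)
      then obtain d where "Poly_Mapping.single (xseq l, p) 1
          - Poly_Mapping.single (xseq l, map dot_diagram r) d \<in> J"
        by (auto simp: proportional_def)
      from ideal_smul[OF this, of c] 2(1) show ?thesis
        unfolding prod
        by (intro exI[of _ "Poly_Mapping.single (l, r) (c * d)"]) (auto simp: smul_diff paths_def)
    qed
  next
    case False
    then have "path_mult R_quiver (path_mult R_quiver (idem (xseq l)) (Poly_Mapping.single a c)) (idem (xseq m)) = 0"
      using a awalk_awlast[OF a(2)] by (auto simp: idem_def path_mult_single)
    then show ?thesis by (intro exI[of _ 0]) (simp add: ideal_zero)
  qed
qed

section \<open>The corner subalgebra and the induced map\<close>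

interpretation R: diagram_quotient R_ideal
  by unfold_locales (auto intro: R_rel_ideal)

lemma R_class_cls: "R_class = R.cls"
  by (simp add: R_class_def fun_eq_iff)

lemma F_class_cls: "F_class = F.cls"
  by (simp add: F_class_def fun_eq_iff)

lemma idem_path: "x \<in> Mseq \<Longrightarrow> Poly_Mapping.keys (idem x) \<subseteq> paths R_quiver"
  by (auto simp: idem_def paths_def R.awalk_Nil_iff)

lemma mul_R_alg:
  assumes "Poly_Mapping.keys f \<subseteq> paths R_quiver" "Poly_Mapping.keys g \<subseteq> paths R_quiver"
  shows "mul R_alg (R_class f) (R_class g) = R_class (path_mult R_quiver f g)"
  using assms unfolding R_alg_def R_class_cls by (rule R.mul_quot)

lemma add_R_alg: "add R_alg (R_class f) (R_class g) = R_class (f + g)"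
  unfolding R_alg_def R_class_cls by (rule R.add_quot)

lemma scl_R_alg: "scl R_alg c (R_class f) = R_class (smul c f)"
  unfolding R_alg_def R_class_cls by (rule R.scl_quot)

lemma zer_R_alg: "zer R_alg = R_class 0"
  unfolding R_alg_def R_class_cls by (rule R.zer_quot)

lemma car_R_alg: "car R_alg = R_class ` {f. Poly_Mapping.keys f \<subseteq> paths R_quiver}"
  unfolding R_alg_def R_class_cls by (rule R.car_quot)

lemma corner_product:
  assumes "x \<in> Mseq" "y \<in> Mseq" "Poly_Mapping.keys f \<subseteq> paths R_quiver"
  shows "mul R_alg (mul R_alg (R_class (idem x)) (R_class f)) (R_class (idem y)) =
    R_class (path_mult R_quiver (path_mult R_quiver (idem x) f) (idem y))"
  using assms by (simp add: mul_R_alg idem_path R.path_mult_closed)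

text \<open>Corner products are images of \<open>dot_map\<close> by the spanning result. Conversely,
  a product of dots is unchanged by the idempotents at its ends, so it is a corner product
  itself.\<close>

lemma car_H_tilde:
  "car (H_tilde :: (_, 'k::field) nualgebra) =
    (\<lambda>f. R_class (dot_map f)) ` {f. Poly_Mapping.keys f \<subseteq> paths Gamma}" (is "_ = ?V")
proof -
  let ?S = "\<Union>x\<in>IM 0. \<Union>y\<in>IM 0.
    {mul R_alg (mul R_alg (R_class (idem x)) r) (R_class (idem y)) | r. r \<in> car (R_alg :: (_, 'k) nualgebra)}"
  have "?S \<subseteq> ?V"
  proof
    fix X assume "X \<in> ?S"
    then obtain x y and f :: "(int stream, diagram) path \<Rightarrow>\<^sub>0 'k" where X: "x \<in> IM 0" "y \<in> IM 0"
      "Poly_Mapping.keys f \<subseteq> paths R_quiver"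
      "X = mul R_alg (mul R_alg (R_class (idem x)) (R_class f)) (R_class (idem y))"
      by (auto simp: car_R_alg)
    obtain l m where lm: "l \<in> Par" "m \<in> Par" "xseq l = x" "xseq m = y"
      using IM_xseq X(1,2) by metis
    obtain g where g: "Poly_Mapping.keys g \<subseteq> paths Gamma"
      "path_mult R_quiver (path_mult R_quiver (idem x) f) (idem y) - dot_map g \<in> R_ideal"
      using R.corner_in_dot_map[OF lm(1,2) X(3)] lm(3,4) by auto
    have "X = R_class (dot_map g)"
      unfolding X(4) corner_product[OF X(1)[THEN IM_Mseq] X(2)[THEN IM_Mseq] X(3)]
      using g(2) by (simp add: R_class_cls R.cls_eq_iff)
    with g(1) show "X \<in> ?V" by blast
  qed
  moreover have "subspace_of R_alg ?V"
    unfolding subspace_of_def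
  proof (intro conjI ballI allI)
    show "?V \<subseteq> car R_alg" by (auto simp: car_R_alg dot_map_keys)
    show "zer R_alg \<in> ?V" unfolding zer_R_alg by (rule image_eqI[of _ _ 0]) auto
    fix X Y c assume "X \<in> ?V" "Y \<in> ?V"
    then obtain f g :: "(nat list, nat list \<times> nat list) path \<Rightarrow>\<^sub>0 'k" where
      "Poly_Mapping.keys f \<subseteq> paths Gamma" "X = R_class (dot_map f)"
      "Poly_Mapping.keys g \<subseteq> paths Gamma" "Y = R_class (dot_map g)" by blast
    then show "add R_alg X Y \<in> ?V"
      by (intro image_eqI[of _ _ "f + g"]) (simp_all add: add_R_alg dot_map_add keys_add_subset)
  next
    fix c X assume "X \<in> ?V"
    then obtain f :: "(nat list, nat list \<times> nat list) path \<Rightarrow>\<^sub>0 'k" where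
      "Poly_Mapping.keys f \<subseteq> paths Gamma" "X = R_class (dot_map f)" by blast
    then show "scl R_alg c X \<in> ?V"
      by (intro image_eqI[of _ _ "smul c f"]) (simp_all add: scl_R_alg dot_map_smul keys_smul_mono)
  qed
  moreover have "R_class (dot_map f) \<in> W"
    if W: "subspace_of R_alg W" "?S \<subseteq> W" and f: "Poly_Mapping.keys f \<subseteq> paths Gamma"
    for W and f :: "(nat list, nat list \<times> nat list) path \<Rightarrow>\<^sub>0 'k"
    using f
  proof (induction rule: poly_mapping_keys_induct)
    case zero
    show ?case using W(1) by (simp add: subspace_of_def zer_R_alg)
  next
    case (add f g)
    then show ?case using W(1) by (simp add: subspace_of_def dot_map_add flip: add_R_alg)
  next
    case (single a c)
    then obtain l p m where a: "a = (l, p)" "F.awalk l p m" by (auto simp: paths_def)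
    let ?f = "Poly_Mapping.single (xseq l, map dot_diagram p) c"
    have P: "l \<in> Par" "m \<in> Par" using walk_Par[OF a(2)] by auto
    have keys: "Poly_Mapping.keys ?f \<subseteq> paths R_quiver"
      using dot_diagram_walk[OF a(2)] by (auto simp: paths_def)
    have "mul R_alg (mul R_alg (R_class (idem (xseq l))) (R_class ?f)) (R_class (idem (xseq m)))
        = R_class ?f"
      using corner_product[OF xseq_Mseq[OF P(1)] xseq_Mseq[OF P(2)] keys]
        awalk_awlast[OF dot_diagram_walk[OF a(2)]]
      by (simp add: idem_def path_mult_single)
    moreover have "mul R_alg (mul R_alg (R_class (idem (xseq l))) (R_class ?f)) (R_class (idem (xseq m))) \<in> ?S"
    proof -
      have "R_class ?f \<in> car R_alg" unfolding car_R_alg using keys by blast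
      then show ?thesis using xseq_IM[OF P(1)] xseq_IM[OF P(2)] by blast
    qed
    ultimately have "R_class ?f \<in> ?S" by (simp only:)
    with W(2) have "R_class ?f \<in> W" by (rule subsetD)
    then show ?case by (simp add: a(1))
  qed
  ultimately have "linspan R_alg ?S = ?V"
    unfolding linspan_def by (intro equalityI) auto
  then show ?thesis by (simp add: H_tilde_def)
qed

text \<open>Any representative will do, because \<open>dot_map\<close> takes \<open>F_ideal\<close>
  into \<open>R_ideal\<close>.\<close>

definition F_iso :: "((nat list, nat list \<times> nat list) path \<Rightarrow>\<^sub>0 'k::field) set
    \<Rightarrow> ((int stream, diagram) path \<Rightarrow>\<^sub>0 'k) set" where
  "F_iso X = R_class (dot_map (SOME f. f \<in> X))"

lemma F_iso_class: "F_iso (F_class f) = R_class (dot_map f)"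
proof -
  have "(SOME f'. f' \<in> F_class f) \<in> F_class f"
    unfolding F_class_cls by (rule someI) (rule F.cls_self)
  then have "(SOME f'. f' \<in> F_class f) - f \<in> F_ideal"
    by (simp add: F_class_cls F.mem_cls)
  from dot_map_F_ideal[OF this] show ?thesis
    by (simp add: F_iso_def R_class_cls R.cls_eq_iff dot_map_diff)
qed

lemma algebra_iso_F_iso: "algebra_iso F_alg (H_tilde :: (_, 'k::field) nualgebra) F_iso"
proof -
  let ?P = "{f :: (nat list, nat list \<times> nat list) path \<Rightarrow>\<^sub>0 'k. Poly_Mapping.keys f \<subseteq> paths Gamma}"
  have car_F: "car F_alg = F_class ` ?P"
    unfolding F_alg_def F_class_cls by (rule F.car_quot)
  have H: "add H_tilde = add (R_alg :: (_, 'k) nualgebra)" "mul H_tilde = mul (R_alg :: (_, 'k) nualgebra)"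
    "scl H_tilde = scl (R_alg :: (_, 'k) nualgebra)"
    by (simp_all add: H_tilde_def)
  have "inj_on F_iso (F_class ` ?P)"
  proof (rule inj_onI; elim imageE; clarify)
    fix f g :: "(nat list, nat list \<times> nat list) path \<Rightarrow>\<^sub>0 'k"
    assume fg: "Poly_Mapping.keys f \<subseteq> paths Gamma" "Poly_Mapping.keys g \<subseteq> paths Gamma"
      and eq: "F_iso (F_class f) = F_iso (F_class g)"
    have "dot_map (f - g) \<in> R_ideal"
      using eq unfolding F_iso_class R_class_cls R.cls_eq_iff dot_map_diff .
    with fg have "f - g \<in> F_ideal" by (intro dot_map_inj keys_diff_subset)
    then show "F_class f = F_class g" by (simp add: F_class_cls F.cls_eq_iff)
  qed
  moreover have "F_iso ` (F_class ` ?P) = car H_tilde"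
    by (simp add: car_H_tilde image_image F_iso_class)
  ultimately have "bij_betw F_iso (car F_alg) (car (H_tilde :: (_, 'k) nualgebra))"
    by (simp add: bij_betw_def car_F)
  moreover have "F_iso (add F_alg X Y) = add H_tilde (F_iso X) (F_iso Y)"
    if "X \<in> F_class ` ?P" "Y \<in> F_class ` ?P" for X Y
  proof -
    obtain f g where "f \<in> ?P" "g \<in> ?P" "X = F_class f" "Y = F_class g" using \<open>X \<in> _\<close> \<open>Y \<in> _\<close> by blast
    moreover have "add F_alg (F_class f) (F_class g) = F_class (f + g)"
      unfolding F_alg_def F_class_cls by (rule F.add_quot)
    ultimately show ?thesis by (simp add: H F_iso_class add_R_alg dot_map_add)
  qed
  moreover have "F_iso (mul F_alg X Y) = mul H_tilde (F_iso X) (F_iso Y)"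
    if "X \<in> F_class ` ?P" "Y \<in> F_class ` ?P" for X Y
  proof -
    obtain f g where fg: "f \<in> ?P" "g \<in> ?P" "X = F_class f" "Y = F_class g" using \<open>X \<in> _\<close> \<open>Y \<in> _\<close> by blast
    moreover have "mul F_alg (F_class f) (F_class g) = F_class (path_mult Gamma f g)"
      using fg(1,2) unfolding F_alg_def F_class_cls by (intro F.mul_quot) auto
    ultimately show ?thesis by (simp add: H F_iso_class mul_R_alg dot_map_mult dot_map_keys)
  qed
  moreover have "F_iso (scl F_alg c X) = scl H_tilde c (F_iso X)" if "X \<in> F_class ` ?P" for c X
  proof -
    obtain f where "f \<in> ?P" "X = F_class f" using \<open>X \<in> _\<close> by blast
    moreover have "scl F_alg c (F_class f) = F_class (smul c f)"
      unfolding F_alg_def F_class_cls by (rule F.scl_quot)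
    ultimately show ?thesis by (simp add: H F_iso_class scl_R_alg dot_map_smul)
  qed
  ultimately show ?thesis by (simp add: algebra_iso_def car_F)
qed

theorem proposition4p4:
  shows "bij_betw xseq Par (IM 0) \<and>
    (\<exists>\<Phi>. algebra_iso
           (F_alg :: (((nat list, nat list \<times> nat list) path \<Rightarrow>\<^sub>0 'k::field_char_0) set, 'k) nualgebra)
           H_tilde \<Phi> \<and>
         (\<forall>l\<in>Par. \<Phi> (F_class (idem l)) = R_class (idem (xseq l))) \<and>
         (\<forall>l m. par_arrow l m \<longrightarrow>
            (\<exists>e. single_dot_diagrams (xseq l) (xseq m) = {e} \<and>
                 \<Phi> (F_class (arrows Gamma [(l, m)])) = R_class (arrows R_quiver [e]))))"
proof (intro conjI exI ballI allI impI)
  show "bij_betw xseq Par (IM 0)" by (rule bij_betw_xseq)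
  show "algebra_iso (F_alg :: (_, 'k) nualgebra) H_tilde F_iso" by (rule algebra_iso_F_iso)
  show "F_iso (F_class (idem l)) = R_class (idem (xseq l))" for l
    by (simp add: F_iso_class idem_def)
  fix l m assume "par_arrow l m"
  then obtain k where k: "xseq m = lower (xseq l) k" "dot_diagram (l, m) = dot_at (xseq l) k"
    by (rule par_arrow_lower)
  have x: "xseq l \<in> Mseq" using \<open>par_arrow l m\<close> par_arrow_Par xseq_Mseq by blast
  show "single_dot_diagrams (xseq l) (xseq m) = {dot_diagram (l, m)}"
    unfolding k by (rule single_dot_diagrams_lower[OF x])
  show "F_iso (F_class (arrows Gamma [(l, m)])) = R_class (arrows R_quiver [dot_diagram (l, m)])"
    by (simp add: F_iso_class arrows_def k(2) dot_at_quiver(2)[OF x])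
qed

end
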